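(* Assume high-resolution scalar transform coding with optimal bit allocation and marginal entropy coding. Let $R\succ0$ on $\mathcal{H}=\bigoplus_\rho\mathcal{H}_\rho$, let $R_0=\sum_\rho P_\rho RP_\rho$ be its block-diagonal part, and let $U_G$ be the blockwise group transform. Under this model the distortion of an orthonormal transform $U$ at fixed rate is proportional to the geometric mean of its coordinate variances $\bigl(\prod_i(URU^\ast)_{ii}\bigr)^{1/M}$, which the Karhunen–Loève transform (KLT) of $R$ minimizes. The multiplicative distortion penalty of $U_G$ relative to the optimal KLT is exactly $$G=\Bigl(\frac{\det R_0}{\det R}\Bigr)^{1/M}=\exp\Bigl(\frac{2C}{M}\Bigr)\ge1,\qquad C=\tfrac12\Bigl(\sum_\rho\log\det A_\rho-\log\det R\Bigr),$$ where $C$ is the Gaussian multi-information (total correlation) among the isotypic sectors, with equality if and only if $R$ is weakly symmetric ($E=0$). Equivalently, at fixed distortion the excess coding rate of $U_G$ over the rate-distortion bound is exactly $C$ nats, independent of the rate.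
   Context: $\mathcal{H}$ is $M$-dimensional, and $\mathcal{H}=\bigoplus_\rho\mathcal{H}_\rho$ is the decomposition into isotypic components (sectors) of a unitary representation of a group $G$ (the group, not to be confused with the penalty $G$), with orthogonal projections $P_\rho$. $R$ is a covariance on $\mathcal{H}$, $A_\rho=P_\rho RP_\rho$ (regarded as an operator on $\mathcal{H}_\rho$), and $E=R-R_0=\sum_{\rho\neq\rho'}P_\rho RP_{\rho'}$ is the off-sector part. The blockwise group transform $U_G$ uses, on each sector $\mathcal{H}_\rho$, the orthonormal eigenvectors of $A_\rho$; it is the KLT of $R_0$. The KLT of $R$ is the transform to an orthonormal eigenbasis of $R$. $URU^\ast$ is the covariance of the transform coefficients. The Gaussian multi-information among the sectors is $\sum_\rho h(X_\rho)-h(X)$ for jointly Gaussian $X$ with covariance $R$ and $X_\rho=P_\rho X$, with $h$ the differential entropy.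
   Formalization: H is taken to be a real space (unitary means orthogonal): for complex circular Gaussian X the multi-information is 2C, not C, so the claim as written holds only for real signals. *)

theory Defs
  imports "HOL-Algebra.Group" "HOL-Probability.Probability"
begin

section \<open>Positive definite matrices, orthonormal bases, projections, determinants on subspaces\<close>

definition pos_def :: "real^'n^'n \<Rightarrow> bool" where
  "pos_def R \<longleftrightarrow> transpose R = R \<and> (\<forall>x. x \<noteq> 0 \<longrightarrow> x \<bullet> (R *v x) > 0)"

definition orthonormal_basis_of :: "('a::euclidean_space) set \<Rightarrow> 'a set \<Rightarrow> bool" where
  "orthonormal_basis_of S B \<longleftrightarrow>
     pairwise orthogonal B \<and> (\<forall>b\<in>B. norm b = 1) \<and> span B = S"

definition some_onb :: "('a::euclidean_space) set \<Rightarrow> 'a set" where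
  "some_onb S = (SOME B. orthonormal_basis_of S B)"

definition orth_proj :: "(real^'n) set \<Rightarrow> real^'n^'n" where
  "orth_proj S = (THE P. P ** P = P \<and> transpose P = P \<and> range ((*v) P) = S)"

text \<open>The determinant of the operator that \<open>A\<close> induces on the subspace \<open>S\<close> (for \<open>A\<close> mapping
  \<open>S\<close> into itself): the Leibniz formula for the matrix \<open>(b \<bullet> A b')\<close>, where \<open>b\<close>, \<open>b'\<close> run over an
  orthonormal basis of \<open>S\<close>. The value does not depend on the basis.\<close>

definition det_on :: "(real^'n) set \<Rightarrow> real^'n^'n \<Rightarrow> real" where
  "det_on S A =
     (\<Sum>p | p permutes some_onb S.
        of_int (sign p) * (\<Prod>b\<in>some_onb S. b \<bullet> (A *v p b)))"

section \<open>Unitary representations and their isotypic components\<close>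

text \<open>The Hilbert space is the real space \<open>\<real>\<^sup>M\<close> with \<open>M = CARD('n)\<close>, so the unitary operators are
  the orthogonal matrices and adjoints are transposes.\<close>

definition unitary_rep :: "('g, 'm) monoid_scheme \<Rightarrow> ('g \<Rightarrow> real^'n^'n) \<Rightarrow> bool" where
  "unitary_rep G \<pi> \<longleftrightarrow>
     (\<forall>g\<in>carrier G. orthogonal_matrix (\<pi> g)) \<and>
     \<pi> \<one>\<^bsub>G\<^esub> = mat 1 \<and>
     (\<forall>g\<in>carrier G. \<forall>h\<in>carrier G. \<pi> (g \<otimes>\<^bsub>G\<^esub> h) = \<pi> g ** \<pi> h)"

definition subrep :: "('g, 'm) monoid_scheme \<Rightarrow> ('g \<Rightarrow> real^'n^'n) \<Rightarrow> (real^'n) set \<Rightarrow> bool" where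
  "subrep G \<pi> S \<longleftrightarrow> subspace S \<and> (\<forall>g\<in>carrier G. \<forall>x\<in>S. \<pi> g *v x \<in> S)"

definition irreducible_subrep ::
    "('g, 'm) monoid_scheme \<Rightarrow> ('g \<Rightarrow> real^'n^'n) \<Rightarrow> (real^'n) set \<Rightarrow> bool" where
  "irreducible_subrep G \<pi> S \<longleftrightarrow>
     subrep G \<pi> S \<and> S \<noteq> {0} \<and> (\<forall>T. subrep G \<pi> T \<and> T \<subseteq> S \<longrightarrow> T = {0} \<or> T = S)"

definition isomorphic_subreps ::
    "('g, 'm) monoid_scheme \<Rightarrow> ('g \<Rightarrow> real^'n^'n) \<Rightarrow> (real^'n) set \<Rightarrow> (real^'n) set \<Rightarrow> bool" where
  "isomorphic_subreps G \<pi> S T \<longleftrightarrow>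
     (\<exists>f. linear f \<and> bij_betw f S T \<and> (\<forall>g\<in>carrier G. \<forall>x\<in>S. f (\<pi> g *v x) = \<pi> g *v f x))"

definition isotypic_component ::
    "('g, 'm) monoid_scheme \<Rightarrow> ('g \<Rightarrow> real^'n^'n) \<Rightarrow> (real^'n) set \<Rightarrow> (real^'n) set" where
  "isotypic_component G \<pi> S =
     span (\<Union>{T. irreducible_subrep G \<pi> T \<and> isomorphic_subreps G \<pi> S T})"

text \<open>A sector is identified with the subspace itself; isomorphic irreducible subrepresentations
  yield the same element of this set. The set is finite, since distinct sectors are orthogonal.\<close>

definition sectors :: "('g, 'm) monoid_scheme \<Rightarrow> ('g \<Rightarrow> real^'n^'n) \<Rightarrow> (real^'n) set set" where
  "sectors G \<pi> = isotypic_component G \<pi> ` {S. irreducible_subrep G \<pi> S}"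

section \<open>Block-diagonal part, weak symmetry, Karhunen--Loeve and group transforms\<close>

definition compression :: "real^'n^'n \<Rightarrow> (real^'n) set \<Rightarrow> real^'n^'n" where
  "compression R S = orth_proj S ** R ** orth_proj S"

definition block_diag_part ::
    "('g, 'm) monoid_scheme \<Rightarrow> ('g \<Rightarrow> real^'n^'n) \<Rightarrow> real^'n^'n \<Rightarrow> real^'n^'n" where
  "block_diag_part G \<pi> R = (\<Sum>S\<in>sectors G \<pi>. compression R S)"

definition off_sector_part ::
    "('g, 'm) monoid_scheme \<Rightarrow> ('g \<Rightarrow> real^'n^'n) \<Rightarrow> real^'n^'n \<Rightarrow> real^'n^'n" where
  "off_sector_part G \<pi> R = R - block_diag_part G \<pi> R"

definition weakly_symmetric ::
    "('g, 'm) monoid_scheme \<Rightarrow> ('g \<Rightarrow> real^'n^'n) \<Rightarrow> real^'n^'n \<Rightarrow> bool" where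
  "weakly_symmetric G \<pi> R \<longleftrightarrow> off_sector_part G \<pi> R = 0"

text \<open>A transform is an orthogonal matrix \<open>U\<close> whose rows are the transform vectors: the
  coefficients of \<open>x\<close> are \<open>U *v x\<close>. Eigenbases need not be unique, so both transforms below are
  predicates.\<close>

definition is_KLT :: "real^'n^'n \<Rightarrow> real^'n^'n \<Rightarrow> bool" where
  "is_KLT R U \<longleftrightarrow>
     orthogonal_matrix U \<and> (\<forall>i. \<exists>l. R *v row i U = l *\<^sub>R row i U)"

definition is_group_transform ::
    "('g, 'm) monoid_scheme \<Rightarrow> ('g \<Rightarrow> real^'n^'n) \<Rightarrow> real^'n^'n \<Rightarrow> real^'n^'n \<Rightarrow> bool" where
  "is_group_transform G \<pi> R U \<longleftrightarrow>
     orthogonal_matrix U \<and>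
     (\<forall>i. \<exists>S\<in>sectors G \<pi>.
        row i U \<in> S \<and> (\<exists>l. compression R S *v row i U = l *\<^sub>R row i U))"

section \<open>The high-resolution transform coding model\<close>

definition coeff_var :: "real^'n^'n \<Rightarrow> real^'n^'n \<Rightarrow> 'n \<Rightarrow> real" where
  "coeff_var R U i = (U ** R ** transpose U) $ i $ i"

definition geo_mean_var :: "real^'n^'n \<Rightarrow> real^'n^'n \<Rightarrow> real" where
  "geo_mean_var R U = (\<Prod>i\<in>UNIV. coeff_var R U i) powr (1 / real CARD('n))"

text \<open>High-resolution law: a coefficient of variance \<open>v\<close> that is scalar quantized and entropy coded
  on its own with \<open>b\<close> nats contributes distortion \<open>c * v * exp (-2 * b)\<close>. The constant \<open>c > 0\<close>
  depends on the quantizer (\<open>c = pi * exp 1 / 6\<close> for uniform quantization of Gaussian coefficients,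
  \<open>c = 1\<close> for an ideal coder at the Shannon limit). As usual in the high-resolution model, the law
  is used for every real \<open>b\<close>.\<close>

definition total_distortion :: "real \<Rightarrow> real^'n^'n \<Rightarrow> real^'n^'n \<Rightarrow> ('n \<Rightarrow> real) \<Rightarrow> real" where
  "total_distortion c R U b = (\<Sum>i\<in>UNIV. c * coeff_var R U i * exp (- 2 * b i))"

definition coding_distortion :: "real \<Rightarrow> real^'n^'n \<Rightarrow> real^'n^'n \<Rightarrow> real \<Rightarrow> real" where
  "coding_distortion c R U B =
     Inf {total_distortion c R U b | b. (\<Sum>i\<in>UNIV. b i) = B}"

definition coding_rate :: "real \<Rightarrow> real^'n^'n \<Rightarrow> real^'n^'n \<Rightarrow> real \<Rightarrow> real" where
  "coding_rate c R U D =
     Inf {(\<Sum>i\<in>UNIV. b i) | b. total_distortion c R U b \<le> D}"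

section \<open>The sector information \<open>C\<close>\<close>

definition sector_information ::
    "('g, 'm) monoid_scheme \<Rightarrow> ('g \<Rightarrow> real^'n^'n) \<Rightarrow> real^'n^'n \<Rightarrow> real" where
  "sector_information G \<pi> R =
     1/2 * ((\<Sum>S\<in>sectors G \<pi>. ln (det_on S (compression R S))) - ln (det R))"

section \<open>Gaussian vectors, multi-information and the rate-distortion function\<close>

definition gaussian_density :: "real^'n \<Rightarrow> real^'n^'n \<Rightarrow> real^'n \<Rightarrow> real" where
  "gaussian_density m R x =
     exp (- ((x - m) \<bullet> (matrix_inv R *v (x - m))) / 2) / sqrt ((2 * pi) ^ CARD('n) * det R)"

definition gaussian_measure :: "real^'n \<Rightarrow> real^'n^'n \<Rightarrow> (real^'n) measure" where
  "gaussian_measure m R = density lborel (\<lambda>x. ennreal (gaussian_density m R x))"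

definition gaussian_vector ::
    "'w measure \<Rightarrow> ('w \<Rightarrow> real^'n) \<Rightarrow> real^'n \<Rightarrow> real^'n^'n \<Rightarrow> bool" where
  "gaussian_vector \<Omega> X m R \<longleftrightarrow>
     prob_space \<Omega> \<and> distributed \<Omega> lborel X (\<lambda>x. ennreal (gaussian_density m R x))"

text \<open>Lebesgue measure of the subspace \<open>S\<close>, as a measure on the whole space concentrated on \<open>S\<close>:
  the image of the product Lebesgue measure under orthonormal coordinates.\<close>

definition lborel_on :: "('a::euclidean_space) set \<Rightarrow> 'a measure" where
  "lborel_on S =
     distr (Pi\<^sub>M (some_onb S) (\<lambda>_. lborel)) borel (\<lambda>t. \<Sum>b\<in>some_onb S. t b *\<^sub>R b)"

text \<open>Differential entropy (in nats) is the library's entropy relative to Lebesgue measure; the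
  component of \<open>X\<close> in \<open>S\<close> is measured against Lebesgue measure of \<open>S\<close>.\<close>

definition multi_information ::
    "'w measure \<Rightarrow> ('w \<Rightarrow> real^'n) \<Rightarrow> (real^'n) set set \<Rightarrow> real" where
  "multi_information \<Omega> X \<S> =
     (\<Sum>S\<in>\<S>. prob_space.entropy \<Omega> (exp 1) (lborel_on S) (\<lambda>\<omega>. orth_proj S *v X \<omega>))
     - prob_space.entropy \<Omega> (exp 1) lborel X"

text \<open>Shannon's rate-distortion function for squared error (total, not per coordinate), in nats:
  the infimum of \<open>I(X;Y)\<close> over all joint laws \<open>P\<close> of source \<open>X\<close> and reproduction \<open>Y\<close>. The library's
  \<open>mutual_information\<close> has no meaningful value where the mutual information is infinite; the
  absolute continuity and integrability conditions restrict to joint laws where it is finite.\<close>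

definition rate_distortion :: "('a::euclidean_space) measure \<Rightarrow> real \<Rightarrow> real" where
  "rate_distortion \<mu> D =
     Inf {prob_space.mutual_information P (exp 1) borel borel fst snd | P :: ('a \<times> 'a) measure.
       prob_space P \<and> sets P = sets (borel \<Otimes>\<^sub>M borel) \<and>
       distr P borel fst = \<mu> \<and>
       absolutely_continuous (distr P borel fst \<Otimes>\<^sub>M distr P borel snd) P \<and>
       integrable P (entropy_density (exp 1) (distr P borel fst \<Otimes>\<^sub>M distr P borel snd) P) \<and>
       (\<integral>\<^sup>+ z. ennreal ((norm (fst z - snd z))\<^sup>2) \<partial>P) \<le> ennreal D}"

end

theory Submission
  imports Defs
begin

text \<open>Optimal bit allocation turns the distortion and the rate of a transform \<open>U\<close> into functions of
  \<open>\<Prod>i. coeff_var R U i\<close>. For the KLT this product is \<open>det R\<close>. Distinct sectors are orthogonal by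
  Schur's lemma, so the rows of the group transform form an eigenbasis of \<open>R\<^sub>0\<close>, adapted to the
  sectors, on which \<open>R\<close> and \<open>R\<^sub>0\<close> have the same diagonal, and the product is \<open>det R\<^sub>0\<close>. Optimality of
  the KLT and the equality case are Hadamard's inequality.

  For Gaussian \<open>X\<close>, the coordinates along the rows that lie in one sector are uncorrelated, hence
  independent, so the entropy of each sector component is a sum of one-dimensional entropies. For the
  rate-distortion function with \<open>\<delta> = D / M\<close>, the Donsker--Varadhan bound is applied to
  \<open>ln (q(x|y) / f(x))\<close>, where \<open>q(\<sqdot>|y)\<close> is the density of \<open>N(y, \<delta> I)\<close> and \<open>f\<close> that of the source;
  equality holds for the joint law with backward channel \<open>q\<close> and reproduction \<open>N(m, R - \<delta> I)\<close>.\<close>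

section \<open>Indexed orthonormal bases\<close>

text \<open>The determinant and the Lebesgue measure of a subspace are defined through an arbitrary
  basis \<open>some_onb S\<close>, while all computations use the rows of \<open>U\<^sub>G\<close>
  or of \<open>V\<close>, so independence of the basis is a recurring obstacle. Both times the
  subspace is completed to the whole space, where this independence can be had: by the identity on
  the complement for determinants, by a unit cube in the complement for measures. The other obstacle
  is that coordinates in different sectors are correlated. The density of \<open>X\<close> need not
  factor along the rows of \<open>U\<^sub>G\<close>, so the law of one sector component cannot be
  read off it; whitening treats one sector at a time and leaves the completion of its rows free. In
  the comparison with Shannon's function, \<open>D / M\<close> lies below every eigenvalue, which
  keeps the variances \<open>l j - \<delta>\<close> of the reproduction positive. Every component
  then receives the same distortion, and the rate is half of
  \<open>ln (det R / \<delta> ^ CARD('n))\<close>.\<close>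

definition onb :: "('i \<Rightarrow> 'a::euclidean_space) \<Rightarrow> 'i set \<Rightarrow> 'a set \<Rightarrow> bool" where
  "onb e I S \<longleftrightarrow> finite I \<and> (\<forall>i\<in>I. \<forall>j\<in>I. e i \<bullet> e j = (if i = j then 1 else 0)) \<and> span (e ` I) = S"

lemma onb_inner: "onb e I S \<Longrightarrow> i \<in> I \<Longrightarrow> j \<in> I \<Longrightarrow> e i \<bullet> e j = (if i = j then 1 else 0)"
  by (simp add: onb_def)

lemma onb_finite: "onb e I S \<Longrightarrow> finite I"
  by (simp add: onb_def)

lemma onb_mem: "onb e I S \<Longrightarrow> i \<in> I \<Longrightarrow> e i \<in> S"
  by (auto simp: onb_def intro: span_base)

lemma onb_subspace: "onb e I S \<Longrightarrow> subspace S"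
  by (auto simp: onb_def)

lemma onb_inj_on: "onb e I S \<Longrightarrow> inj_on e I"
  by (rule inj_onI) (metis onb_inner zero_neq_one)

lemma onb_inner_sum:
  assumes "onb e I S" "j \<in> I"
  shows "e j \<bullet> (\<Sum>i\<in>I. t i *\<^sub>R e i) = t j"
proof -
  have "e j \<bullet> (\<Sum>i\<in>I. t i *\<^sub>R e i) = (\<Sum>i\<in>I. if j = i then t i else 0)"
    unfolding inner_sum_right using assms by (intro sum.cong) (auto simp: onb_inner)
  then show ?thesis
    using assms by (simp add: onb_finite)
qed

lemma onb_expand:
  assumes "onb e I S" "x \<in> S"
  shows "(\<Sum>i\<in>I. (e i \<bullet> x) *\<^sub>R e i) = x"
proof -
  have "x \<in> span (e ` I)"
    using assms by (simp add: onb_def)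
  then obtain u where "x = (\<Sum>v\<in>e ` I. u v *\<^sub>R v)"
    using span_finite[of "e ` I"] assms(1) by (auto simp: onb_def)
  then have "x = (\<Sum>i\<in>I. u (e i) *\<^sub>R e i)"
    by (simp add: sum.reindex[OF onb_inj_on[OF assms(1)]])
  then show ?thesis
    using onb_inner_sum[OF assms(1), of _ "\<lambda>i. u (e i)"] by simp
qed

lemma onb_expand_UNIV: "onb e I UNIV \<Longrightarrow> (\<Sum>i\<in>I. (e i \<bullet> x) *\<^sub>R e i) = x"
  using onb_expand by blast

lemma onb_inner_expand:
  assumes "onb e I UNIV"
  shows "x \<bullet> y = (\<Sum>i\<in>I. (e i \<bullet> x) * (e i \<bullet> y))"
proof -
  have "x \<bullet> y = (\<Sum>i\<in>I. (e i \<bullet> x) *\<^sub>R e i) \<bullet> y"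
    by (simp add: onb_expand_UNIV[OF assms])
  then show ?thesis
    by (simp add: inner_sum_left)
qed

lemma onb_ext:
  assumes "onb e I UNIV" "\<And>i. i \<in> I \<Longrightarrow> e i \<bullet> x = e i \<bullet> y"
  shows "x = y"
  by (metis (no_types, lifting) assms onb_expand_UNIV sum.cong)

lemma onb_independent:
  assumes "onb e I S"
  shows "independent (e ` I)"
proof (rule pairwise_orthogonal_independent)
  show "pairwise orthogonal (e ` I)"
    using onb_inner[OF assms] by (auto simp: pairwise_def orthogonal_def)
  show "0 \<notin> e ` I"
    using onb_inner[OF assms] by (metis imageE inner_zero_left zero_neq_one)
qed

lemma onb_card:
  assumes "onb e I S"
  shows "card I = dim S"
proof -
  have "dim S = card (e ` I)"
    using assms dim_span[of "e ` I"] dim_eq_card_independent[OF onb_independent[OF assms]]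
    by (simp add: onb_def)
  then show ?thesis
    by (simp add: card_image[OF onb_inj_on[OF assms]])
qed

lemma onb_set:
  assumes "orthonormal_basis_of S B"
  shows "onb (\<lambda>b. b) B S"
proof -
  have B: "pairwise orthogonal B" "\<And>b. b \<in> B \<Longrightarrow> norm b = 1" "span B = S"
    using assms unfolding orthonormal_basis_of_def by simp_all
  have "b \<bullet> b' = (if b = b' then 1 else 0)" if "b \<in> B" "b' \<in> B" for b b'
    using B(1) B(2)[OF that(1)] that unfolding pairwise_def orthogonal_def
    by (auto simp: dot_square_norm)
  then show ?thesis
    using pairwise_orthogonal_imp_finite[OF B(1)] B(3) by (simp add: onb_def)
qed

lemma ex_orthonormal_basis_of:
  fixes S :: "'a::euclidean_space set"
  assumes "subspace S"
  obtains B where "orthonormal_basis_of S B"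
proof -
  obtain B where "pairwise orthogonal B" "\<And>x. x \<in> B \<Longrightarrow> norm x = 1" "span B = S"
    using orthonormal_basis_subspace[OF assms] by metis
  then show thesis
    by (intro that[of B]) (auto simp: orthonormal_basis_of_def)
qed

lemma onb_some_onb: "subspace S \<Longrightarrow> onb (\<lambda>b. b) (some_onb S) S"
  unfolding some_onb_def by (rule onb_set, rule someI_ex) (metis ex_orthonormal_basis_of)

lemma onb_complement:
  fixes S :: "'a::euclidean_space set"
  obtains B' :: "'a set" where "onb (\<lambda>b. b) B' {y. \<forall>x\<in>S. x \<bullet> y = 0}"
proof -
  have "subspace {y. \<forall>x\<in>S. x \<bullet> y = 0}"
    by (auto simp: subspace_def inner_add_right)
  then obtain B where "orthonormal_basis_of {y. \<forall>x\<in>S. x \<bullet> y = 0} B"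
    by (rule ex_orthonormal_basis_of)
  then show thesis
    by (rule that[OF onb_set])
qed

section \<open>Orthogonal projection onto a subspace\<close>

definition onb_proj :: "('i \<Rightarrow> 'a::euclidean_space) \<Rightarrow> 'i set \<Rightarrow> 'a \<Rightarrow> 'a" where
  "onb_proj e I x = (\<Sum>i\<in>I. (e i \<bullet> x) *\<^sub>R e i)"

lemma onb_proj_mem: "onb e I S \<Longrightarrow> onb_proj e I x \<in> S"
  unfolding onb_proj_def
  by (intro subspace_sum subspace_scale) (auto simp: onb_subspace onb_mem)

lemma onb_proj_inner:
  assumes "onb e I S" "y \<in> S"
  shows "y \<bullet> onb_proj e I x = y \<bullet> x"
proof -
  have "y \<bullet> onb_proj e I x = (\<Sum>i\<in>I. (e i \<bullet> y) * (e i \<bullet> x))"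
    by (simp add: onb_proj_def inner_sum_right inner_commute mult.commute)
  also have "\<dots> = (\<Sum>i\<in>I. (e i \<bullet> y) *\<^sub>R e i) \<bullet> x"
    by (simp add: inner_sum_left)
  finally show ?thesis
    using onb_expand[OF assms] by simp
qed

text \<open>The conditions on \<open>p\<close> do not mention the basis, so projections are
  identified, and compared across different bases, without coordinates.\<close>

lemma onb_proj_unique:
  assumes "onb e I S" "p \<in> S" "\<And>y. y \<in> S \<Longrightarrow> y \<bullet> p = y \<bullet> x"
  shows "onb_proj e I x = p"
proof -
  have "onb_proj e I x = (\<Sum>i\<in>I. (e i \<bullet> p) *\<^sub>R e i)"
    unfolding onb_proj_def using assms(1,3) by (intro sum.cong) (auto simp: onb_mem)
  then show ?thesis
    using onb_expand[OF assms(1,2)] by simp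
qed

lemma linear_onb_proj: "linear (onb_proj e I)"
  unfolding onb_proj_def
  by (intro linear_compose_sum ballI linearI) (auto simp: inner_add_right scaleR_add_left)

text \<open>The definite description in \<^const>\<open>orth_proj\<close> is only meaningful for subspaces.\<close>

lemma orth_proj_onb:
  fixes e :: "'i \<Rightarrow> real^'n"
  assumes "onb e I S"
  shows "orth_proj S *v x = onb_proj e I x"
proof -
  let ?P = "matrix (onb_proj e I)"
  have P: "?P *v x = onb_proj e I x" for x
    using fun_cong[OF matrix_vector_mul(2)[OF linear_onb_proj], of e I x] by simp
  have idem: "onb_proj e I (onb_proj e I x) = onb_proj e I x" for x
    by (rule onb_proj_unique[OF assms onb_proj_mem[OF assms]]) simp
  have sym: "x \<bullet> onb_proj e I y = onb_proj e I x \<bullet> y" for x y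
    by (simp add: onb_proj_def inner_sum_right inner_sum_left inner_commute mult.commute)
  have symI: "transpose Q = Q" if "\<And>x y. x \<bullet> (Q *v y) = (Q *v x) \<bullet> y" for Q :: "real^'n^'n"
  proof -
    have "y \<bullet> (transpose Q *v x) = y \<bullet> (Q *v x)" for x y
      using that[of x y] by (metis dot_lmul_matrix inner_commute transpose_matrix_vector)
    then show ?thesis
      by (metis matrix_eq vector_eq_ldot)
  qed
  have "orth_proj S = ?P"
    unfolding orth_proj_def
  proof (rule the_equality, intro conjI)
    show "?P ** ?P = ?P"
      by (simp add: matrix_eq P idem flip: matrix_vector_mul_assoc)
    show "transpose ?P = ?P"
      by (rule symI) (simp add: P sym)
    have "x \<in> range ((*v) ?P)" if "x \<in> S" for x
      using onb_proj_unique[OF assms that, of x] P by (metis rangeI)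
    then show "range ((*v) ?P) = S"
      using onb_proj_mem[OF assms] P by auto
  next
    \<comment> \<open>A symmetric idempotent fixes its range pointwise, so
      \<open>y \<bullet> (Q *v x) = (Q *v y) \<bullet> x = y \<bullet> x\<close> for
      \<open>y\<close> in \<open>S\<close>, which characterises the projection.\<close>
    fix Q assume Q: "Q ** Q = Q \<and> transpose Q = Q \<and> range ((*v) Q) = S"
    have "Q *v x = ?P *v x" for x
      unfolding P
    proof (rule onb_proj_unique[OF assms, symmetric])
      show "Q *v x \<in> S"
        using Q by auto
      fix y assume "y \<in> S"
      then obtain z where "y = Q *v z"
        using Q by auto
      then have "Q *v y = y"
        using Q by (metis matrix_vector_mul_assoc)
      then show "y \<bullet> (Q *v x) = y \<bullet> x"
        using Q by (metis dot_lmul_matrix transpose_matrix_vector)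
    qed
    then show "Q = ?P"
      by (simp add: matrix_eq)
  qed
  then show ?thesis
    by (simp add: P)
qed

section \<open>Bases from orthogonal matrices, restriction and completion of bases\<close>

lemma onb_rows:
  fixes U :: "real^'n^'n"
  assumes "orthogonal_matrix U"
  shows "onb (\<lambda>i. row i U) UNIV UNIV"
proof -
  have *: "row i U \<bullet> row j U = (if i = j then 1 else 0)" for i j
    using assms by (simp add: orthogonal_matrix_orthonormal_rows norm_eq_1 orthogonal_def)
  have "rows U = range (\<lambda>i. row i U)"
    by (auto simp: rows_def)
  moreover have "span (rows U) = UNIV"
    using assms unfolding orthogonal_matrix_def
    by (metis matrix_left_invertible_span_rows)
  ultimately show ?thesis
    using * by (simp add: onb_def)
qed

lemma orthogonal_matrix_onb:
  assumes "onb e (UNIV :: 'n set) UNIV"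
  shows "orthogonal_matrix (\<chi> i. e i :: real^'n^'n)"
  using onb_inner[OF assms]
  by (auto simp: orthogonal_matrix_orthonormal_rows row_def norm_eq_1 orthogonal_def vec_lambda_eta)

text \<open>For \<open>x\<close> in \<open>T\<close> the coefficients outside \<open>J\<close>
  vanish, so the expansion of \<open>x\<close> uses only \<open>J\<close>. Applied with a sector as
  \<open>T\<close> and the rows lying in it as \<open>J\<close>.\<close>

lemma onb_subset:
  assumes "onb e I S" "J \<subseteq> I" "\<And>i. i \<in> I - J \<Longrightarrow> \<forall>x\<in>T. e i \<bullet> x = 0" "T \<subseteq> S" "subspace T" "e ` J \<subseteq> T"
  shows "onb e J T"
proof -
  have "x \<in> span (e ` J)" if "x \<in> T" for x
  proof -
    have "x = (\<Sum>i\<in>I. (e i \<bullet> x) *\<^sub>R e i)"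
      using onb_expand[OF assms(1)] assms(4) that by auto
    also have "\<dots> = (\<Sum>i\<in>J. (e i \<bullet> x) *\<^sub>R e i)"
      using assms(2,3) that by (intro sum.mono_neutral_right) (auto simp: onb_finite[OF assms(1)])
    also have "\<dots> \<in> span (e ` J)"
      by (intro span_sum span_scale span_base) auto
    finally show ?thesis .
  qed
  moreover have "span (e ` J) \<subseteq> T"
    using assms(5,6) by (metis span_minimal)
  ultimately show ?thesis
    using assms(1,2) finite_subset by (auto simp: onb_def subset_iff)
qed

text \<open>The sum type keeps the two index sets apart whatever the index type of \<open>d\<close>
  is. Spanning holds because a vector minus its projection to \<open>S\<close> lies in the
  complement.\<close>

lemma onb_case_sum:
  fixes d :: "'j \<Rightarrow> 'a::euclidean_space"
  assumes d: "onb d J S" and B': "onb (\<lambda>b. b) B' {y. \<forall>x\<in>S. x \<bullet> y = 0}"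
  shows "onb (case_sum d (\<lambda>b. b)) (Inl ` J \<union> Inr ` B') UNIV"
proof -
  let ?K = "Inl ` J \<union> Inr ` B'" and ?g = "case_sum d (\<lambda>b. b)"
  have inner: "?g i \<bullet> ?g j = (if i = j then 1 else 0)" if "i \<in> ?K" "j \<in> ?K" for i j
    using that onb_inner[OF d] onb_inner[OF B'] onb_mem[OF d] onb_mem[OF B']
    by (auto simp: inner_commute split: if_splits)
  have "x \<in> span (?g ` ?K)" for x
  proof -
    let ?p = "onb_proj d J x"
    have p: "?p \<in> S" "\<And>y. y \<in> S \<Longrightarrow> y \<bullet> ?p = y \<bullet> x"
      using onb_proj_mem[OF d] onb_proj_inner[OF d] by auto
    have "?p \<in> span (d ` J)"
      using p(1) d by (simp add: onb_def)
    moreover have "x - ?p \<in> {y. \<forall>x\<in>S. x \<bullet> y = 0}"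
      using p(2) by (simp add: inner_diff_right)
    then have "x - ?p \<in> span B'"
      using B' by (simp add: onb_def)
    moreover have "d ` J \<subseteq> ?g ` ?K" "B' \<subseteq> ?g ` ?K"
      by force+
    ultimately have "?p + (x - ?p) \<in> span (?g ` ?K)"
      by (meson span_add span_mono subsetD)
    then show ?thesis
      by simp
  qed
  then show ?thesis
    using inner onb_finite[OF d] onb_finite[OF B'] unfolding onb_def by auto
qed

section \<open>Orthogonality of the sectors\<close>

lemma isomorphic_subreps_sym:
  assumes "subrep G \<pi> S" "isomorphic_subreps G \<pi> S T"
  shows "isomorphic_subreps G \<pi> T S"
proof -
  obtain f where f: "linear f" "bij_betw f S T" "\<And>g x. g \<in> carrier G \<Longrightarrow> x \<in> S \<Longrightarrow> f (\<pi> g *v x) = \<pi> g *v f x"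
    using assms(2) unfolding isomorphic_subreps_def by blast
  have "subspace S"
    using assms(1) by (simp add: subrep_def)
  \<comment> \<open>Isomorphisms are required to be linear on the whole space, so the inverse of
    \<open>f\<close> on \<open>T\<close> is the restriction of a globally linear left
    inverse.\<close>
  then obtain h where h: "linear h" "\<And>x. x \<in> S \<Longrightarrow> h (f x) = x"
    using linear_exists_left_inverse_on[OF f(1) _ bij_betw_imp_inj_on[OF f(2)]] by blast
  have "bij_betw h T S"
    using f(2) h(2) by (intro bij_betw_byWitness[where f' = f]) (auto simp: bij_betw_def)
  moreover have "h (\<pi> g *v y) = \<pi> g *v h y" if g: "g \<in> carrier G" and y: "y \<in> T" for g y
  proof -
    obtain x where x: "x \<in> S" "y = f x"
      using bij_betw_imp_surj_on[OF f(2)] y by blast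
    then have "\<pi> g *v x \<in> S"
      using assms(1) g by (auto simp: subrep_def)
    then show ?thesis
      using f(3)[OF g x(1)] h(2) x by metis
  qed
  ultimately show ?thesis
    using h(1) unfolding isomorphic_subreps_def by blast
qed

lemma isomorphic_subreps_trans:
  assumes "isomorphic_subreps G \<pi> S T" "isomorphic_subreps G \<pi> T V"
  shows "isomorphic_subreps G \<pi> S V"
proof -
  obtain f where f: "linear f" "bij_betw f S T" "\<And>g x. g \<in> carrier G \<Longrightarrow> x \<in> S \<Longrightarrow> f (\<pi> g *v x) = \<pi> g *v f x"
    using assms(1) unfolding isomorphic_subreps_def by blast
  obtain h where h: "linear h" "bij_betw h T V" "\<And>g x. g \<in> carrier G \<Longrightarrow> x \<in> T \<Longrightarrow> h (\<pi> g *v x) = \<pi> g *v h x"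
    using assms(2) unfolding isomorphic_subreps_def by blast
  have "f x \<in> T" if "x \<in> S" for x
    using f(2) that by (auto simp: bij_betw_def)
  then show ?thesis
    unfolding isomorphic_subreps_def
    using f h by (intro exI[of _ "h \<circ> f"]) (auto simp: linear_compose bij_betw_trans)
qed

lemma sector_subspace: "A \<in> sectors G \<pi> \<Longrightarrow> subspace A"
  by (auto simp: sectors_def isotypic_component_def)

text \<open>Forces every sector to contain at least one row of the group transform, whence the
  finiteness of the set of sectors.\<close>

lemma sector_nonzero:
  assumes "A \<in> sectors G \<pi>"
  shows "A \<noteq> {0}"
proof -
  obtain S where S: "irreducible_subrep G \<pi> S" "A = isotypic_component G \<pi> S"
    using assms by (auto simp: sectors_def)
  have "isomorphic_subreps G \<pi> S S"
    unfolding isomorphic_subreps_def by (intro exI[of _ "\<lambda>x. x"]) (auto simp: bij_betw_def linear_ident)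
  then have "S \<subseteq> A"
    using S unfolding isotypic_component_def by (auto intro: span_base)
  moreover have "S \<noteq> {0}" "0 \<in> S"
    using S(1) by (auto simp: irreducible_subrep_def subrep_def subspace_0)
  ultimately show ?thesis
    by blast
qed

context
  fixes G :: "('g, 'm) monoid_scheme" and \<pi> :: "'g \<Rightarrow> real^'n^'n"
  assumes G: "Group.group G" and rep: "unitary_rep G \<pi>"
begin

lemma rep_inner:
  assumes "g \<in> carrier G"
  shows "(\<pi> g *v x) \<bullet> y = x \<bullet> (\<pi> (inv\<^bsub>G\<^esub> g) *v y)"
proof -
  interpret group G by (rule G)
  have "\<pi> g *v (\<pi> (inv\<^bsub>G\<^esub> g) *v y) = y"
    using rep assms unfolding unitary_rep_def
    by (metis inv_closed matrix_vector_mul_assoc matrix_vector_mul_lid r_inv)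
  moreover have "(\<pi> g *v x) \<bullet> (\<pi> g *v z) = x \<bullet> z" for z
    using rep assms unfolding unitary_rep_def
    by (metis orthogonal_transformation_def orthogonal_transformation_matrix matrix_of_matrix_vector_mul matrix_vector_mul_linear)
  ultimately show ?thesis
    by metis
qed

text \<open>Unitarity moves \<open>\<pi> g\<close> across the inner product as the inverse group
  element, under which \<open>S\<close> is invariant as well.\<close>

lemma subrep_complement:
  assumes "subrep G \<pi> S" "g \<in> carrier G" "\<And>y. y \<in> S \<Longrightarrow> y \<bullet> x = 0" "y \<in> S"
  shows "y \<bullet> (\<pi> g *v x) = 0"
proof -
  interpret group G by (rule G)
  have "\<pi> (inv\<^bsub>G\<^esub> g) *v y \<in> S"
    using assms unfolding subrep_def by auto
  then show ?thesis
    using rep_inner[OF assms(2), of x y] assms(3) by (metis inner_commute)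
qed

text \<open>Schur's lemma, applied to the restriction to \<open>S\<close> of the orthogonal projection onto \<open>T\<close>.\<close>

lemma irreducible_orthogonal_or_isomorphic:
  assumes S: "irreducible_subrep G \<pi> S" and T: "irreducible_subrep G \<pi> T"
    and ne: "\<not> isomorphic_subreps G \<pi> S T" and xy: "x \<in> S" "y \<in> T"
  shows "x \<bullet> y = 0"
proof (rule ccontr)
  assume xy0: "x \<bullet> y \<noteq> 0"
  have rS: "subrep G \<pi> S" "subspace S" and rT: "subrep G \<pi> T" "subspace T"
    using S T by (auto simp: irreducible_subrep_def subrep_def)
  have e: "onb (\<lambda>b. b) (some_onb T) T" (is "onb ?e ?I T")
    by (rule onb_some_onb[OF rT(2)])
  define f where "f = onb_proj ?e ?I"
  have lin: "linear f" and fT: "f z \<in> T" and fin: "z' \<in> T \<Longrightarrow> z' \<bullet> f z = z' \<bullet> z" for z z'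
    unfolding f_def by (rule linear_onb_proj, rule onb_proj_mem[OF e], rule onb_proj_inner[OF e])
  \<comment> \<open>The projection commutes with the group because both \<open>T\<close> and its
    orthogonal complement, which contains \<open>f z - z\<close>, are invariant.\<close>
  have eqv: "f (\<pi> g *v z) = \<pi> g *v f z" if g: "g \<in> carrier G" for g z
    unfolding f_def
  proof (rule onb_proj_unique[OF e], fold f_def)
    show "\<pi> g *v f z \<in> T"
      using rT g fT by (auto simp: subrep_def)
    fix w assume "w \<in> T"
    then have "w \<bullet> (\<pi> g *v (f z - z)) = 0"
      using fin by (intro subrep_complement[OF rT(1) g]) (auto simp: inner_diff_right)
    then show "w \<bullet> (\<pi> g *v f z) = w \<bullet> (\<pi> g *v z)"
      by (simp add: matrix_vector_mult_diff_distrib inner_diff_right)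
  qed
  have f0: "f 0 = 0"
    using lin by (rule linear_0)
  \<comment> \<open>The kernel in \<open>S\<close> misses \<open>x\<close>, so irreducibility makes
    it zero. In the same way the image contains \<open>f x \<noteq> 0\<close> and is therefore all
    of \<open>T\<close>.\<close>
  have "subrep G \<pi> {z \<in> S. f z = 0}"
    using rS f0 eqv linear_add[OF lin] linear_cmul[OF lin]
    by (auto simp: subrep_def subspace_def)
  moreover have "x \<notin> {z \<in> S. f z = 0}"
    using fin[OF xy(2), of x] xy0 by (auto simp: inner_commute)
  ultimately have ker: "{z \<in> S. f z = 0} = {0}"
    using S xy(1) unfolding irreducible_subrep_def by blast
  have inj: "inj_on f S"
  proof (rule inj_onI)
    fix a b assume "a \<in> S" "b \<in> S" "f a = f b"
    then have "a - b \<in> {z \<in> S. f z = 0}"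
      using rS(2) by (simp add: linear_diff[OF lin] subspace_diff)
    then show "a = b"
      using ker by auto
  qed
  have "subrep G \<pi> (f ` S)"
    using rS eqv[symmetric] by (auto simp: subrep_def linear_subspace_image[OF lin])
  moreover have "f ` S \<subseteq> T"
    using fT by auto
  moreover have "f x \<noteq> 0"
    using fin[OF xy(2), of x] xy0 by (auto simp: inner_commute)
  ultimately have "f ` S = T"
    using T xy(1) unfolding irreducible_subrep_def by blast
  then have "isomorphic_subreps G \<pi> S T"
    unfolding isomorphic_subreps_def using lin inj eqv by (auto simp: bij_betw_def)
  then show False
    using ne by simp
qed

text \<open>Isomorphic irreducibles have the same isomorphic copies. The contrapositive is what gets
  used: generators of distinct sectors are never isomorphic, so Schur's lemma makes them
  orthogonal.\<close>

lemma isotypic_component_cong: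
  assumes "irreducible_subrep G \<pi> S" "irreducible_subrep G \<pi> T" "isomorphic_subreps G \<pi> S T"
  shows "isotypic_component G \<pi> S = isotypic_component G \<pi> T"
proof -
  have "isomorphic_subreps G \<pi> T S"
    using isomorphic_subreps_sym[OF _ assms(3)] assms(1) by (simp add: irreducible_subrep_def)
  then have "isomorphic_subreps G \<pi> S V \<longleftrightarrow> isomorphic_subreps G \<pi> T V" for V
    using assms(3) isomorphic_subreps_trans by blast
  then show ?thesis
    by (simp add: isotypic_component_def)
qed

lemma sectors_orthogonal:
  assumes "A \<in> sectors G \<pi>" "B \<in> sectors G \<pi>" "A \<noteq> B" "x \<in> A" "y \<in> B"
  shows "x \<bullet> y = 0"
proof -
  obtain S T where S: "irreducible_subrep G \<pi> S" "A = isotypic_component G \<pi> S"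
    and T: "irreducible_subrep G \<pi> T" "B = isotypic_component G \<pi> T"
    using assms by (auto simp: sectors_def)
  have *: "v \<bullet> w = 0"
    if "irreducible_subrep G \<pi> V" "isomorphic_subreps G \<pi> S V" "v \<in> V"
      "irreducible_subrep G \<pi> W" "isomorphic_subreps G \<pi> T W" "w \<in> W" for V W v w
  proof (rule irreducible_orthogonal_or_isomorphic[OF that(1,4) _ that(3,6)])
    show "\<not> isomorphic_subreps G \<pi> V W"
      using assms(3) S T that isotypic_component_cong by metis
  qed
  \<comment> \<open>Orthogonality passes from the generators to their spans one argument at a time,
    here for \<open>x\<close> and afterwards for \<open>y\<close>.\<close>
  have "orthogonal w x" if w: "w \<in> \<Union>{W. irreducible_subrep G \<pi> W \<and> isomorphic_subreps G \<pi> T W}" for w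
  proof (rule orthogonal_to_span[OF assms(4)[unfolded S(2) isotypic_component_def]])
    fix v assume "v \<in> \<Union>{V. irreducible_subrep G \<pi> V \<and> isomorphic_subreps G \<pi> S V}"
    then have "v \<bullet> w = 0"
      using w * by blast
    then show "orthogonal w v"
      by (simp add: orthogonal_def inner_commute)
  qed
  then have "orthogonal x y"
    using orthogonal_to_span[OF assms(5)[unfolded T(2) isotypic_component_def], of x]
    by (simp add: orthogonal_commute)
  then show ?thesis
    by (simp add: orthogonal_def)
qed

end

section \<open>Determinants in orthonormal bases\<close>

lemma orthogonal_conj_nth:
  fixes U A :: "real^'n^'n"
  shows "(U ** A ** transpose U) $ i $ j = row i U \<bullet> (A *v row j U)"
proof -
  have "(U ** A ** transpose U) $ i $ j = (U ** (A ** transpose U)) $ i $ j"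
    by (simp add: matrix_mul_assoc)
  also have "\<dots> = row i U \<bullet> (A *v row j U)"
    by (simp add: matrix_matrix_mult_def matrix_vector_mult_def inner_vec_def row_def transpose_def)
  finally show ?thesis .
qed

lemma coeff_var_row: "coeff_var R U i = row i U \<bullet> (R *v row i U)"
  by (simp add: coeff_var_def orthogonal_conj_nth)

lemma det_onb:
  fixes e :: "'n \<Rightarrow> real^'n"
  assumes "onb e UNIV UNIV"
  shows "det A = det (\<chi> i j. e i \<bullet> (A *v e j))"
proof -
  let ?U = "\<chi> i. e i"
  have U: "orthogonal_matrix ?U"
    by (rule orthogonal_matrix_onb[OF assms])
  have row: "row i ?U = e i" for i
    by (simp add: row_def vec_lambda_eta)
  have "(\<chi> i j. e i \<bullet> (A *v e j)) = ?U ** A ** transpose ?U"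
    by (simp add: vec_eq_iff orthogonal_conj_nth row)
  moreover have "det ?U * det ?U = 1"
    using det_orthogonal_matrix[OF U] by auto
  ultimately show ?thesis
    by (simp add: det_mul)
qed

lemma det_eigenbasis:
  fixes e :: "'n \<Rightarrow> real^'n"
  assumes "onb e UNIV UNIV" "\<And>i. A *v e i = l i *\<^sub>R e i"
  shows "det A = (\<Prod>i\<in>UNIV. l i)"
proof -
  have "det (\<chi> i j. e i \<bullet> (A *v e j)) = (\<Prod>i\<in>UNIV. (\<chi> i j. e i \<bullet> (A *v e j)) $ i $ i)"
    by (rule det_diagonal) (simp add: assms(2) onb_inner[OF assms(1)])
  then show ?thesis
    by (simp add: det_onb[OF assms(1), of A] assms(2) onb_inner[OF assms(1)])
qed

text \<open>One operator \<open>K\<close> on the whole space has its determinant computed in two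
  bases. In \<open>e\<close> it is diagonal and gives the product of the \<open>l i\<close>; in a
  basis \<open>h\<close> that contains the basis chosen by \<open>det_on\<close> the Leibniz formula
  reduces to the one defining \<open>det_on\<close>.\<close>

lemma det_on_eigenbasis:
  fixes e :: "'n \<Rightarrow> real^'n"
  assumes e: "onb e UNIV UNIV" and eJ: "onb e J S"
    and eig: "\<And>i. i \<in> J \<Longrightarrow> A *v e i = l i *\<^sub>R e i"
  shows "det_on S A = (\<Prod>i\<in>J. l i)"
proof -
  define B where "B = some_onb S"
  have B: "onb (\<lambda>b. b) B S"
    unfolding B_def by (rule onb_some_onb[OF onb_subspace[OF eJ]])
  have "card J = card B"
    by (simp add: onb_card[OF B] onb_card[OF eJ])
  then obtain g where g: "bij_betw g J B"
    using onb_finite[OF B] onb_finite[OF eJ] by (metis finite_same_card_bij)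
  have gB: "g i \<in> B" if "i \<in> J" for i
    using g that by (auto simp: bij_betw_def)
  have gS: "g i \<in> S" if "i \<in> J" for i
    using onb_mem[OF B gB[OF that]] .
  have gg: "g i \<bullet> g j = (if i = j then 1 else 0)" if "i \<in> J" "j \<in> J" for i j
    using onb_inner[OF B gB[OF that(1)] gB[OF that(2)]] bij_betw_imp_inj_on[OF g] that
    by (auto simp: inj_on_eq_iff)
  have perp: "e i \<bullet> x = 0" if "i \<notin> J" "x \<in> S" for i x
  proof -
    have "e i \<bullet> x = e i \<bullet> (\<Sum>k\<in>J. (e k \<bullet> x) *\<^sub>R e k)"
      using onb_expand[OF eJ that(2)] by simp
    also have "\<dots> = (\<Sum>k\<in>J. (e k \<bullet> x) * (e i \<bullet> e k))"
      by (simp add: inner_sum_right)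
    also have "\<dots> = 0"
      using that(1) by (intro sum.neutral) (auto simp: onb_inner[OF e])
    finally show ?thesis .
  qed
  \<comment> \<open>Replaces only the vectors indexed by \<open>J\<close>, so the new basis of the
    whole space keeps the index type and the old basis of the complement.\<close>
  define h where "h i = (if i \<in> J then g i else e i)" for i
  have hh: "h i \<bullet> h j = (if i = j then 1 else 0)" for i j
    using gg[of i j] perp[of i "g j"] perp[of j "g i"] gS[of i] gS[of j] onb_inner[OF e, of i j]
    by (auto simp: h_def inner_commute)
  have h: "onb h UNIV UNIV"
  proof -
    have "B \<subseteq> range h"
    proof
      fix b assume "b \<in> B"
      then obtain i where "i \<in> J" "b = g i"
        using g by (auto simp: bij_betw_def)
      then show "b \<in> range h"
        by (intro range_eqI[of _ _ i]) (simp add: h_def)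
    qed
    then have "S \<subseteq> span (range h)"
      using B span_mono[of B "range h"] by (auto simp: onb_def)
    then have "e i \<in> span (range h)" for i
      using onb_mem[OF eJ, of i] by (cases "i \<in> J") (auto simp: h_def intro: span_base range_eqI[of _ _ i])
    then have "span (range e) \<subseteq> span (range h)"
      by (intro span_minimal) auto
    then have "span (range h) = UNIV"
      using e by (simp add: onb_def top.extremum_unique)
    then show ?thesis
      using hh by (simp add: onb_def)
  qed
  define P where "P = orth_proj S"
  have P: "P *v x = onb_proj e J x" for x
    unfolding P_def by (rule orth_proj_onb[OF eJ])
  have P_id: "P *v x = x" if "x \<in> S" for x
    unfolding P by (rule onb_proj_unique[OF eJ that]) simp
  have P_e: "P *v e i = 0" if "i \<notin> J" for i
    unfolding P using perp[OF that]
    by (intro onb_proj_unique[OF eJ]) (auto simp: inner_commute subspace_0[OF onb_subspace[OF eJ]])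
  have P_inner: "x \<bullet> (P *v y) = x \<bullet> y" if "x \<in> S" for x y
    unfolding P by (rule onb_proj_inner[OF eJ that])
  have P_mem: "P *v x \<in> S" for x
    unfolding P by (rule onb_proj_mem[OF eJ])
  \<comment> \<open>\<open>A\<close> compressed to \<open>S\<close>, plus the identity on the
    complement: nothing is assumed about \<open>A\<close> outside \<open>S\<close>, and the
    complement contributes a factor 1.\<close>
  define K where "K = P ** A ** P + (mat 1 - P)"
  have K: "K *v x = P *v (A *v (P *v x)) + (x - P *v x)" for x
    by (simp add: K_def matrix_vector_mult_add_rdistrib matrix_vector_mult_diff_rdistrib
        flip: matrix_vector_mul_assoc)
  have "K *v e i = (if i \<in> J then l i else 1) *\<^sub>R e i" for i
    using eig[of i] P_e[of i] P_id[OF onb_mem[OF eJ], of i]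
    by (simp add: K matrix_vector_mult_scaleR)
  then have "det K = (\<Prod>i\<in>UNIV. if i \<in> J then l i else 1)"
    by (rule det_eigenbasis[OF e])
  then have detK: "det K = (\<Prod>i\<in>J. l i)"
    by (simp add: prod.If_cases)
  have hK: "h i \<bullet> (K *v h j) = (if i \<in> J \<and> j \<in> J then g i \<bullet> (A *v g j) else if i = j then 1 else 0)" for i j
  proof (cases "j \<in> J")
    case True
    then have "K *v h j = P *v (A *v g j)"
      using P_id[OF gS[OF True]] by (simp add: K h_def)
    then show ?thesis
      using True perp[of i] P_mem P_inner[OF gS, of i] by (auto simp: h_def)
  next
    case False
    then have "K *v h j = h j"
      using P_e[OF False] by (simp add: K h_def)
    then show ?thesis
      using False by (simp add: hh)
  qed
  let ?F = "\<lambda>p. of_int (sign p) * (\<Prod>i\<in>J. g i \<bullet> (A *v g (p i)))"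
  have "det K = (\<Sum>p | p permutes UNIV. of_int (sign p) * (\<Prod>i\<in>UNIV. h i \<bullet> (K *v h (p i))))"
    by (subst det_onb[OF h]) (simp add: det_def)
  \<comment> \<open>A permutation moving some \<open>i \<notin> J\<close> picks an off-diagonal
    entry from row \<open>i\<close>, which is a row of the identity matrix.\<close>
  also have "\<dots> = (\<Sum>p | p permutes J. of_int (sign p) * (\<Prod>i\<in>UNIV. h i \<bullet> (K *v h (p i))))"
  proof (rule sum.mono_neutral_right)
    show "{p. p permutes J} \<subseteq> {p. p permutes (UNIV :: 'n set)}"
      using permutes_subset by blast
    show "\<forall>p\<in>{p. p permutes UNIV} - {p. p permutes J}.
        of_int (sign p) * (\<Prod>i\<in>UNIV. h i \<bullet> (K *v h (p i))) = 0"
    proof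
      fix p assume p: "p \<in> {p. p permutes (UNIV :: 'n set)} - {p. p permutes J}"
      then obtain i where "i \<notin> J" "p i \<noteq> i"
        using permutes_superset[of p UNIV J] by auto
      then have "h i \<bullet> (K *v h (p i)) = 0"
        by (simp add: hK)
      then have "(\<Prod>i\<in>UNIV. h i \<bullet> (K *v h (p i))) = 0"
        by (intro prod_zero) auto
      then show "of_int (sign p) * (\<Prod>i\<in>UNIV. h i \<bullet> (K *v h (p i))) = 0"
        by simp
    qed
  qed (simp add: finite_permutations)
  also have "\<dots> = (\<Sum>p | p permutes J. ?F p)"
  proof (rule sum.cong[OF refl])
    fix p assume "p \<in> {p. p permutes J}"
    then have p: "p permutes J"
      by simp
    have "(\<Prod>i\<in>UNIV. h i \<bullet> (K *v h (p i))) = (\<Prod>i\<in>J. h i \<bullet> (K *v h (p i)))"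
      using p by (intro prod.mono_neutral_right) (auto simp: hK permutes_not_in)
    also have "\<dots> = (\<Prod>i\<in>J. g i \<bullet> (A *v g (p i)))"
      using p by (intro prod.cong) (auto simp: hK permutes_in_image)
    finally show "of_int (sign p) * (\<Prod>i\<in>UNIV. h i \<bullet> (K *v h (p i))) = ?F p"
      by simp
  qed
  \<comment> \<open>Relabelling along \<open>g\<close> turns permutations of the indices
    \<open>J\<close> into permutations of the basis vectors \<open>B\<close>, with the same
    sign.\<close>
  also have "\<dots> = (\<Sum>q | q permutes B. of_int (sign q) * (\<Prod>b\<in>B. b \<bullet> (A *v q b)))"
  proof -
    have eq: "map_permutation J g = (\<lambda>\<pi> x. if x \<in> B then g (\<pi> (inv_into J g x)) else x)"
      using g by (auto simp: fun_eq_iff map_permutation_def restrict_id_def bij_betw_def)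
    have "bij_betw (map_permutation J g) {p. p permutes J} {q. q permutes B}"
      unfolding eq by (rule bij_betw_permutations[OF g])
    then have "(\<Sum>q | q permutes B. of_int (sign q) * (\<Prod>b\<in>B. b \<bullet> (A *v q b)))
        = (\<Sum>p | p permutes J. of_int (sign (map_permutation J g p)) * (\<Prod>b\<in>B. b \<bullet> (A *v map_permutation J g p b)))"
      by (rule sum.reindex_bij_betw[symmetric])
    also have "\<dots> = (\<Sum>p | p permutes J. ?F p)"
    proof (rule sum.cong[OF refl])
      fix p assume "p \<in> {p. p permutes J}"
      then have p: "p permutes J"
        by simp
      have s: "sign (map_permutation J g p) = sign p"
        by (rule sign_map_permutation[OF bij_betw_imp_inj_on[OF g] p onb_finite[OF eJ]])
      have "(\<Prod>b\<in>B. b \<bullet> (A *v map_permutation J g p b)) = (\<Prod>i\<in>J. g i \<bullet> (A *v map_permutation J g p (g i)))"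
        by (rule prod.reindex_bij_betw[OF g, symmetric])
      also have "\<dots> = (\<Prod>i\<in>J. g i \<bullet> (A *v g (p i)))"
        using gB by (intro prod.cong) (auto simp: eq bij_betw_inv_into_left[OF g])
      finally show "of_int (sign (map_permutation J g p)) * (\<Prod>b\<in>B. b \<bullet> (A *v map_permutation J g p b)) = ?F p"
        by (simp add: s)
    qed
    finally show ?thesis
      by simp
  qed
  finally show ?thesis
    using detK by (simp add: det_on_def B_def)
qed

section \<open>Hadamard's inequality\<close>

lemma spectral_inner:
  fixes v :: "'i \<Rightarrow> real^'n" and R :: "real^'n^'n"
  assumes v: "onb v I UNIV" and eig: "\<And>j. j \<in> I \<Longrightarrow> R *v v j = l j *\<^sub>R v j"
  shows "x \<bullet> (R *v y) = (\<Sum>j\<in>I. l j * (v j \<bullet> x) * (v j \<bullet> y))"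
proof -
  have "R *v y = R *v (\<Sum>j\<in>I. (v j \<bullet> y) *\<^sub>R v j)"
    by (simp add: onb_expand_UNIV[OF v])
  also have "\<dots> = (\<Sum>j\<in>I. (v j \<bullet> y) *\<^sub>R (R *v v j))"
    using linear_sum[OF matrix_vector_mul_linear[of R], of "\<lambda>j. (v j \<bullet> y) *\<^sub>R v j" I]
    by (simp add: matrix_vector_mult_scaleR)
  also have "\<dots> = (\<Sum>j\<in>I. (l j * (v j \<bullet> y)) *\<^sub>R v j)"
    using eig by (intro sum.cong) auto
  finally show ?thesis
    by (simp add: inner_sum_right inner_commute mult_ac)
qed

text \<open>The squared inner products of two orthonormal bases form a doubly stochastic matrix, so the
  inequality is the concavity of the logarithm, in the form \<open>ln (l / d) \<le> l / d - 1\<close>.\<close>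

lemma hadamard:
  fixes e v :: "'n \<Rightarrow> real^'n"
  assumes e: "onb e UNIV UNIV" and v: "onb v UNIV UNIV"
    and eig: "\<And>j. R *v v j = l j *\<^sub>R v j" and l: "\<And>j. l j > 0"
  defines "d \<equiv> \<lambda>i. e i \<bullet> (R *v e i)"
  shows "d i > 0" "(\<Sum>j\<in>UNIV. ln (l j)) \<le> (\<Sum>i\<in>UNIV. ln (d i))"
    "(\<Sum>j\<in>UNIV. ln (l j)) = (\<Sum>i\<in>UNIV. ln (d i)) \<Longrightarrow> R *v e i = d i *\<^sub>R e i"
proof -
  define w where "w i j = (v j \<bullet> e i)\<^sup>2" for i j
  have w0: "w i j \<ge> 0" for i j
    by (simp add: w_def)
  have row: "(\<Sum>j\<in>UNIV. w i j) = 1" for i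
    using onb_inner_expand[OF v, of "e i" "e i"] onb_inner[OF e, of i i] by (simp add: w_def power2_eq_square)
  have col: "(\<Sum>i\<in>UNIV. w i j) = 1" for j
    using onb_inner_expand[OF e, of "v j" "v j"] onb_inner[OF v, of j j]
    by (simp add: w_def power2_eq_square inner_commute)
  have d: "d i = (\<Sum>j\<in>UNIV. w i j * l j)" for i
    using spectral_inner[OF v eig, of "e i" "e i"] by (simp add: d_def w_def power2_eq_square mult_ac)
  show d0: "d i > 0" for i
  proof -
    have "\<exists>j. w i j \<noteq> 0"
      using row[of i] by (metis sum.neutral zero_neq_one)
    then obtain j where "w i j > 0"
      using w0 by (metis less_eq_real_def)
    then show ?thesis
      unfolding d using w0 l by (intro sum_pos2[of _ j]) (auto intro!: mult_nonneg_nonneg less_imp_le[OF l])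
  qed
  \<comment> \<open>Each term is a weight times the gap in the logarithm inequality. Rows and
    columns of \<open>w\<close> sum to 1 and the row averages of \<open>l\<close> are
    \<open>d\<close>, so the double sum collapses to the gap between the two sums of
    logarithms.\<close>
  define t where "t i j = w i j * (l j / d i - 1 - ln (l j / d i))" for i j
  have t0: "t i j \<ge> 0" for i j
    unfolding t_def using w0 ln_le_minus_one[of "l j / d i"] l d0 by (intro mult_nonneg_nonneg) auto
  have "(\<Sum>i\<in>UNIV. \<Sum>j\<in>UNIV. t i j) =
      (\<Sum>i\<in>UNIV. \<Sum>j\<in>UNIV. w i j * l j / d i - w i j - w i j * ln (l j) + w i j * ln (d i))"
  proof (intro sum.cong refl)
    fix i j
    have *: "ln (l j / d i) = ln (l j) - ln (d i)"
      using l[of j] d0[of i] by (simp add: ln_div)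
    show "t i j = w i j * l j / d i - w i j - w i j * ln (l j) + w i j * ln (d i)"
      unfolding t_def * by (simp add: algebra_simps)
  qed
  also have "\<dots> = (\<Sum>i\<in>UNIV. (\<Sum>j\<in>UNIV. w i j * l j) / d i) - (\<Sum>i\<in>UNIV. \<Sum>j\<in>UNIV. w i j)
      - (\<Sum>i\<in>UNIV. \<Sum>j\<in>UNIV. w i j * ln (l j)) + (\<Sum>i\<in>UNIV. (\<Sum>j\<in>UNIV. w i j) * ln (d i))"
    by (simp add: sum.distrib sum_subtractf sum_divide_distrib sum_distrib_right)
  also have "(\<Sum>i\<in>UNIV. \<Sum>j\<in>UNIV. w i j * ln (l j)) = (\<Sum>j\<in>UNIV. \<Sum>i\<in>UNIV. w i j * ln (l j))"
    by (rule sum.swap)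
  also have "\<dots> = (\<Sum>j\<in>UNIV. ln (l j))"
    by (simp add: col flip: sum_distrib_right)
  finally have T: "(\<Sum>i\<in>UNIV. \<Sum>j\<in>UNIV. t i j) = (\<Sum>i\<in>UNIV. ln (d i)) - (\<Sum>j\<in>UNIV. ln (l j))"
    using d0 by (simp add: row less_imp_neq[symmetric] flip: d)
  have "(\<Sum>i\<in>UNIV. \<Sum>j\<in>UNIV. t i j) \<ge> 0"
    using t0 by (intro sum_nonneg)
  then show "(\<Sum>j\<in>UNIV. ln (l j)) \<le> (\<Sum>i\<in>UNIV. ln (d i))"
    using T by simp
  assume "(\<Sum>j\<in>UNIV. ln (l j)) = (\<Sum>i\<in>UNIV. ln (d i))"
  then have "(\<Sum>i\<in>UNIV. \<Sum>j\<in>UNIV. t i j) = 0"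
    using T by simp
  then have tz: "t i j = 0" for i j
    using t0 by (simp add: sum_nonneg_eq_0_iff sum_nonneg)
  show "R *v e i = d i *\<^sub>R e i"
  proof (rule onb_ext[OF v])
    fix j :: 'n
    \<comment> \<open>The logarithm inequality is tight only at 1: every \<open>v j\<close> is
      orthogonal to \<open>e i\<close> or has eigenvalue \<open>d i\<close>, which puts
      \<open>e i\<close> into the eigenspace of \<open>d i\<close>.\<close>
    have "w i j = 0 \<or> l j / d i = 1"
      using tz[of i j] ln_eq_minus_one[of "l j / d i"] l d0 by (auto simp: t_def)
    then have "l j * (v j \<bullet> e i) = d i * (v j \<bullet> e i)"
      using d0[of i] by (auto simp: w_def)
    moreover have "v j \<bullet> (R *v e i) = l j * (v j \<bullet> e i)"
      using spectral_inner[OF v eig, of "v j" "e i"]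
      by (simp add: onb_inner[OF v] if_distrib if_distribR sum.delta cong: if_cong)
    ultimately show "v j \<bullet> (R *v e i) = v j \<bullet> (d i *\<^sub>R e i)"
      by simp
  qed
qed

section \<open>Optimal bit allocation\<close>

text \<open>The arithmetic-geometric mean inequality for the distortions of the coefficients, from
  \<open>1 + t \<le> exp t\<close> after division by their geometric mean.\<close>

lemma total_distortion_ge:
  fixes R U :: "real^'n^'n"
  assumes "c > 0" "\<And>i. coeff_var R U i > 0"
  defines "M \<equiv> real CARD('n)" and "L \<equiv> \<Sum>i\<in>UNIV. ln (coeff_var R U i)"
  shows "c * M * exp ((L - 2 * (\<Sum>i\<in>UNIV. b i)) / M) \<le> total_distortion c R U b"
proof -
  let ?v = "coeff_var R U"
  \<comment> \<open>The logarithm of the geometric mean of \<open>?v i * exp (- 2 * b i)\<close>.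
    The deviations from it sum to zero, so the linear part of the exponential bound is a
    constant.\<close>
  define k where "k = (L - 2 * (\<Sum>i\<in>UNIV. b i)) / M"
  have M: "M > 0"
    by (simp add: M_def)
  have "(\<Sum>i\<in>UNIV. ln (?v i) - 2 * b i - k) = 0"
    using M by (simp add: sum_subtractf k_def L_def M_def flip: sum_distrib_left)
  then have "c * exp k * M = (\<Sum>i\<in>UNIV. c * exp k * (1 + (ln (?v i) - 2 * b i - k)))"
    by (simp add: M_def sum.distrib flip: sum_distrib_left)
  also have "\<dots> \<le> (\<Sum>i\<in>UNIV. c * exp k * exp (ln (?v i) - 2 * b i - k))"
    using assms(1) by (intro sum_mono mult_left_mono exp_ge_add_one_self) auto
  also have "\<dots> = total_distortion c R U b"
    unfolding total_distortion_def
  proof (intro sum.cong refl)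
    fix i
    have "exp k * exp (ln (?v i) - 2 * b i - k) = exp (ln (?v i)) * exp (- 2 * b i)"
      by (simp flip: exp_add)
    then show "c * exp k * exp (ln (?v i) - 2 * b i - k) = c * ?v i * exp (- 2 * b i)"
      using assms(2)[of i] by simp
  qed
  finally show ?thesis
    by (simp add: k_def mult_ac)
qed

text \<open>Equality of means requires equal distortions. Solving
  \<open>coeff_var R U i * exp (- 2 * b i) = exp ((L - 2 * B) / M)\<close> for \<open>b i\<close>
  gives the allocation, which may be negative for coefficients of small variance.\<close>

lemma total_distortion_optimal:
  fixes R U :: "real^'n^'n"
  assumes "\<And>i. coeff_var R U i > 0"
  defines "M \<equiv> real CARD('n)" and "L \<equiv> \<Sum>i\<in>UNIV. ln (coeff_var R U i)"
  obtains b where "(\<Sum>i\<in>UNIV. b i) = B" "total_distortion c R U b = c * M * exp ((L - 2 * B) / M)"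
proof
  let ?v = "coeff_var R U" and ?b = "\<lambda>i. 1 / 2 * (ln (coeff_var R U i) - (L - 2 * B) / M)"
  have M: "M > 0"
    by (simp add: M_def)
  have "(\<Sum>i\<in>UNIV. ?b i) = 1 / 2 * (L - M * ((L - 2 * B) / M))"
    unfolding sum_distrib_left[symmetric] sum_subtractf by (simp add: L_def M_def)
  then show "(\<Sum>i\<in>UNIV. ?b i) = B"
    using M by simp
  have *: "c * ?v i * exp (- 2 * ?b i) = c * exp ((L - 2 * B) / M)" for i
  proof -
    have "exp (- 2 * ?b i) = exp ((L - 2 * B) / M - ln (?v i))"
      by (intro arg_cong[where f = exp]) simp
    then show ?thesis
      using assms(1)[of i] by (simp add: exp_diff)
  qed
  show "total_distortion c R U ?b = c * M * exp ((L - 2 * B) / M)"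
    unfolding total_distortion_def * by (simp add: M_def)
qed

lemma geo_mean_var_exp:
  fixes R U :: "real^'n^'n"
  assumes "\<And>i. coeff_var R U i > 0"
  shows "geo_mean_var R U = exp ((\<Sum>i\<in>UNIV. ln (coeff_var R U i)) / real CARD('n))"
proof -
  have "ln (\<Prod>i\<in>UNIV. coeff_var R U i) = (\<Sum>i\<in>UNIV. ln (coeff_var R U i))"
    using assms by (intro ln_prod) (auto simp: less_imp_neq[symmetric])
  then show ?thesis
    using assms by (simp add: geo_mean_var_def powr_def prod_pos less_imp_neq[symmetric])
qed

lemma coding_distortion_eq:
  fixes R U :: "real^'n^'n"
  assumes "c > 0" "\<And>i. coeff_var R U i > 0"
  shows "coding_distortion c R U B =
    c * real CARD('n) * exp (- 2 * B / real CARD('n)) * geo_mean_var R U"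
proof -
  let ?k = "c * real CARD('n) * exp (((\<Sum>i\<in>UNIV. ln (coeff_var R U i)) - 2 * B) / real CARD('n))"
  obtain b where b: "(\<Sum>i\<in>UNIV. b i) = B" "total_distortion c R U b = ?k"
    using total_distortion_optimal[OF assms(2)] by metis
  have "?k \<le> total_distortion c R U b'" if "(\<Sum>i\<in>UNIV. b' i) = B" for b'
    using total_distortion_ge[OF assms, of b'] unfolding that .
  moreover have "?k \<in> {total_distortion c R U b |b. (\<Sum>i\<in>UNIV. b i) = B}"
    using b(1) by (auto intro!: exI[of _ b] simp flip: b(2))
  ultimately have "coding_distortion c R U B = ?k"
    unfolding coding_distortion_def by (intro cInf_eq_minimum) auto
  also have "\<dots> = c * real CARD('n) * exp (- 2 * B / real CARD('n)) * geo_mean_var R U"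
    by (simp add: geo_mean_var_exp[OF assms(2)] diff_divide_distrib add_ac flip: exp_add)
  finally show ?thesis .
qed

lemma coding_rate_eq:
  fixes R U :: "real^'n^'n"
  assumes "c > 0" "\<And>i. coeff_var R U i > 0" "D > 0"
  shows "coding_rate c R U D =
    real CARD('n) / 2 * ln (c * real CARD('n) / D) + (\<Sum>i\<in>UNIV. ln (coeff_var R U i)) / 2"
proof -
  define M where "M = real CARD('n)"
  define L where "L = (\<Sum>i\<in>UNIV. ln (coeff_var R U i))"
  \<comment> \<open>The solution of \<open>c * M * exp ((L - 2 * B) / M) = D\<close>: the rate at
    which the optimal allocation has distortion exactly \<open>D\<close>.\<close>
  define B where "B = M / 2 * ln (c * M / D) + L / 2"
  have M: "M > 0"
    by (simp add: M_def)
  have le_iff: "c * M * exp ((L - 2 * B') / M) \<le> D \<longleftrightarrow> B \<le> B'" for B'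
  proof -
    have "c * M * exp ((L - 2 * B') / M) \<le> D \<longleftrightarrow> exp ((L - 2 * B') / M) \<le> D / (c * M)"
      using assms(1) M by (simp add: field_simps)
    also have "\<dots> \<longleftrightarrow> (L - 2 * B') / M \<le> ln (D / (c * M))"
      using assms(1,3) M by (simp add: ln_ge_iff)
    also have "ln (D / (c * M)) = - ln (c * M / D)"
      using assms(1,3) M by (simp add: ln_div)
    also have "(L - 2 * B') / M \<le> - ln (c * M / D) \<longleftrightarrow> B \<le> B'"
      using M unfolding B_def by (simp add: field_simps)
    finally show ?thesis .
  qed
  obtain b where b: "(\<Sum>i\<in>UNIV. b i) = B" "total_distortion c R U b = c * M * exp ((L - 2 * B) / M)"
    using total_distortion_optimal[OF assms(2)] unfolding M_def L_def by metis
  have "coding_rate c R U D = B"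
    unfolding coding_rate_def
  proof (rule cInf_eq_minimum)
    show "B \<in> {(\<Sum>i\<in>UNIV. b i) |b. total_distortion c R U b \<le> D}"
      using b le_iff[of B] by auto
  next
    fix x assume "x \<in> {(\<Sum>i\<in>UNIV. b i) |b. total_distortion c R U b \<le> D}"
    then obtain b where b: "x = (\<Sum>i\<in>UNIV. b i)" "total_distortion c R U b \<le> D"
      by auto
    then have "c * M * exp ((L - 2 * x) / M) \<le> D"
      using total_distortion_ge[OF assms(1,2), of b] by (simp add: M_def L_def)
    then show "B \<le> x"
      by (simp add: le_iff)
  qed
  then show ?thesis
    by (simp add: B_def M_def L_def)
qed

section \<open>Lebesgue measure in orthonormal coordinates\<close>

lemma nn_integral_lborel_translate:
  fixes a :: "'a::euclidean_space"
  assumes "f \<in> borel_measurable borel"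
  shows "(\<integral>\<^sup>+ x. f (a + x) \<partial>lborel) = (\<integral>\<^sup>+ x. f x \<partial>lborel)"
proof -
  have "(\<integral>\<^sup>+ x. f x \<partial>lborel) = (\<integral>\<^sup>+ x. f x \<partial>distr lborel borel ((+) a))"
    by (simp add: lborel_distr_plus)
  then show ?thesis
    using assms by (simp add: nn_integral_distr)
qed

text \<open>The library has this only for \<^typ>\<open>real^'n\<close> with a well-ordered index type. Here both sides are
  translation invariant and agree on the unit ball; Tonelli's theorem, applied to the indicator of
  \<open>{(x, z). x \<in> A \<and> x + f z \<in> E}\<close> with \<open>A\<close> the unit ball, gives equality.\<close>

lemma lborel_distr_orthogonal:
  fixes f :: "'a::euclidean_space \<Rightarrow> 'a"
  assumes f: "orthogonal_transformation f"
  shows "distr lborel borel f = lborel"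
proof (rule measure_eqI)
  have lin: "linear f"
    using f by (simp add: orthogonal_transformation_linear)
  have [measurable]: "f \<in> borel_measurable borel"
    using lin by (intro borel_measurable_continuous_onI linear_continuous_on) (simp add: linear_conv_bounded_linear)
  have surj: "\<exists>x'. x = f x'" for x
    using orthogonal_transformation_surj[OF f] by (auto simp: surj_def)
  fix E assume "E \<in> sets (distr lborel borel f)"
  then have [measurable]: "E \<in> sets borel"
    by simp
  define A :: "'a set" where "A = cball 0 1"
  have [measurable]: "A \<in> sets borel"
    by (simp add: A_def)
  let ?i = "\<lambda>B. indicator B :: 'a \<Rightarrow> ennreal"
  let ?N = "\<integral>\<^sup>+ x. \<integral>\<^sup>+ z. ?i A x * ?i E (x + f z) \<partial>lborel \<partial>lborel"
  have A_f: "?i A (f x) = ?i A x" for x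
    using orthogonal_transformation_norm[OF f, of x] by (simp add: A_def indicator_def)
  have fE: "emeasure (distr lborel borel f) E = (\<integral>\<^sup>+ z. ?i E (f z) \<partial>lborel)"
  proof -
    have "(\<integral>\<^sup>+ z. ?i E (f z) \<partial>lborel) = (\<integral>\<^sup>+ x. ?i E x \<partial>distr lborel borel f)"
      by (rule nn_integral_distr[symmetric]) measurable
    also have "\<dots> = emeasure (distr lborel borel f) E"
      by (rule nn_integral_indicator) simp
    finally show ?thesis
      by (rule sym)
  qed
  have "(\<integral>\<^sup>+ z. ?i E (x + f z) \<partial>lborel) = emeasure (distr lborel borel f) E" for x
  proof -
    \<comment> \<open>By surjectivity the shift moves inside \<open>f\<close>, where translation
      invariance removes it: the inner integral is the same for every \<open>x\<close>.\<close>
    obtain x' where x: "x = f x'"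
      using surj by blast
    have "(\<integral>\<^sup>+ z. ?i E (f (x' + z)) \<partial>lborel) = (\<integral>\<^sup>+ z. ?i E (f z) \<partial>lborel)"
      by (rule nn_integral_lborel_translate) measurable
    then show ?thesis
      by (simp add: x fE linear_add[OF lin])
  qed
  then have N1: "?N = emeasure lborel A * emeasure (distr lborel borel f) E"
    by (simp add: nn_integral_cmult nn_integral_multc)
  have "?N = (\<integral>\<^sup>+ z. \<integral>\<^sup>+ x. ?i A x * ?i E (x + f z) \<partial>lborel \<partial>lborel)"
    by (rule lborel_pair.Fubini'[symmetric]) measurable
  also have "\<dots> = (\<integral>\<^sup>+ z. \<integral>\<^sup>+ x. ?i A (x - f z) * ?i E x \<partial>lborel \<partial>lborel)"
  proof (rule nn_integral_cong)
    fix z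
    show "(\<integral>\<^sup>+ x. ?i A x * ?i E (x + f z) \<partial>lborel) = (\<integral>\<^sup>+ x. ?i A (x - f z) * ?i E x \<partial>lborel)"
      using nn_integral_lborel_translate[of "\<lambda>x. ?i A (x - f z) * ?i E x" "f z"] by (simp add: add.commute)
  qed
  also have "\<dots> = (\<integral>\<^sup>+ x. \<integral>\<^sup>+ z. ?i A (x - f z) * ?i E x \<partial>lborel \<partial>lborel)"
    by (rule lborel_pair.Fubini') measurable
  also have "\<dots> = (\<integral>\<^sup>+ x. emeasure lborel A * ?i E x \<partial>lborel)"
  proof (rule nn_integral_cong)
    fix x
    obtain x' where x: "x = f x'"
      using surj by blast
    \<comment> \<open>\<open>f\<close> preserves the ball and the ball is symmetric about 0, so the
      rotation disappears and only a translation of the ball remains.\<close>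
    have "?i A (x - f z) = ?i A (- x' + z)" for z
    proof -
      have "?i A (x - f z) = ?i A (x' - z)"
        using A_f[of "x' - z"] by (simp add: x linear_diff[OF lin])
      then show ?thesis
        by (simp add: A_def indicator_def norm_minus_commute)
    qed
    then have "(\<integral>\<^sup>+ z. ?i A (x - f z) \<partial>lborel) = emeasure lborel A"
      using nn_integral_lborel_translate[of "?i A" "- x'"] by simp
    then show "(\<integral>\<^sup>+ z. ?i A (x - f z) * ?i E x \<partial>lborel) = emeasure lborel A * ?i E x"
      by (simp add: nn_integral_multc)
  qed
  also have "\<dots> = emeasure lborel A * emeasure lborel E"
    by (simp add: nn_integral_cmult)
  finally have "emeasure lborel A * emeasure (distr lborel borel f) E = emeasure lborel A * emeasure lborel E"
    using N1 by simp
  moreover have "emeasure lborel A \<noteq> \<infinity>"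
    using emeasure_bounded_finite[of A] by (simp add: A_def)
  moreover have "emeasure lborel A \<noteq> 0"
  proof
    assume "emeasure lborel A = 0"
    then have "measure lborel A = 0"
      by (simp add: measure_def)
    then show False
      unfolding A_def using content_cball_pos[of 1 "0::'a"] by simp
  qed
  ultimately show "emeasure (distr lborel borel f) E = emeasure lborel E"
    by (simp add: ennreal_mult_cancel_left)
qed simp

lemma product_sigma_finite_lborel: "product_sigma_finite (\<lambda>_. lborel)"
  by (simp add: product_sigma_finite_def sigma_finite_lborel)

lemma distr_PiM_lborel_reindex:
  assumes "finite I" and h: "bij_betw h J I"
  shows "distr (\<Pi>\<^sub>M i\<in>I. lborel) (\<Pi>\<^sub>M j\<in>J. lborel) (\<lambda>t. \<lambda>j\<in>J. t (h j)) = (\<Pi>\<^sub>M j\<in>J. lborel :: 'a::euclidean_space measure)"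
proof -
  interpret product_sigma_finite "\<lambda>_. lborel :: 'a measure"
    by (rule product_sigma_finite_lborel)
  have J: "finite J"
    using assms bij_betw_finite by blast
  have hI: "h j \<in> I" if "j \<in> J" for j
    using h that by (auto simp: bij_betw_def)
  have meas[measurable]: "(\<lambda>t. \<lambda>j\<in>J. t (h j)) \<in> measurable (\<Pi>\<^sub>M i\<in>I. lborel) (\<Pi>\<^sub>M j\<in>J. lborel :: 'a measure)"
    by (intro measurable_restrict measurable_component_singleton hI)
  show ?thesis
  proof (rule PiM_eqI[OF J])
    fix A assume A: "\<And>j. j \<in> J \<Longrightarrow> A j \<in> sets (lborel :: 'a measure)"
    let ?A = "\<lambda>i. A (inv_into J h i)"
    have inv: "inv_into J h i \<in> J" if "i \<in> I" for i
      using h that by (metis bij_betw_def inv_into_into)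
    have "(\<lambda>t. \<lambda>j\<in>J. t (h j)) -` Pi\<^sub>E J A \<inter> space (\<Pi>\<^sub>M i\<in>I. lborel) = Pi\<^sub>E I ?A"
    proof (intro Set.set_eqI iffI)
      fix t assume t: "t \<in> (\<lambda>t. \<lambda>j\<in>J. t (h j)) -` Pi\<^sub>E J A \<inter> space (\<Pi>\<^sub>M i\<in>I. lborel)"
      show "t \<in> Pi\<^sub>E I ?A"
      proof (rule PiE_I)
        fix i assume "i \<in> I"
        then show "t i \<in> ?A i"
          using t inv[of i] bij_betw_inv_into_right[OF h, of i] by (fastforce simp: PiE_iff)
      next
        fix i assume "i \<notin> I"
        then show "t i = undefined"
          using t by (auto simp: space_PiM PiE_iff extensional_def)
      qed
    next
      fix t assume t: "t \<in> Pi\<^sub>E I ?A"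
      then have "t (h j) \<in> A j" if "j \<in> J" for j
        using hI[OF that] bij_betw_inv_into_left[OF h that] by (force simp: PiE_iff)
      then show "t \<in> (\<lambda>t. \<lambda>j\<in>J. t (h j)) -` Pi\<^sub>E J A \<inter> space (\<Pi>\<^sub>M i\<in>I. lborel)"
        using t by (auto simp: space_PiM PiE_iff)
    qed
    then have "emeasure (distr (\<Pi>\<^sub>M i\<in>I. lborel) (\<Pi>\<^sub>M j\<in>J. lborel) (\<lambda>t. \<lambda>j\<in>J. t (h j))) (Pi\<^sub>E J A)
        = emeasure (\<Pi>\<^sub>M i\<in>I. lborel) (Pi\<^sub>E I ?A)"
      using A J by (subst emeasure_distr[OF meas]) (auto intro!: sets_PiM_I_finite)
    also have "\<dots> = (\<Prod>i\<in>I. emeasure lborel (?A i))"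
      using A inv by (intro emeasure_PiM[OF assms(1)]) auto
    also have "\<dots> = (\<Prod>j\<in>J. emeasure lborel (?A (h j)))"
      by (rule prod.reindex_bij_betw[OF h, symmetric])
    also have "\<dots> = (\<Prod>j\<in>J. emeasure lborel (A j))"
      by (intro prod.cong) (auto simp: bij_betw_inv_into_left[OF h])
    finally show "emeasure (distr (\<Pi>\<^sub>M i\<in>I. lborel) (\<Pi>\<^sub>M j\<in>J. lborel) (\<lambda>t. \<lambda>j\<in>J. t (h j))) (Pi\<^sub>E J A)
        = (\<Prod>j\<in>J. emeasure lborel (A j))" .
  qed simp
qed

definition onb_sum :: "('i \<Rightarrow> 'a::euclidean_space) \<Rightarrow> 'i set \<Rightarrow> ('i \<Rightarrow> real) \<Rightarrow> 'a" where
  "onb_sum e I t = (\<Sum>i\<in>I. t i *\<^sub>R e i)"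

lemma measurable_onb_sum[measurable]: "onb_sum e I \<in> borel_measurable (\<Pi>\<^sub>M i\<in>I. lborel)"
  unfolding onb_sum_def by measurable

lemma inner_onb_sum: "onb e I S \<Longrightarrow> j \<in> I \<Longrightarrow> e j \<bullet> onb_sum e I t = t j"
  unfolding onb_sum_def by (rule onb_inner_sum)

text \<open>In the standard basis this is the product form of Lebesgue measure. The linear map
  carrying the standard basis to \<open>e\<close>, matched up by a bijection of index sets, is
  orthogonal and so preserves the measure.\<close>

lemma lborel_onb:
  fixes e :: "'i \<Rightarrow> 'a::euclidean_space"
  assumes e: "onb e I UNIV"
  shows "distr (\<Pi>\<^sub>M i\<in>I. lborel) borel (onb_sum e I) = (lborel :: 'a measure)"
proof -
  have "card (Basis :: 'a set) = card I"
    using onb_card[OF e] by simp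
  then obtain h where h: "bij_betw h (Basis :: 'a set) I"
    using onb_finite[OF e] by (metis finite_Basis finite_same_card_bij)
  have hI: "h b \<in> I" if "b \<in> Basis" for b
    using h that by (auto simp: bij_betw_def)
  define f where "f x = (\<Sum>b\<in>Basis. (x \<bullet> b) *\<^sub>R e (h b))" for x :: 'a
  have f_sum: "f (\<Sum>b\<in>Basis. t b *\<^sub>R b) = (\<Sum>b\<in>Basis. t b *\<^sub>R e (h b))" for t
    unfolding f_def by (intro sum.cong) auto
  have lin: "linear f"
    unfolding f_def by (intro linear_compose_sum ballI linearI) (auto simp: inner_add_left scaleR_add_left)
  have "f x \<bullet> f y = x \<bullet> y" for x y
  proof -
    have "e (h b) \<bullet> f y = y \<bullet> b" if "b \<in> Basis" for b
    proof -
      have "e (h b) \<bullet> f y = (\<Sum>b'\<in>Basis. if b = b' then y \<bullet> b' else 0)"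
        using bij_betw_imp_inj_on[OF h] that unfolding f_def inner_sum_right
        by (intro sum.cong refl) (auto simp: onb_inner[OF e] hI inj_on_eq_iff)
      then show ?thesis
        using that by simp
    qed
    then have "f x \<bullet> f y = (\<Sum>b\<in>Basis. (x \<bullet> b) * (y \<bullet> b))"
      unfolding f_def[of x] inner_sum_left by (intro sum.cong) auto
    also have "\<dots> = x \<bullet> y"
      by (simp add: euclidean_inner[of x y])
    finally show ?thesis .
  qed
  then have f: "orthogonal_transformation f"
    using lin by (simp add: orthogonal_transformation_def)
  have [measurable]: "f \<in> borel_measurable borel"
    unfolding f_def by measurable
  have [measurable]: "(\<lambda>t. \<lambda>b\<in>Basis. t (h b)) \<in> measurable (\<Pi>\<^sub>M i\<in>I. lborel) (\<Pi>\<^sub>M b\<in>(Basis :: 'a set). lborel :: real measure)"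
    by (intro measurable_restrict measurable_component_singleton hI)
  have "lborel = distr (lborel :: 'a measure) borel f"
    by (rule lborel_distr_orthogonal[OF f, symmetric])
  also have "\<dots> = distr (distr (\<Pi>\<^sub>M b\<in>Basis. lborel) borel (\<lambda>t. \<Sum>b\<in>Basis. t b *\<^sub>R b)) borel f"
    by (simp flip: lborel_eq)
  also have "\<dots> = distr (\<Pi>\<^sub>M b\<in>(Basis :: 'a set). lborel) borel (\<lambda>t. \<Sum>b\<in>Basis. t b *\<^sub>R e (h b))"
    by (subst distr_distr) (simp_all add: o_def f_sum)
  also have "\<dots> = distr (distr (\<Pi>\<^sub>M i\<in>I. lborel) (\<Pi>\<^sub>M b\<in>(Basis :: 'a set). lborel) (\<lambda>t. \<lambda>b\<in>Basis. t (h b)))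
      borel (\<lambda>t. \<Sum>b\<in>Basis. t b *\<^sub>R e (h b))"
    by (simp add: distr_PiM_lborel_reindex[OF onb_finite[OF e] h])
  also have "\<dots> = distr (\<Pi>\<^sub>M i\<in>I. lborel) borel (\<lambda>t. \<Sum>b\<in>Basis. t (h b) *\<^sub>R e (h b))"
    by (subst distr_distr) (simp_all add: o_def)
  also have "(\<lambda>t. \<Sum>b\<in>Basis. t (h b) *\<^sub>R e (h b)) = onb_sum e I"
    unfolding onb_sum_def by (intro ext sum.reindex_bij_betw[OF h])
  finally show ?thesis
    by simp
qed

text \<open>The image measure of a Borel set \<open>A\<close> is the Lebesgue measure of the cylinder over \<open>A \<inter> S\<close> with
  unit cube as fibre, and the cube may be taken in a basis of the orthogonal complement that does
  not depend on \<open>e\<close>.\<close>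

lemma lborel_on_onb:
  fixes e :: "'i \<Rightarrow> 'a::euclidean_space"
  assumes e: "onb e I S"
  shows "lborel_on S = distr (\<Pi>\<^sub>M i\<in>I. lborel) borel (onb_sum e I)"
proof -
  define C where "C = {y. \<forall>x\<in>S. x \<bullet> y = 0}"
  obtain B' :: "'a set" where B': "onb (\<lambda>b. b) B' C"
    unfolding C_def by (rule onb_complement)
  define Q where "Q A = {x. onb_proj (\<lambda>b. b) (some_onb S) x \<in> A \<and> (\<forall>b\<in>B'. b \<bullet> x \<in> {0..1})}" for A
  have sub: "subspace S"
    by (rule onb_subspace[OF e])
  \<comment> \<open>Stated for an arbitrary basis \<open>d\<close> because it is applied twice, to
    \<open>e\<close> and to the basis chosen in \<open>lborel_on\<close>; \<open>Q A\<close>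
    involves neither \<open>d\<close> nor \<open>e\<close>.\<close>
  have key: "emeasure (distr (\<Pi>\<^sub>M i\<in>J. lborel) borel (onb_sum d J)) A = emeasure lborel (Q A)"
    if d: "onb d J S" and A[measurable]: "A \<in> sets borel" for d :: "'j \<Rightarrow> 'a" and J A
  proof -
    interpret product_sigma_finite "\<lambda>_. lborel :: real measure"
      by (rule product_sigma_finite_lborel)
    let ?K = "Inl ` J \<union> Inr ` B'" and ?g = "case_sum d (\<lambda>b. b)"
    have dis: "Inl ` J \<inter> Inr ` B' = {}"
      by auto
    have fin: "finite (Inl ` J)" "finite (Inr ` B')"
      using onb_finite[OF d] onb_finite[OF B'] by auto
    have CS: "x \<bullet> y = 0" if "x \<in> S" "y \<in> C" for x y
      using that by (auto simp: C_def)
    have g: "onb ?g ?K UNIV"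
      using d B' unfolding C_def by (rule onb_case_sum)
    have projg: "onb_proj (\<lambda>b. b) (some_onb S) (onb_sum ?g ?K t) = onb_sum d J (\<lambda>i. t (Inl i))" for t
    proof (rule onb_proj_unique[OF onb_some_onb[OF sub]])
      have eq: "onb_sum ?g ?K t = onb_sum d J (\<lambda>i. t (Inl i)) + onb_sum (\<lambda>b. b) B' (\<lambda>b. t (Inr b))"
        unfolding onb_sum_def by (simp add: sum.union_disjoint[OF fin dis] sum.reindex)
      show "onb_sum d J (\<lambda>i. t (Inl i)) \<in> S"
        unfolding onb_sum_def by (intro subspace_sum[OF sub] subspace_scale[OF sub] onb_mem[OF d])
      have "onb_sum (\<lambda>b. b) B' (\<lambda>b. t (Inr b)) \<in> C"
        unfolding onb_sum_def
        by (intro subspace_sum[OF onb_subspace[OF B']] subspace_scale[OF onb_subspace[OF B']] onb_mem[OF B'])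
      then show "y \<bullet> onb_sum d J (\<lambda>i. t (Inl i)) = y \<bullet> onb_sum ?g ?K t" if "y \<in> S" for y
        using CS[OF that] by (simp add: eq inner_add_right)
    qed
    have cube: "Inr b \<in> ?K \<Longrightarrow> b \<bullet> onb_sum ?g ?K t = t (Inr b)" for b t
      using inner_onb_sum[OF g, of "Inr b" t] by simp
    have [measurable]: "onb_proj (\<lambda>b. b) (some_onb S) \<in> borel_measurable borel"
      unfolding onb_proj_def by measurable
    have "finite B'"
      by (rule onb_finite[OF B'])
    have Q_meas[measurable]: "Q A \<in> sets borel"
      unfolding Q_def using \<open>finite B'\<close> by measurable
    let ?T = "(\<lambda>t :: 'j + 'a \<Rightarrow> real. onb_sum d J (\<lambda>i. t (Inl i))) -` A \<inter> space (\<Pi>\<^sub>M i\<in>Inl ` J. lborel)"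
    let ?C = "Pi\<^sub>E (Inr ` B' :: ('j + 'a) set) (\<lambda>_. {0..1 :: real})"
    have mT: "(\<lambda>t :: 'j + 'a \<Rightarrow> real. onb_sum d J (\<lambda>i. t (Inl i))) \<in> borel_measurable (\<Pi>\<^sub>M i\<in>Inl ` J. lborel)"
      unfolding onb_sum_def by measurable
    interpret J: finite_product_sigma_finite "\<lambda>_. lborel :: real measure" "Inl ` J :: ('j + 'a) set"
      by standard (rule fin)
    interpret B: finite_product_sigma_finite "\<lambda>_. lborel :: real measure" "Inr ` B' :: ('j + 'a) set"
      by standard (rule fin)
    have "emeasure lborel (Q A) = emeasure (distr (\<Pi>\<^sub>M i\<in>?K. lborel) borel (onb_sum ?g ?K)) (Q A)"
      by (simp add: lborel_onb[OF g])
    also have "\<dots> = emeasure (\<Pi>\<^sub>M i\<in>?K. lborel) (onb_sum ?g ?K -` Q A \<inter> space (\<Pi>\<^sub>M i\<in>?K. lborel))"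
      by (rule emeasure_distr) measurable
    also have "\<dots> = emeasure (distr ((\<Pi>\<^sub>M i\<in>Inl ` J. lborel) \<Otimes>\<^sub>M (\<Pi>\<^sub>M i\<in>Inr ` B'. lborel)) (\<Pi>\<^sub>M i\<in>?K. lborel)
        (merge (Inl ` J) (Inr ` B'))) (onb_sum ?g ?K -` Q A \<inter> space (\<Pi>\<^sub>M i\<in>?K. lborel))"
      by (simp add: distr_merge[OF dis fin])
    also have "\<dots> = emeasure ((\<Pi>\<^sub>M i\<in>Inl ` J. lborel) \<Otimes>\<^sub>M (\<Pi>\<^sub>M i\<in>Inr ` B'. lborel))
        (merge (Inl ` J) (Inr ` B') -` (onb_sum ?g ?K -` Q A \<inter> space (\<Pi>\<^sub>M i\<in>?K. lborel))
          \<inter> space ((\<Pi>\<^sub>M i\<in>Inl ` J. lborel) \<Otimes>\<^sub>M (\<Pi>\<^sub>M i\<in>Inr ` B'. lborel)))"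
      by (rule emeasure_distr) measurable
    \<comment> \<open>Splitting the coordinates turns the cylinder into a product set, whose second
      factor is a unit cube of measure 1.\<close>
    also have "merge (Inl ` J) (Inr ` B') -` (onb_sum ?g ?K -` Q A \<inter> space (\<Pi>\<^sub>M i\<in>?K. lborel))
          \<inter> space ((\<Pi>\<^sub>M i\<in>Inl ` J. lborel) \<Otimes>\<^sub>M (\<Pi>\<^sub>M i\<in>Inr ` B'. lborel)) = ?T \<times> ?C"
    proof (intro Set.set_eqI, clarify)
      fix t u :: "'j + 'a \<Rightarrow> real"
      let ?m = "merge (Inl ` J) (Inr ` B') (t, u)"
      have "onb_sum d J (\<lambda>i. ?m (Inl i)) = onb_sum d J (\<lambda>i. t (Inl i))"
        unfolding onb_sum_def by (intro sum.cong) (auto simp: merge_def)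
      moreover have "?m (Inr b) = u (Inr b)" if "b \<in> B'" for b
        using that by (auto simp: merge_def)
      moreover have "?m \<in> space (\<Pi>\<^sub>M i\<in>?K. lborel)"
        by (auto simp: space_PiM PiE_iff merge_def extensional_def)
      ultimately show "(t, u) \<in> merge (Inl ` J) (Inr ` B') -` (onb_sum ?g ?K -` Q A \<inter> space (\<Pi>\<^sub>M i\<in>?K. lborel))
          \<inter> space ((\<Pi>\<^sub>M i\<in>Inl ` J. lborel) \<Otimes>\<^sub>M (\<Pi>\<^sub>M i\<in>Inr ` B'. lborel)) \<longleftrightarrow> (t, u) \<in> ?T \<times> ?C"
        by (auto simp: Q_def projg cube space_pair_measure space_PiM PiE_iff)
    qed
    also have "emeasure ((\<Pi>\<^sub>M i\<in>Inl ` J. lborel) \<Otimes>\<^sub>M (\<Pi>\<^sub>M i\<in>Inr ` B'. lborel)) (?T \<times> ?C) =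
        emeasure (\<Pi>\<^sub>M i\<in>Inl ` J. lborel) ?T * emeasure (\<Pi>\<^sub>M i\<in>Inr ` B'. lborel) ?C"
      using fin measurable_sets[OF mT A]
      by (intro B.emeasure_pair_measure_Times sets_PiM_I_finite) auto
    also have "emeasure (\<Pi>\<^sub>M i\<in>Inr ` B'. lborel) ?C = 1"
      by (subst B.measure_times) auto
    also have "emeasure (\<Pi>\<^sub>M i\<in>Inl ` J. lborel) ?T * 1 =
        emeasure (distr (\<Pi>\<^sub>M i\<in>Inl ` J. lborel) borel (\<lambda>t :: 'j + 'a \<Rightarrow> real. onb_sum d J (\<lambda>i. t (Inl i)))) A"
      unfolding emeasure_distr[OF mT A] by simp
    also have "distr (\<Pi>\<^sub>M i\<in>Inl ` J. lborel) borel (\<lambda>t :: 'j + 'a \<Rightarrow> real. onb_sum d J (\<lambda>i. t (Inl i)))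
        = distr (distr (\<Pi>\<^sub>M i\<in>Inl ` J. lborel) (\<Pi>\<^sub>M i\<in>J. lborel) (\<lambda>t :: 'j + 'a \<Rightarrow> real. \<lambda>i\<in>J. t (Inl i))) borel (onb_sum d J)"
      by (subst distr_distr) (auto simp: o_def onb_sum_def)
    also have "distr (\<Pi>\<^sub>M i\<in>Inl ` J. lborel) (\<Pi>\<^sub>M i\<in>J. lborel) (\<lambda>t :: 'j + 'a \<Rightarrow> real. \<lambda>i\<in>J. t (Inl i)) = (\<Pi>\<^sub>M i\<in>J. lborel :: real measure)"
      by (rule distr_PiM_lborel_reindex[OF fin(1)]) (simp add: inj_on_imp_bij_betw)
    finally show ?thesis
      by simp
  qed
  show ?thesis
  proof (rule measure_eqI)
    fix A assume "A \<in> sets (lborel_on S)"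
    then have A: "A \<in> sets borel"
      by (simp add: lborel_on_def)
    have "lborel_on S = distr (\<Pi>\<^sub>M b\<in>some_onb S. lborel) borel (onb_sum (\<lambda>b. b) (some_onb S))"
      by (simp add: lborel_on_def onb_sum_def[abs_def])
    then show "emeasure (lborel_on S) A = emeasure (distr (\<Pi>\<^sub>M i\<in>I. lborel) borel (onb_sum e I)) A"
      using key[OF e A] key[OF onb_some_onb[OF sub] A] by simp
  qed (simp add: lborel_on_def)
qed

section \<open>Gaussian vectors\<close>

lemma PiM_density_lborel:
  fixes d :: "'i \<Rightarrow> real \<Rightarrow> real"
  assumes I: "finite I" and meas: "\<And>i. i \<in> I \<Longrightarrow> d i \<in> borel_measurable borel"
    and nonneg: "\<And>i x. i \<in> I \<Longrightarrow> d i x \<ge> 0"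
    and prob: "\<And>i. i \<in> I \<Longrightarrow> prob_space (density lborel (d i))"
  shows "density (\<Pi>\<^sub>M i\<in>I. lborel) (\<lambda>t. ennreal (\<Prod>i\<in>I. d i (t i))) = (\<Pi>\<^sub>M i\<in>I. density lborel (d i))"
proof -
  \<comment> \<open>A product of measures wants sigma-finiteness at every index, but
    \<open>d\<close> is controlled only on \<open>I\<close>; Lebesgue measure fills the other
    indices.\<close>
  define N where "N i = (if i \<in> I then density lborel (d i) else lborel)" for i
  interpret L: product_sigma_finite "\<lambda>_. lborel :: real measure"
    by (rule product_sigma_finite_lborel)
  interpret product_sigma_finite N
    unfolding product_sigma_finite_def N_def
    using prob by (auto intro: prob_space_imp_sigma_finite sigma_finite_lborel)
  have sets_N: "sets (N i) = sets borel" for i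
    by (simp add: N_def)
  have "density (\<Pi>\<^sub>M i\<in>I. lborel) (\<lambda>t. ennreal (\<Prod>i\<in>I. d i (t i))) = Pi\<^sub>M I N"
  proof (rule PiM_eqI[OF I])
    show "sets (density (\<Pi>\<^sub>M i\<in>I. lborel) (\<lambda>t. ennreal (\<Prod>i\<in>I. d i (t i)))) = sets (Pi\<^sub>M I N)"
      by (simp add: sets_N cong: sets_PiM_cong)
    fix A assume A: "\<And>i. i \<in> I \<Longrightarrow> A i \<in> sets (N i)"
    have mA[measurable]: "A i \<in> sets borel" if "i \<in> I" for i
      using A[OF that] by (simp add: sets_N)
    have mt: "(\<lambda>t. d i (t i)) \<in> borel_measurable (\<Pi>\<^sub>M i\<in>I. lborel)" if "i \<in> I" for i
      using measurable_compose[OF measurable_component_singleton[OF that, of "\<lambda>_. lborel"], of "d i" borel] meas[OF that]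
      by simp
    have [measurable]: "(\<lambda>t. \<Prod>i\<in>I. d i (t i)) \<in> borel_measurable (\<Pi>\<^sub>M i\<in>I. lborel)"
      using mt by (rule borel_measurable_prod)
    have box: "Pi\<^sub>E I A \<in> sets (\<Pi>\<^sub>M i\<in>I. lborel)"
      using mA I by (intro sets_PiM_I_finite) auto
    have "emeasure (density (\<Pi>\<^sub>M i\<in>I. lborel) (\<lambda>t. ennreal (\<Prod>i\<in>I. d i (t i)))) (Pi\<^sub>E I A)
        = (\<integral>\<^sup>+ t. ennreal (\<Prod>i\<in>I. d i (t i)) * indicator (Pi\<^sub>E I A) t \<partial>(\<Pi>\<^sub>M i\<in>I. lborel))"
      by (rule emeasure_density) (use box in measurable)
    also have "\<dots> = (\<integral>\<^sup>+ t. (\<Prod>i\<in>I. ennreal (d i (t i)) * indicator (A i) (t i)) \<partial>(\<Pi>\<^sub>M i\<in>I. lborel))"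
    proof (rule nn_integral_cong)
      fix t assume "t \<in> space (\<Pi>\<^sub>M i\<in>I. lborel :: real measure)"
      then have "(t \<in> Pi\<^sub>E I A) = (\<forall>i\<in>I. t i \<in> A i)"
        by (auto simp: space_PiM PiE_iff)
      then have "(indicator (Pi\<^sub>E I A) t :: ennreal) = (\<Prod>i\<in>I. indicator (A i) (t i))"
        using I by (auto simp: indicator_def)
      then show "ennreal (\<Prod>i\<in>I. d i (t i)) * indicator (Pi\<^sub>E I A) t = (\<Prod>i\<in>I. ennreal (d i (t i)) * indicator (A i) (t i))"
        using nonneg by (simp add: prod.distrib prod_ennreal)
    qed
    also have "\<dots> = (\<Prod>i\<in>I. \<integral>\<^sup>+ x. ennreal (d i x) * indicator (A i) x \<partial>lborel)"
      using meas by (intro L.product_nn_integral_prod[OF I]) auto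
    also have "\<dots> = (\<Prod>i\<in>I. emeasure (N i) (A i))"
      using meas by (intro prod.cong) (auto simp: N_def emeasure_density)
    finally show "emeasure (density (\<Pi>\<^sub>M i\<in>I. lborel) (\<lambda>t. ennreal (\<Prod>i\<in>I. d i (t i)))) (Pi\<^sub>E I A)
        = (\<Prod>i\<in>I. emeasure (N i) (A i))" .
  qed
  also have "\<dots> = (\<Pi>\<^sub>M i\<in>I. density lborel (d i))"
    by (rule PiM_cong) (auto simp: N_def)
  finally show ?thesis .
qed

text \<open>The bridge between densities and independence: a density that factors in orthonormal
  coordinates is the image of a product measure.\<close>

lemma density_lborel_on:
  fixes e :: "'i \<Rightarrow> 'a::euclidean_space" and d :: "'i \<Rightarrow> real \<Rightarrow> real"
  assumes e: "onb e I S" and meas: "\<And>i. i \<in> I \<Longrightarrow> d i \<in> borel_measurable borel"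
    and nonneg: "\<And>i x. i \<in> I \<Longrightarrow> d i x \<ge> 0"
    and prob: "\<And>i. i \<in> I \<Longrightarrow> prob_space (density lborel (d i))"
  shows "density (lborel_on S) (\<lambda>x. ennreal (\<Prod>i\<in>I. d i (e i \<bullet> x))) =
    distr (\<Pi>\<^sub>M i\<in>I. density lborel (d i)) borel (onb_sum e I)"
proof -
  have "(\<lambda>x. d i (e i \<bullet> x)) \<in> borel_measurable borel" if "i \<in> I" for i
    using measurable_compose[of "\<lambda>x. e i \<bullet> x" borel borel "d i" borel] meas[OF that] by simp
  then have [measurable]: "(\<lambda>x. \<Prod>i\<in>I. d i (e i \<bullet> x)) \<in> borel_measurable borel"
    by (rule borel_measurable_prod)
  have "density (lborel_on S) (\<lambda>x. ennreal (\<Prod>i\<in>I. d i (e i \<bullet> x))) =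
      distr (density (\<Pi>\<^sub>M i\<in>I. lborel) (\<lambda>t. ennreal (\<Prod>i\<in>I. d i (e i \<bullet> onb_sum e I t)))) borel (onb_sum e I)"
    unfolding lborel_on_onb[OF e] by (rule density_distr) measurable
  also have "(\<lambda>t. ennreal (\<Prod>i\<in>I. d i (e i \<bullet> onb_sum e I t))) = (\<lambda>t. ennreal (\<Prod>i\<in>I. d i (t i)))"
    by (intro ext arg_cong[where f = ennreal] prod.cong refl) (simp add: inner_onb_sum[OF e])
  finally show ?thesis
    by (simp add: PiM_density_lborel[OF onb_finite[OF e] meas nonneg prob])
qed

lemma lborel_on_UNIV: "lborel_on UNIV = (lborel :: 'a::euclidean_space measure)"
proof -
  have e: "onb (\<lambda>b. b) (some_onb UNIV) (UNIV :: 'a set)"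
    by (rule onb_some_onb) simp
  show ?thesis
    using lborel_onb[OF e] lborel_on_onb[OF e] by simp
qed

lemma sets_lborel_on[simp, measurable_cong]: "sets (lborel_on S) = sets borel"
  by (simp add: lborel_on_def)

text \<open>The entropy formula on \<open>S\<close> asks for it. Slabs bounded only in the
  directions of \<open>S\<close> exhaust the space and have finite measure, since the coordinates
  enter only through a basis of \<open>S\<close>.\<close>

lemma sigma_finite_lborel_on:
  fixes S :: "'a::euclidean_space set"
  assumes "subspace S"
  shows "sigma_finite_measure (lborel_on S)"
proof
  define I where "I = some_onb S"
  have e: "onb (\<lambda>b. b) I S"
    unfolding I_def by (rule onb_some_onb[OF assms])
  interpret product_sigma_finite "\<lambda>_. lborel :: real measure"
    by (rule product_sigma_finite_lborel)
  define A where "A n = {x :: 'a. \<forall>b\<in>I. b \<bullet> x \<in> {- real n..real n}}" for n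
  have fin: "finite I"
    by (rule onb_finite[OF e])
  have A[measurable]: "A n \<in> sets borel" for n
    unfolding A_def using fin by measurable
  have cover: "x \<in> (\<Union>n. A n)" for x
  proof -
    obtain n where n: "norm x \<le> real n"
      using real_arch_simple by blast
    have "\<bar>b \<bullet> x\<bar> \<le> real n" if "b \<in> I" for b
    proof -
      have "norm b = 1"
        using onb_inner[OF e that that] by (simp add: norm_eq_1)
      then show ?thesis
        using Cauchy_Schwarz_ineq2[of b x] n by simp
    qed
    then have "x \<in> A n"
      unfolding A_def by (fastforce simp: abs_le_iff)
    then show ?thesis
      by blast
  qed
  have "emeasure (lborel_on S) (A n) \<noteq> \<infinity>" for n
  proof -
    have "onb_sum (\<lambda>b. b) I -` A n \<inter> space (\<Pi>\<^sub>M b\<in>I. lborel) = Pi\<^sub>E I (\<lambda>_. {- real n..real n})"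
      by (auto simp: A_def inner_onb_sum[OF e] space_PiM PiE_iff)
    then have "emeasure (lborel_on S) (A n) = emeasure (\<Pi>\<^sub>M b\<in>I. lborel) (Pi\<^sub>E I (\<lambda>_. {- real n..real n}))"
      unfolding lborel_on_onb[OF e] by (subst emeasure_distr) auto
    also have "\<dots> = (\<Prod>b\<in>I. ennreal (2 * real n))"
      using fin by (subst emeasure_PiM) auto
    also have "\<dots> < \<infinity>"
      by (simp add: power_less_top_ennreal)
    finally show ?thesis
      by simp
  qed
  then show "\<exists>A. countable A \<and> A \<subseteq> sets (lborel_on S) \<and> \<Union> A = space (lborel_on S)
      \<and> (\<forall>a\<in>A. emeasure (lborel_on S) a \<noteq> \<infinity>)"
    using cover by (intro exI[of _ "range A"]) (auto simp: lborel_on_def)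
qed

text \<open>Serves to strip the tag \<open>Inl\<close> from the indices once the coordinates in a
  completed basis are restricted to the original vectors.\<close>

lemma (in prob_space) indep_vars_reindex:
  assumes indep: "indep_vars M' X (f ` I)" and f: "inj_on f I"
  shows "indep_vars (\<lambda>i. M' (f i)) (\<lambda>i. X (f i)) I"
proof -
  have *: "prob (\<Inter>j\<in>J. A j) = (\<Prod>j\<in>J. prob (A j))"
    if F: "indep_sets F (f ` I)" and J: "J \<subseteq> I" "J \<noteq> {}" "finite J" "\<forall>j\<in>J. A j \<in> F (f j)" for F J A
  proof -
    let ?A = "\<lambda>k. A (inv_into J f k)"
    have inj: "inj_on f J"
      using f J(1) by (rule inj_on_subset)
    have inv: "?A (f j) = A j" if "j \<in> J" for j
      using that by (simp add: inv_into_f_f[OF inj])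
    have "prob (\<Inter>k\<in>f ` J. ?A k) = (\<Prod>k\<in>f ` J. prob (?A k))"
      using J inv by (intro indep_setsD[OF F]) auto
    moreover have "(\<Inter>k\<in>f ` J. ?A k) = (\<Inter>j\<in>J. A j)"
      using inv by simp
    ultimately show ?thesis
      using inv by (simp add: prod.reindex[OF inj])
  qed
  have "indep_sets (\<lambda>i. F (f i)) I" if F: "indep_sets F (f ` I)" for F
    unfolding indep_sets_def
  proof (intro conjI ballI allI impI)
    show "F (f i) \<subseteq> events" if "i \<in> I" for i
      using F that by (simp add: indep_sets_def)
    show "prob (\<Inter>j\<in>J. A j) = (\<Prod>j\<in>J. prob (A j))"
      if "J \<subseteq> I" "J \<noteq> {}" "finite J" "A \<in> Pi J (\<lambda>i. F (f i))" for J A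
      using *[OF F that(1-3)] that(4) by blast
  qed
  then show ?thesis
    using indep unfolding indep_vars_def by auto
qed

text \<open>The law of \<open>X\<close> is the image of a product measure under
  \<open>onb_sum\<close>, and taking coordinates undoes \<open>onb_sum\<close>; so the joint law of
  the coordinates is that product measure.\<close>

lemma (in prob_space) distributed_onb_coords:
  fixes e :: "'i \<Rightarrow> 'b::euclidean_space"
  assumes e: "onb e I UNIV" and meas: "\<And>i. i \<in> I \<Longrightarrow> d i \<in> borel_measurable borel"
    and nonneg: "\<And>i x. i \<in> I \<Longrightarrow> d i x \<ge> 0"
    and prob: "\<And>i. i \<in> I \<Longrightarrow> prob_space (density lborel (d i))"
    and X: "distributed M lborel X (\<lambda>x. ennreal (\<Prod>i\<in>I. d i (e i \<bullet> x)))"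
  shows "indep_vars (\<lambda>_. borel) (\<lambda>i \<omega>. e i \<bullet> X \<omega>) I"
    "\<And>i. i \<in> I \<Longrightarrow> distributed M lborel (\<lambda>\<omega>. e i \<bullet> X \<omega>) (d i)"
proof -
  let ?c = "\<lambda>x. \<lambda>i\<in>I. e i \<bullet> x"
  let ?P = "\<Pi>\<^sub>M i\<in>I. density lborel (d i)"
  have X_meas[measurable]: "X \<in> borel_measurable M"
    using distributed_measurable[OF X] by simp
  have sets_P: "sets ?P = sets (\<Pi>\<^sub>M i\<in>I. borel)"
    by (rule sets_PiM_cong) auto
  have [measurable]: "onb_sum e I \<in> borel_measurable ?P"
    using measurable_onb_sum[of e I] by (simp add: measurable_def space_PiM cong: sets_PiM_cong)
  have [measurable]: "?c \<in> measurable borel (\<Pi>\<^sub>M i\<in>I. borel)"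
    by (intro measurable_restrict) simp
  have "distr M borel X = distr ?P borel (onb_sum e I)"
    using distributed_distr_eq_density[OF X] density_lborel_on[OF e meas nonneg prob]
    by (simp add: lborel_on_UNIV cong: distr_cong)
  moreover have "distr M (\<Pi>\<^sub>M i\<in>I. borel) (\<lambda>\<omega>. ?c (X \<omega>)) = distr (distr M borel X) (\<Pi>\<^sub>M i\<in>I. borel) ?c"
    by (subst distr_distr) (auto simp: o_def)
  ultimately have "distr M (\<Pi>\<^sub>M i\<in>I. borel) (\<lambda>\<omega>. ?c (X \<omega>)) = distr (distr ?P borel (onb_sum e I)) (\<Pi>\<^sub>M i\<in>I. borel) ?c"
    by simp
  also have "\<dots> = distr ?P (\<Pi>\<^sub>M i\<in>I. borel) (\<lambda>t. ?c (onb_sum e I t))"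
    by (subst distr_distr) (auto simp: o_def)
  also have "\<dots> = distr ?P ?P (\<lambda>t. t)"
  proof (rule distr_cong[OF refl])
    fix t assume "t \<in> space ?P"
    then show "?c (onb_sum e I t) = t"
      by (auto simp: space_PiM PiE_iff extensional_def fun_eq_iff inner_onb_sum[OF e])
  qed (simp add: sets_P)
  also have "\<dots> = ?P"
    by (rule distr_id)
  finally have D: "distr M (\<Pi>\<^sub>M i\<in>I. borel) (\<lambda>\<omega>. \<lambda>i\<in>I. e i \<bullet> X \<omega>) = ?P" .
  have comp: "distr M borel (\<lambda>\<omega>. e i \<bullet> X \<omega>) = density lborel (d i)" if "i \<in> I" for i
  proof -
    have "density lborel (d i) = distr ?P (density lborel (d i)) (\<lambda>t. t i)"
      by (rule distr_PiM_component[OF prob that, symmetric])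
    also have "\<dots> = distr ?P borel (\<lambda>t. t i)"
      by (rule distr_cong) auto
    also have "\<dots> = distr (distr M (\<Pi>\<^sub>M i\<in>I. borel) (\<lambda>\<omega>. \<lambda>i\<in>I. e i \<bullet> X \<omega>)) borel (\<lambda>t. t i)"
      by (simp add: D)
    also have "\<dots> = distr M borel (\<lambda>\<omega>. e i \<bullet> X \<omega>)"
      using that by (subst distr_distr) (auto simp: o_def)
    finally show ?thesis
      by simp
  qed
  then show "distributed M lborel (\<lambda>\<omega>. e i \<bullet> X \<omega>) (d i)" if "i \<in> I" for i
    using that meas[OF that] by (auto simp: distributed_def cong: distr_cong)
  have "I \<noteq> {}"
    using onb_card[OF e] by auto
  moreover have "(\<Pi>\<^sub>M i\<in>I. distr M borel (\<lambda>\<omega>. e i \<bullet> X \<omega>)) = ?P"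
    by (rule PiM_cong) (auto simp: comp)
  ultimately show "indep_vars (\<lambda>_. borel) (\<lambda>i \<omega>. e i \<bullet> X \<omega>) I"
    using D by (subst indep_vars_iff_distr_eq_PiM') auto
qed

text \<open>The opposite direction, for a subspace: independence makes the joint law of the
  coefficients a product measure, whose image has the factored density.\<close>

lemma (in prob_space) distributed_onb_sum:
  fixes e :: "'i \<Rightarrow> 'b::euclidean_space"
  assumes e: "onb e I S" and "I \<noteq> {}" and nonneg: "\<And>i x. i \<in> I \<Longrightarrow> d i x \<ge> 0"
    and indep: "indep_vars (\<lambda>_. borel) Y I"
    and Y: "\<And>i. i \<in> I \<Longrightarrow> distributed M lborel (Y i) (\<lambda>x. ennreal (d i x))"
  shows "distributed M (lborel_on S) (\<lambda>\<omega>. onb_sum e I (\<lambda>i. Y i \<omega>)) (\<lambda>x. ennreal (\<Prod>i\<in>I. d i (e i \<bullet> x)))"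
proof -
  let ?P = "\<Pi>\<^sub>M i\<in>I. density lborel (d i)"
  have meas: "d i \<in> borel_measurable borel" if "i \<in> I" for i
    using distributed_real_measurable[OF _ Y[OF that]] nonneg[OF that] by simp
  have Ym[measurable]: "Y i \<in> borel_measurable M" if "i \<in> I" for i
    using distributed_measurable[OF Y[OF that]] by simp
  have dist: "distr M borel (Y i) = density lborel (d i)" if "i \<in> I" for i
    using distributed_distr_eq_density[OF Y[OF that]] by (simp cong: distr_cong)
  have prob: "prob_space (density lborel (d i))" if "i \<in> I" for i
    using prob_space_distr[OF Ym[OF that]] by (simp add: dist[OF that])
  have D: "distr M (\<Pi>\<^sub>M i\<in>I. borel) (\<lambda>\<omega>. \<lambda>i\<in>I. Y i \<omega>) = ?P"
    using indep_vars_iff_distr_eq_PiM'[OF \<open>I \<noteq> {}\<close> Ym, THEN iffD1, OF _ indep] dist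
    by (simp cong: PiM_cong)
  have [measurable]: "onb_sum e I \<in> borel_measurable (\<Pi>\<^sub>M i\<in>I. borel)"
    unfolding onb_sum_def by measurable
  have "(\<lambda>x. d i (e i \<bullet> x)) \<in> borel_measurable borel" if "i \<in> I" for i
    using measurable_compose[of "\<lambda>x. e i \<bullet> x" borel borel "d i" borel] meas[OF that] by simp
  then have [measurable]: "(\<lambda>x. \<Prod>i\<in>I. d i (e i \<bullet> x)) \<in> borel_measurable borel"
    by (rule borel_measurable_prod)
  have mY: "(\<lambda>\<omega>. onb_sum e I (\<lambda>i. Y i \<omega>)) \<in> borel_measurable M"
    unfolding onb_sum_def by measurable
  have "distr M borel (\<lambda>\<omega>. onb_sum e I (\<lambda>i. Y i \<omega>)) =
      distr (distr M (\<Pi>\<^sub>M i\<in>I. borel) (\<lambda>\<omega>. \<lambda>i\<in>I. Y i \<omega>)) borel (onb_sum e I)"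
    by (subst distr_distr) (auto simp: o_def onb_sum_def)
  also have "\<dots> = density (lborel_on S) (\<lambda>x. ennreal (\<Prod>i\<in>I. d i (e i \<bullet> x)))"
    by (simp add: D density_lborel_on[OF e meas nonneg prob])
  finally show ?thesis
    using mY by (simp add: distributed_def cong: distr_cong)
qed

section \<open>Entropy of sums of independent normal coordinates\<close>

lemma (in prob_space) normal_log_density:
  assumes "\<sigma> > 0" and Y: "distributed M lborel Y (normal_density \<mu> \<sigma>)"
  shows "integrable M (\<lambda>\<omega>. ln (normal_density \<mu> \<sigma> (Y \<omega>)))"
    "(\<integral>\<omega>. ln (normal_density \<mu> \<sigma> (Y \<omega>)) \<partial>M) = - ln (2 * pi * exp 1 * \<sigma>\<^sup>2) / 2"
proof -
  have ln: "ln (normal_density \<mu> \<sigma> x) = - ln (2 * pi * \<sigma>\<^sup>2) / 2 - (x - \<mu>)\<^sup>2 / (2 * \<sigma>\<^sup>2)" for x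
    using assms(1) by (simp add: normal_density_def ln_mult ln_div ln_sqrt) (simp add: field_simps)
  have int: "integrable M (\<lambda>\<omega>. (Y \<omega> - \<mu>)\<^sup>2)"
    using distributed_integrable[OF Y, of "\<lambda>x. (x - \<mu>)\<^sup>2"] integrable_normal_moment[OF assms(1), of \<mu> 2] by simp
  have "(\<integral>\<omega>. (Y \<omega> - \<mu>)\<^sup>2 \<partial>M) = (\<integral>x. normal_density \<mu> \<sigma> x * (x - \<mu>)\<^sup>2 \<partial>lborel)"
    by (rule distributed_integral[OF Y, symmetric]) auto
  also have "\<dots> = \<sigma>\<^sup>2"
    using integral_normal_moment_even[OF assms(1), of \<mu> 1] by (simp add: eval_nat_numeral)
  finally have var: "(\<integral>\<omega>. (Y \<omega> - \<mu>)\<^sup>2 \<partial>M) = \<sigma>\<^sup>2" .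
  show "integrable M (\<lambda>\<omega>. ln (normal_density \<mu> \<sigma> (Y \<omega>)))"
    unfolding ln using int by auto
  have "(\<integral>\<omega>. ln (normal_density \<mu> \<sigma> (Y \<omega>)) \<partial>M) = - ln (2 * pi * \<sigma>\<^sup>2) / 2 - 1 / 2"
    unfolding ln using int var assms(1) by (simp add: prob_space)
  also have "\<dots> = - ln (2 * pi * exp 1 * \<sigma>\<^sup>2) / 2"
    using assms(1) by (simp add: ln_mult)
  finally show "(\<integral>\<omega>. ln (normal_density \<mu> \<sigma> (Y \<omega>)) \<partial>M) = - ln (2 * pi * exp 1 * \<sigma>\<^sup>2) / 2" .
qed

lemma ln_prod_normal_density:
  assumes "finite I" "\<And>i. i \<in> I \<Longrightarrow> \<sigma> i > 0"
  shows "ln (\<Prod>i\<in>I. normal_density (\<mu> i) (\<sigma> i) (x i)) = (\<Sum>i\<in>I. ln (normal_density (\<mu> i) (\<sigma> i) (x i)))"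
  using assms normal_density_pos by (intro ln_prod) (auto simp: less_imp_neq[symmetric])

text \<open>The log density at the sum is the sum of the log densities of its coordinates, so
  linearity of the expectation is enough. The factor \<open>exp 1\<close> absorbs the 1/2 that each
  normalised square contributes.\<close>

lemma (in prob_space) entropy_onb_sum_normal:
  fixes e :: "'i \<Rightarrow> 'b::euclidean_space"
  assumes e: "onb e I S" and "I \<noteq> {}" and \<sigma>: "\<And>i. i \<in> I \<Longrightarrow> \<sigma> i > 0"
    and indep: "indep_vars (\<lambda>_. borel) Y I"
    and Y: "\<And>i. i \<in> I \<Longrightarrow> distributed M lborel (Y i) (normal_density (\<mu> i) (\<sigma> i))"
  shows "entropy (exp 1) (lborel_on S) (\<lambda>\<omega>. onb_sum e I (\<lambda>i. Y i \<omega>)) =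
    (\<Sum>i\<in>I. ln (2 * pi * exp 1 * (\<sigma> i)\<^sup>2) / 2)"
proof -
  interpret information_space M "exp 1"
    by standard simp
  interpret L: sigma_finite_measure "lborel_on S"
    by (rule sigma_finite_lborel_on[OF onb_subspace[OF e]])
  let ?f = "\<lambda>x. \<Prod>i\<in>I. normal_density (\<mu> i) (\<sigma> i) (e i \<bullet> x)"
  let ?Y = "\<lambda>\<omega>. onb_sum e I (\<lambda>i. Y i \<omega>)"
  have D: "distributed M (lborel_on S) ?Y (\<lambda>x. ennreal (?f x))"
    by (rule distributed_onb_sum[OF e \<open>I \<noteq> {}\<close> _ indep Y]) auto
  have f0: "?f x \<ge> 0" for x
    by (simp add: prod_nonneg)
  have log: "log (exp 1) x = ln x" for x :: real
    by (simp add: log_def)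
  have "entropy (exp 1) (lborel_on S) ?Y = - (\<integral>x. ?f x * log (exp 1) (?f x) \<partial>lborel_on S)"
    by (rule entropy_distr[OF D f0])
  also have "(\<integral>x. ?f x * log (exp 1) (?f x) \<partial>lborel_on S) = (\<integral>\<omega>. log (exp 1) (?f (?Y \<omega>)) \<partial>M)"
    by (rule distributed_integral[OF D _ f0]) (simp add: log; measurable)
  also have "\<dots> = (\<integral>\<omega>. (\<Sum>i\<in>I. ln (normal_density (\<mu> i) (\<sigma> i) (Y i \<omega>))) \<partial>M)"
    by (intro Bochner_Integration.integral_cong refl)
      (simp add: log ln_prod_normal_density onb_finite[OF e] \<sigma> inner_onb_sum[OF e])
  also have "\<dots> = (\<Sum>i\<in>I. - ln (2 * pi * exp 1 * (\<sigma> i)\<^sup>2) / 2)"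
    using normal_log_density[OF \<sigma> Y] by (simp add: Bochner_Integration.integral_sum)
  finally show ?thesis
    by (simp add: sum_negf)
qed

section \<open>Gaussian densities in an eigenbasis\<close>

lemma matrix_inv_eigenvector:
  fixes R :: "real^'n^'n"
  assumes "det R \<noteq> 0" "R *v x = l *\<^sub>R x" "l \<noteq> 0"
  shows "matrix_inv R *v x = (1 / l) *\<^sub>R x"
proof -
  have "invertible R"
    using assms(1) by (simp add: invertible_det_nz)
  then have "matrix_inv R ** R = mat 1"
    unfolding invertible_def matrix_inv_def by (rule someI2_ex) simp
  then have "x = matrix_inv R *v (R *v x)"
    by (simp add: matrix_vector_mul_assoc)
  also have "\<dots> = l *\<^sub>R (matrix_inv R *v x)"
    by (simp add: assms(2) matrix_vector_mult_scaleR)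
  finally have "(1 / l) *\<^sub>R x = (1 / l) *\<^sub>R (l *\<^sub>R (matrix_inv R *v x))"
    by simp
  then show ?thesis
    using assms(3) by simp
qed

lemma gaussian_density_eigenbasis:
  fixes v :: "'n \<Rightarrow> real^'n"
  assumes v: "onb v UNIV UNIV" and eig: "\<And>j. R *v v j = l j *\<^sub>R v j" and l: "\<And>j. l j > 0"
  shows "gaussian_density m R x = (\<Prod>j\<in>UNIV. normal_density (v j \<bullet> m) (sqrt (l j)) (v j \<bullet> x))"
proof -
  have det: "det R = (\<Prod>j\<in>UNIV. l j)"
    by (rule det_eigenbasis[OF v eig])
  have "det R > 0"
    using l by (simp add: det prod_pos)
  then have "matrix_inv R *v v j = (1 / l j) *\<^sub>R v j" for j
    using eig l[of j] by (intro matrix_inv_eigenvector) auto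
  then have "(x - m) \<bullet> (matrix_inv R *v (x - m)) = (\<Sum>j\<in>UNIV. 1 / l j * (v j \<bullet> (x - m)) * (v j \<bullet> (x - m)))"
    by (rule spectral_inner[OF v])
  then have "- ((x - m) \<bullet> (matrix_inv R *v (x - m))) / 2 = (\<Sum>j\<in>UNIV. - (v j \<bullet> x - v j \<bullet> m)\<^sup>2 / (2 * l j))"
    by (simp add: sum_divide_distrib sum_negf inner_diff_right power2_eq_square mult.commute)
  moreover have "sqrt ((2 * pi) ^ CARD('n) * det R) = (\<Prod>j\<in>UNIV. sqrt (2 * pi * l j))"
  proof -
    have eq: "(\<Prod>j\<in>UNIV. 2 * pi * l j) = (2 * pi) ^ CARD('n) * det R"
      by (simp add: det prod.distrib power_mult_distrib)
    have "sqrt (\<Prod>j\<in>A. f j) = (\<Prod>j\<in>A. sqrt (f j))" for f :: "'n \<Rightarrow> real" and A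
      by (induction A rule: infinite_finite_induct) (simp_all add: real_sqrt_mult)
    then show ?thesis
      unfolding eq[symmetric] by blast
  qed
  ultimately show ?thesis
    using l less_imp_le[OF l] unfolding gaussian_density_def normal_density_def
    by (simp add: exp_sum prod_dividef prod.distrib)
qed

text \<open>The right-hand side does not contain \<open>e\<close>: this is the rotation invariance
  that lets one standard normal vector be read in two bases.\<close>

lemma prod_std_normal_density:
  fixes e :: "'i \<Rightarrow> 'a::euclidean_space"
  assumes e: "onb e I UNIV"
  shows "(\<Prod>i\<in>I. std_normal_density (e i \<bullet> x)) = (1 / sqrt (2 * pi)) ^ DIM('a) * exp (- (x \<bullet> x) / 2)"
proof -
  have "(\<Prod>i\<in>I. std_normal_density (e i \<bullet> x)) = (1 / sqrt (2 * pi)) ^ card I * exp (\<Sum>i\<in>I. - (e i \<bullet> x)\<^sup>2 / 2)"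
    by (simp add: std_normal_density_def prod.distrib prod_dividef exp_sum onb_finite[OF e] power_divide)
  also have "(\<Sum>i\<in>I. - (e i \<bullet> x)\<^sup>2 / 2) = - (x \<bullet> x) / 2"
    by (simp add: onb_inner_expand[OF e, of x x] sum_negf sum_divide_distrib power2_eq_square)
  finally show ?thesis
    using onb_card[OF e] by simp
qed

text \<open>Whitening \<open>X\<close> in the eigenbasis \<open>v\<close> gives a standard normal vector \<open>Z\<close>, whose density is
  rotation invariant. The covariances being zero, the coordinates \<open>u i \<bullet> X\<close> are affine images of
  the coordinates of \<open>Z\<close> in another orthonormal system.\<close>

lemma (in prob_space) gaussian_vector_coords:
  fixes v :: "'n \<Rightarrow> real^'n" and u :: "'i \<Rightarrow> real^'n"
  assumes X: "distributed M lborel X (\<lambda>x. ennreal (gaussian_density m R x))"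
    and v: "onb v UNIV UNIV" and eig: "\<And>j. R *v v j = l j *\<^sub>R v j" and l: "\<And>j. l j > 0"
    and I: "finite I" and u: "\<And>i k. i \<in> I \<Longrightarrow> k \<in> I \<Longrightarrow> i \<noteq> k \<Longrightarrow> u i \<bullet> (R *v u k) = 0"
    and \<sigma>: "\<And>i. i \<in> I \<Longrightarrow> u i \<bullet> (R *v u i) = (\<sigma> i)\<^sup>2" "\<And>i. i \<in> I \<Longrightarrow> \<sigma> i > 0"
  shows "indep_vars (\<lambda>_. borel) (\<lambda>i \<omega>. u i \<bullet> X \<omega>) I"
    "\<And>i. i \<in> I \<Longrightarrow> distributed M lborel (\<lambda>\<omega>. u i \<bullet> X \<omega>) (normal_density (u i \<bullet> m) (\<sigma> i))"
proof -
  have sl: "sqrt (l j) > 0" for j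
    using l by simp
  have X': "distributed M lborel X (\<lambda>x. ennreal (\<Prod>j\<in>UNIV. normal_density (v j \<bullet> m) (sqrt (l j)) (v j \<bullet> x)))"
    using X by (simp add: gaussian_density_eigenbasis[OF v eig l])
  have indepX: "indep_vars (\<lambda>_. borel) (\<lambda>j \<omega>. v j \<bullet> X \<omega>) UNIV"
    and normX: "distributed M lborel (\<lambda>\<omega>. v j \<bullet> X \<omega>) (normal_density (v j \<bullet> m) (sqrt (l j)))" for j
    using distributed_onb_coords[OF v _ _ _ X'] prob_space_normal_density[OF sl] by auto
  let ?z = "\<lambda>j \<omega>. (v j \<bullet> X \<omega> - v j \<bullet> m) / sqrt (l j)"
  define Z where "Z \<omega> = onb_sum v UNIV (\<lambda>j. ?z j \<omega>)" for \<omega>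
  have indepZ: "indep_vars (\<lambda>_. borel) ?z UNIV"
    by (rule indep_vars_compose2[OF indepX, of "\<lambda>j x. (x - v j \<bullet> m) / sqrt (l j)"]) measurable
  have normZ: "distributed M lborel (?z j) std_normal_density" for j
    by (rule iffD1[OF normal_standard_normal_convert[OF sl] normX])
  have "distributed M (lborel_on UNIV) Z (\<lambda>x. ennreal (\<Prod>j\<in>UNIV. std_normal_density (v j \<bullet> x)))"
    unfolding Z_def by (rule distributed_onb_sum[OF v _ _ indepZ normZ]) auto
  then have Z: "distributed M lborel Z (\<lambda>x. ennreal ((1 / sqrt (2 * pi)) ^ DIM(real^'n) * exp (- (x \<bullet> x) / 2)))"
    by (simp only: prod_std_normal_density[OF v] lborel_on_UNIV)
  \<comment> \<open>In coordinates, the square root of \<open>R\<close> applied to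
    \<open>u i\<close>, divided by \<open>\<sigma> i\<close>. Orthonormality of \<open>a\<close> is
    then the statement that the \<open>u i\<close> are orthogonal for the form of \<open>R\<close>,
    with variances \<open>(\<sigma> i)\<^sup>2\<close>.\<close>
  define a where "a i = (1 / \<sigma> i) *\<^sub>R onb_sum v UNIV (\<lambda>j. sqrt (l j) * (v j \<bullet> u i))" for i
  have va: "v j \<bullet> a i = sqrt (l j) * (v j \<bullet> u i) / \<sigma> i" for i j
    by (simp add: a_def inner_onb_sum[OF v])
  have aa: "a i \<bullet> a k = u i \<bullet> (R *v u k) / (\<sigma> i * \<sigma> k)" for i k
  proof -
    have "a i \<bullet> a k = (\<Sum>j\<in>UNIV. l j * (v j \<bullet> u i) * (v j \<bullet> u k) / (\<sigma> i * \<sigma> k))"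
      unfolding onb_inner_expand[OF v, of "a i" "a k"] va
      using less_imp_le[OF l] by (intro sum.cong refl) (simp add: field_simps)
    then show ?thesis
      by (simp add: spectral_inner[OF v eig] sum_divide_distrib)
  qed
  have a: "onb a I (span (a ` I))"
    using I u \<sigma> less_imp_neq[OF \<sigma>(2)] unfolding onb_def by (auto simp: aa power2_eq_square)
  \<comment> \<open>The density of \<open>Z\<close> factors only along a basis of the whole space,
    so \<open>a\<close> is completed; the added coordinates are discarded afterwards.\<close>
  obtain B' where "onb (\<lambda>b. b) B' {y. \<forall>x\<in>span (a ` I). x \<bullet> y = 0}"
    by (rule onb_complement)
  then have g: "onb (case_sum a (\<lambda>b. b)) (Inl ` I \<union> Inr ` B') UNIV" (is "onb ?g ?K UNIV")
    by (rule onb_case_sum[OF a])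
  have Z': "distributed M lborel Z (\<lambda>x. ennreal (\<Prod>k\<in>?K. std_normal_density (?g k \<bullet> x)))"
    using Z by (simp only: prod_std_normal_density[OF g])
  have indepG: "indep_vars (\<lambda>_. borel) (\<lambda>k \<omega>. ?g k \<bullet> Z \<omega>) ?K"
    and normG: "\<And>k. k \<in> ?K \<Longrightarrow> distributed M lborel (\<lambda>\<omega>. ?g k \<bullet> Z \<omega>) std_normal_density"
    using distributed_onb_coords[OF g _ _ _ Z'] prob_space_normal_density[of 1] by auto
  have uX: "u i \<bullet> X \<omega> = u i \<bullet> m + \<sigma> i * (a i \<bullet> Z \<omega>)" if "i \<in> I" for i \<omega>
  proof -
    have "\<sigma> i * (a i \<bullet> Z \<omega>) = (\<Sum>j\<in>UNIV. \<sigma> i * ((v j \<bullet> a i) * (v j \<bullet> Z \<omega>)))"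
      by (simp add: onb_inner_expand[OF v, of "a i" "Z \<omega>"] sum_distrib_left)
    also have "\<dots> = (\<Sum>j\<in>UNIV. (v j \<bullet> u i) * (v j \<bullet> (X \<omega> - m)))"
      using sl \<sigma>(2)[OF that] l unfolding va
      by (intro sum.cong refl) (simp add: Z_def inner_onb_sum[OF v] inner_diff_right less_imp_neq[symmetric])
    also have "\<dots> = u i \<bullet> (X \<omega> - m)"
      by (simp add: onb_inner_expand[OF v, of "u i"])
    finally show ?thesis
      by (simp add: inner_diff_right)
  qed
  have "indep_vars (\<lambda>_. borel) (\<lambda>i \<omega>. a i \<bullet> Z \<omega>) I"
    using indep_vars_reindex[where f = Inl and I = I and M' = "\<lambda>_. borel" and X = "\<lambda>k \<omega>. ?g k \<bullet> Z \<omega>"] indep_vars_subset[OF indepG, of "Inl ` I"]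
    by (simp add: o_def)
  then have "indep_vars (\<lambda>_. borel) (\<lambda>i \<omega>. u i \<bullet> m + \<sigma> i * (a i \<bullet> Z \<omega>)) I"
    by (rule indep_vars_compose2[of _ _ _ "\<lambda>i x. u i \<bullet> m + \<sigma> i * x"]) measurable
  then show "indep_vars (\<lambda>_. borel) (\<lambda>i \<omega>. u i \<bullet> X \<omega>) I"
    by (subst indep_vars_cong[OF refl _ refl]) (auto simp: uX)
  show "distributed M lborel (\<lambda>\<omega>. u i \<bullet> X \<omega>) (normal_density (u i \<bullet> m) (\<sigma> i))" if "i \<in> I" for i
  proof -
    have "distributed M lborel (\<lambda>\<omega>. a i \<bullet> Z \<omega>) std_normal_density"
      using normG[of "Inl i"] that by simp
    then have "distributed M lborel (\<lambda>\<omega>. u i \<bullet> m + \<sigma> i * (a i \<bullet> Z \<omega>)) (normal_density (u i \<bullet> m + \<sigma> i * 0) (\<bar>\<sigma> i\<bar> * 1))"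
      using \<sigma>(2)[OF that] by (intro normal_density_affine) auto
    then show ?thesis
      using \<sigma>(2)[OF that] by (simp add: uX[OF that])
  qed
qed

text \<open>Covers both terms of the multi-information: a sector with the rows lying in it, and the
  whole space with the eigenbasis, where the projection is the identity.\<close>

lemma (in prob_space) entropy_gaussian_projection:
  fixes v :: "'n \<Rightarrow> real^'n" and u :: "'i \<Rightarrow> real^'n"
  assumes X: "distributed M lborel X (\<lambda>x. ennreal (gaussian_density m R x))"
    and v: "onb v UNIV UNIV" and eig: "\<And>j. R *v v j = l j *\<^sub>R v j" and l: "\<And>j. l j > 0"
    and u: "onb u I S" "I \<noteq> {}" and uR: "\<And>i k. i \<in> I \<Longrightarrow> k \<in> I \<Longrightarrow> i \<noteq> k \<Longrightarrow> u i \<bullet> (R *v u k) = 0"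
    and d: "\<And>i. i \<in> I \<Longrightarrow> u i \<bullet> (R *v u i) = d i" "\<And>i. i \<in> I \<Longrightarrow> d i > 0"
  shows "entropy (exp 1) (lborel_on S) (\<lambda>\<omega>. orth_proj S *v X \<omega>) = (\<Sum>i\<in>I. ln (2 * pi * exp 1 * d i) / 2)"
proof -
  have "u i \<bullet> (R *v u i) = (sqrt (d i))\<^sup>2" "sqrt (d i) > 0" if "i \<in> I" for i
    using d[OF that] by auto
  note coords = gaussian_vector_coords[OF X v eig l onb_finite[OF u(1)] uR this]
  have "entropy (exp 1) (lborel_on S) (\<lambda>\<omega>. onb_sum u I (\<lambda>i. u i \<bullet> X \<omega>)) =
      (\<Sum>i\<in>I. ln (2 * pi * exp 1 * (sqrt (d i))\<^sup>2) / 2)"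
    using d by (intro entropy_onb_sum_normal[OF u _ coords]) auto
  also have "\<dots> = (\<Sum>i\<in>I. ln (2 * pi * exp 1 * d i) / 2)"
    using d(2) by (intro sum.cong) (auto simp: less_imp_le)
  finally show ?thesis
    by (simp add: orth_proj_onb[OF u(1)] onb_proj_def onb_sum_def)
qed

section \<open>The rate-distortion function of a Gaussian source\<close>

lemma prob_space_normal_onb:
  fixes e :: "'i \<Rightarrow> 'a::euclidean_space"
  assumes e: "onb e I UNIV" and \<sigma>: "\<And>i. i \<in> I \<Longrightarrow> \<sigma> i > 0"
  shows "prob_space (density lborel (\<lambda>x. ennreal (\<Prod>i\<in>I. normal_density (\<mu> i) (\<sigma> i) (e i \<bullet> x))))"
proof -
  let ?P = "\<Pi>\<^sub>M i\<in>I. density lborel (normal_density (\<mu> i) (\<sigma> i))"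
  have prob: "prob_space (density lborel (normal_density (\<mu> i) (\<sigma> i)))" if "i \<in> I" for i
    by (rule prob_space_normal_density[OF \<sigma>[OF that]])
  have "onb_sum e I \<in> borel_measurable ?P"
    unfolding onb_sum_def by measurable
  then have "prob_space (distr ?P borel (onb_sum e I))"
    by (intro prob_space.prob_space_distr prob_space_PiM prob)
  then show ?thesis
    using density_lborel_on[OF e, of "\<lambda>i. normal_density (\<mu> i) (\<sigma> i)"] prob by (simp add: lborel_on_UNIV)
qed

lemma (in prob_space) log_density_normal_onb:
  fixes e :: "'i \<Rightarrow> 'b::euclidean_space"
  assumes e: "onb e I UNIV" and \<sigma>: "\<And>i. i \<in> I \<Longrightarrow> \<sigma> i > 0"
    and X: "distributed M lborel X (\<lambda>x. ennreal (\<Prod>i\<in>I. normal_density (\<mu> i) (\<sigma> i) (e i \<bullet> x)))"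
  shows "integrable M (\<lambda>\<omega>. ln (\<Prod>i\<in>I. normal_density (\<mu> i) (\<sigma> i) (e i \<bullet> X \<omega>)))"
    "(\<integral>\<omega>. ln (\<Prod>i\<in>I. normal_density (\<mu> i) (\<sigma> i) (e i \<bullet> X \<omega>)) \<partial>M) =
      - (\<Sum>i\<in>I. ln (2 * pi * exp 1 * (\<sigma> i)\<^sup>2) / 2)"
proof -
  have ln: "ln (\<Prod>i\<in>I. normal_density (\<mu> i) (\<sigma> i) (e i \<bullet> X \<omega>)) =
      (\<Sum>i\<in>I. ln (normal_density (\<mu> i) (\<sigma> i) (e i \<bullet> X \<omega>)))" for \<omega>
    by (rule ln_prod_normal_density[OF onb_finite[OF e] \<sigma>])
  have coord: "distributed M lborel (\<lambda>\<omega>. e i \<bullet> X \<omega>) (normal_density (\<mu> i) (\<sigma> i))" if "i \<in> I" for i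
    using prob_space_normal_density[OF \<sigma>] by (intro distributed_onb_coords(2)[OF e _ _ _ X that]) auto
  note log = normal_log_density[OF \<sigma> coord]
  show "integrable M (\<lambda>\<omega>. ln (\<Prod>i\<in>I. normal_density (\<mu> i) (\<sigma> i) (e i \<bullet> X \<omega>)))"
    unfolding ln using log(1) by (intro Bochner_Integration.integrable_sum)
  show "(\<integral>\<omega>. ln (\<Prod>i\<in>I. normal_density (\<mu> i) (\<sigma> i) (e i \<bullet> X \<omega>)) \<partial>M) =
      - (\<Sum>i\<in>I. ln (2 * pi * exp 1 * (\<sigma> i)\<^sup>2) / 2)"
    unfolding ln using log by (subst Bochner_Integration.integral_sum) (auto simp flip: sum_negf)
qed

text \<open>The Donsker--Varadhan bound, from \<open>t \<le> exp t - 1\<close> for \<open>t = \<phi> - ln (dP / dQ)\<close>.\<close>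

lemma KL_divergence_ge:
  fixes \<phi> :: "'a \<Rightarrow> real"
  assumes P: "prob_space P" and Q: "prob_space Q" and sets: "sets P = sets Q"
    and ac: "absolutely_continuous Q P" and int: "integrable P (entropy_density (exp 1) Q P)"
    and meas[measurable]: "\<phi> \<in> borel_measurable Q" and \<phi>: "integrable P \<phi>"
    and le: "(\<integral>\<^sup>+ z. ennreal (exp (\<phi> z)) \<partial>Q) \<le> 1"
  shows "(\<integral>z. \<phi> z \<partial>P) \<le> KL_divergence (exp 1) Q P"
proof -
  interpret P: prob_space P by (rule P)
  interpret Q: prob_space Q by (rule Q)
  define g where "g = RN_deriv Q P"
  define k where "k z = ln (enn2real (g z))" for z
  have k: "entropy_density (exp 1) Q P = k"
    by (simp add: entropy_density_def k_def g_def fun_eq_iff log_def)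
  have g_meas[measurable]: "g \<in> borel_measurable Q"
    by (simp add: g_def)
  have k_meas[measurable]: "k \<in> borel_measurable Q"
    unfolding k_def by measurable
  have fin: "AE z in Q. g z \<noteq> \<infinity>"
    unfolding g_def by (rule Q.RN_deriv_finite[OF P.sigma_finite_measure_axioms ac sets])
  have "(\<integral>\<^sup>+ z. ennreal (exp (\<phi> z - k z)) \<partial>P) = (\<integral>\<^sup>+ z. g z * ennreal (exp (\<phi> z - k z)) \<partial>Q)"
    unfolding g_def by (rule Q.RN_deriv_nn_integral[OF ac sets]) measurable
  also have "\<dots> \<le> (\<integral>\<^sup>+ z. ennreal (exp (\<phi> z)) \<partial>Q)"
  proof (rule nn_integral_mono_AE, use fin in eventually_elim)
    fix z assume "g z \<noteq> \<infinity>"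
    then obtain r where r: "g z = ennreal r" "r \<ge> 0"
      by (cases "g z") auto
    show "g z * ennreal (exp (\<phi> z - k z)) \<le> ennreal (exp (\<phi> z))"
    \<comment> \<open>Where the density of \<open>P\<close> vanishes, \<open>k z\<close> has only a
      default value, but the left side is 0. This is why the moment of
      \<open>exp (\<phi> z - k z)\<close> is bounded and not computed.\<close>
    proof (cases "r = 0")
      case False
      then have "r * exp (\<phi> z - k z) = exp (\<phi> z)"
        using r by (simp add: k_def exp_diff)
      then show ?thesis
        using r by (simp flip: ennreal_mult)
    qed (use r in simp)
  qed
  finally have nn: "(\<integral>\<^sup>+ z. ennreal (exp (\<phi> z - k z)) \<partial>P) \<le> 1"
    using le by simp
  have mP: "(\<lambda>z. exp (\<phi> z - k z)) \<in> borel_measurable P"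
    unfolding measurable_cong_sets[OF sets refl] by measurable
  have exp_int: "integrable P (\<lambda>z. exp (\<phi> z - k z))"
    using nn mP by (intro integrableI_bounded) (auto intro: le_less_trans)
  have "ennreal (\<integral>z. exp (\<phi> z - k z) \<partial>P) \<le> ennreal 1"
    using nn by (subst nn_integral_eq_integral[OF exp_int, symmetric]) auto
  then have exp_le: "(\<integral>z. exp (\<phi> z - k z) \<partial>P) \<le> 1"
    by (subst (asm) ennreal_le_iff) auto
  have int_k: "integrable P k"
    using int by (simp add: k)
  have "(\<integral>z. \<phi> z \<partial>P) - (\<integral>z. k z \<partial>P) = (\<integral>z. \<phi> z - k z \<partial>P)"
    using \<phi> int_k by simp
  also have "\<dots> \<le> (\<integral>z. exp (\<phi> z - k z) - 1 \<partial>P)"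
  proof (rule integral_mono)
    show "\<phi> z - k z \<le> exp (\<phi> z - k z) - 1" for z
      using exp_ge_add_one_self[of "\<phi> z - k z"] by linarith
  qed (use \<phi> int_k exp_int in auto)
  also have "\<dots> \<le> 0"
    using exp_int exp_le by (simp add: P.prob_space)
  finally show ?thesis
    by (simp add: KL_divergence_def k)
qed

text \<open>Bayes' rule for two normal variables, by completing the square:
  \<open>(l - \<delta>) / l\<close> is the regression coefficient of \<open>y\<close> on
  \<open>x\<close>, and \<open>\<delta> * (l - \<delta>) / l\<close> is the conditional
  variance.\<close>

lemma normal_density_split:
  assumes "0 < \<delta>" "\<delta> < l"
  shows "normal_density \<mu> (sqrt (l - \<delta>)) y * normal_density y (sqrt \<delta>) x =
    normal_density \<mu> (sqrt l) x * normal_density (\<mu> + (l - \<delta>) / l * (x - \<mu>)) (sqrt (\<delta> * (l - \<delta>) / l)) y"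
proof -
  define k where "k = l - \<delta>"
  have k: "k > 0" "l = k + \<delta>"
    using assms by (auto simp: k_def)
  define a b where "a = x - \<mu>" and "b = y - \<mu>"
  have "(2 * pi * k) * (2 * pi * \<delta>) = (2 * pi * (k + \<delta>)) * (2 * pi * (\<delta> * k / (k + \<delta>)))"
    using k assms(1) by (simp add: field_simps)
  then have s: "sqrt (2 * pi * k) * sqrt (2 * pi * \<delta>) = sqrt (2 * pi * (k + \<delta>)) * sqrt (2 * pi * (\<delta> * k / (k + \<delta>)))"
    by (simp only: flip: real_sqrt_mult)
  have e: "b\<^sup>2 / (2 * k) + (a - b)\<^sup>2 / (2 * \<delta>) = a\<^sup>2 / (2 * (k + \<delta>)) + (b - k / (k + \<delta>) * a)\<^sup>2 / (2 * (\<delta> * k / (k + \<delta>)))"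
  proof -
    have nz: "k + \<delta> \<noteq> 0" "k \<noteq> 0" "\<delta> \<noteq> 0"
      using k assms(1) by auto
    have "b - k / (k + \<delta>) * a = (\<delta> * b - k * (a - b)) / (k + \<delta>)"
      using nz by (simp add: field_simps)
    then have "(b - k / (k + \<delta>) * a)\<^sup>2 / (2 * (\<delta> * k / (k + \<delta>))) = (\<delta> * b - k * (a - b))\<^sup>2 / (2 * \<delta> * k * (k + \<delta>))"
      using nz by (simp add: power_divide power2_eq_square)
    moreover have "b\<^sup>2 / (2 * k) + (a - b)\<^sup>2 / (2 * \<delta>) - a\<^sup>2 / (2 * (k + \<delta>)) =
        (b\<^sup>2 * \<delta> * (k + \<delta>) + (a - b)\<^sup>2 * k * (k + \<delta>) - a\<^sup>2 * \<delta> * k) / (2 * \<delta> * k * (k + \<delta>))"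
      using nz by (simp add: add_divide_distrib diff_divide_distrib)
    moreover have "b\<^sup>2 * \<delta> * (k + \<delta>) + (a - b)\<^sup>2 * k * (k + \<delta>) - a\<^sup>2 * \<delta> * k = (\<delta> * b - k * (a - b))\<^sup>2"
      by (simp add: power2_eq_square algebra_simps)
    ultimately show ?thesis
      by simp
  qed
  have xy: "x - y = a - b" "y - (\<mu> + k / (k + \<delta>) * (x - \<mu>)) = b - k / (k + \<delta>) * a"
    by (auto simp: a_def b_def)
  have "normal_density \<mu> (sqrt k) y * normal_density y (sqrt \<delta>) x =
      1 / (sqrt (2 * pi * k) * sqrt (2 * pi * \<delta>)) * exp (- (b\<^sup>2 / (2 * k) + (a - b)\<^sup>2 / (2 * \<delta>)))"
    using k assms(1) by (simp add: normal_density_def xy flip: b_def exp_add)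
  also have "\<dots> = normal_density \<mu> (sqrt (k + \<delta>)) x * normal_density (\<mu> + k / (k + \<delta>) * (x - \<mu>)) (sqrt (\<delta> * k / (k + \<delta>))) y"
    unfolding s e using k assms(1) unfolding normal_density_def xy by (simp flip: a_def exp_add)
  finally show ?thesis
    by (simp add: k_def)
qed

lemma mutual_information_fst_snd:
  assumes "prob_space P" "sets P = sets (borel \<Otimes>\<^sub>M borel)"
  shows "prob_space.mutual_information P b borel borel fst snd =
    KL_divergence b (distr P borel fst \<Otimes>\<^sub>M distr P borel snd) P"
proof -
  have "distr P (borel \<Otimes>\<^sub>M borel) (\<lambda>z. (fst z, snd z)) = P"
    using assms(2) by (simp add: distr_id2)
  then show ?thesis
    by (simp add: prob_space.mutual_information_def[OF assms(1)])
qed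

section \<open>The Gaussian source with its backward channel\<close>

context
  fixes v :: "'n \<Rightarrow> real^'n" and l :: "'n \<Rightarrow> real" and R :: "real^'n^'n" and m :: "real^'n" and \<delta> :: real
  assumes v: "onb v UNIV UNIV" and eig: "\<And>j. R *v v j = l j *\<^sub>R v j"
    and \<delta>: "0 < \<delta>" "\<And>j. \<delta> < l j"
begin

text \<open>The reproduction \<open>y\<close> comes first, the source value \<open>x\<close> second.
  The channel is isotropic, but writing it in the eigenbasis lets its product with
  \<open>reproduction_density\<close> be rearranged coordinate by coordinate.\<close>

definition test_channel :: "real^'n \<Rightarrow> real^'n \<Rightarrow> real" where
  "test_channel y x = (\<Prod>j\<in>UNIV. normal_density (v j \<bullet> y) (sqrt \<delta>) (v j \<bullet> x))"

definition reproduction_density :: "real^'n \<Rightarrow> real" where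
  "reproduction_density y = (\<Prod>j\<in>UNIV. normal_density (v j \<bullet> m) (sqrt (l j - \<delta>)) (v j \<bullet> y))"

definition gaussian_rate :: real where
  "gaussian_rate = (\<Sum>j\<in>UNIV. ln (l j)) / 2 - real CARD('n) / 2 * ln \<delta>"

lemma l_pos: "l j > 0"
  using \<delta>(1) \<delta>(2)[of j] by linarith

lemma source_density:
  "gaussian_density m R x = (\<Prod>j\<in>UNIV. normal_density (v j \<bullet> m) (sqrt (l j)) (v j \<bullet> x))"
  by (rule gaussian_density_eigenbasis[OF v eig l_pos])

lemma source_density_pos: "gaussian_density m R x > 0"
  unfolding source_density using l_pos by (intro prod_pos) (auto intro!: normal_density_pos)

lemma source_density_measurable[measurable]: "gaussian_density m R \<in> borel_measurable borel"
  unfolding source_density[abs_def] by measurable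

lemma prob_space_source: "prob_space (gaussian_measure m R)"
  unfolding gaussian_measure_def source_density[abs_def]
  using l_pos by (intro prob_space_normal_onb[OF v]) auto

lemma reproduction_density_measurable[measurable]: "reproduction_density \<in> borel_measurable borel"
  unfolding reproduction_density_def[abs_def] by measurable

lemma reproduction_density_pos: "reproduction_density y > 0"
  unfolding reproduction_density_def using \<delta>(2) by (intro prod_pos) (auto intro!: normal_density_pos)

lemma prob_space_reproduction: "prob_space (density lborel reproduction_density)"
  unfolding reproduction_density_def[abs_def]
  using \<delta>(2) by (intro prob_space_normal_onb[OF v]) auto

lemma test_channel_exp:
  "test_channel y x = (1 / sqrt (2 * pi * \<delta>)) ^ CARD('n) * exp (- (norm (x - y))\<^sup>2 / (2 * \<delta>))"
proof -
  have "test_channel y x = (1 / sqrt (2 * pi * \<delta>)) ^ CARD('n) * exp (\<Sum>j\<in>UNIV. - (v j \<bullet> x - v j \<bullet> y)\<^sup>2 / (2 * \<delta>))"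
    using \<delta>(1) by (simp add: test_channel_def normal_density_def prod.distrib prod_dividef exp_sum power_divide)
  also have "(\<Sum>j\<in>UNIV. - (v j \<bullet> x - v j \<bullet> y)\<^sup>2 / (2 * \<delta>)) = - (norm (x - y))\<^sup>2 / (2 * \<delta>)"
    unfolding power2_norm_eq_inner onb_inner_expand[OF v, of "x - y" "x - y"]
    by (simp add: sum_negf sum_divide_distrib power2_eq_square inner_diff_right)
  finally show ?thesis .
qed

lemma test_channel_pos: "test_channel y x > 0"
  unfolding test_channel_exp using \<delta>(1) by simp

lemma ln_test_channel:
  "ln (test_channel y x) = - (real CARD('n) / 2 * ln (2 * pi * \<delta>)) - (norm (x - y))\<^sup>2 / (2 * \<delta>)"
  unfolding test_channel_exp using \<delta>(1) by (simp add: ln_mult ln_realpow ln_div ln_sqrt)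

lemma test_channel_measurable[measurable]:
  assumes [measurable]: "f \<in> borel_measurable N" "g \<in> borel_measurable N"
  shows "(\<lambda>z. test_channel (f z) (g z)) \<in> borel_measurable N"
  unfolding test_channel_exp by measurable

lemma prob_space_test_channel: "prob_space (density lborel (test_channel y))"
  unfolding test_channel_def[abs_def] using \<delta>(1) by (intro prob_space_normal_onb[OF v]) auto

lemma test_channel_integral: "(\<integral>\<^sup>+ x. ennreal (test_channel y x) \<partial>lborel) = 1"
proof -
  interpret prob_space "density lborel (test_channel y)"
    by (rule prob_space_test_channel)
  show ?thesis
    using emeasure_space_1 by (simp add: emeasure_density)
qed

text \<open>The second moment is read off the entropy, since the logarithm of the density is quadratic.\<close>

lemma test_channel_distortion:
  "(\<integral>\<^sup>+ x. ennreal (test_channel y x) * ennreal ((norm (x - y))\<^sup>2) \<partial>lborel) = ennreal (real CARD('n) * \<delta>)"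
proof -
  let ?Q = "density lborel (test_channel y)"
  interpret Q: prob_space ?Q
    by (rule prob_space_test_channel)
  have "distributed ?Q lborel (\<lambda>x. x) (\<lambda>x. ennreal (test_channel y x))"
    by (auto simp: distributed_def intro!: distr_id2)
  then have D: "distributed ?Q lborel (\<lambda>x. x) (\<lambda>x. ennreal (\<Prod>j\<in>UNIV. normal_density (v j \<bullet> y) (sqrt \<delta>) (v j \<bullet> x)))"
    by (simp add: test_channel_def)
  have int: "integrable ?Q (\<lambda>x. ln (test_channel y x))"
    and val: "(\<integral>x. ln (test_channel y x) \<partial>?Q) = - (real CARD('n) * ln (2 * pi * exp 1 * \<delta>) / 2)"
    using Q.log_density_normal_onb[OF v _ D] \<delta>(1) by (simp_all flip: test_channel_def)
  have eq: "(norm (x - y))\<^sup>2 = - 2 * \<delta> * (ln (test_channel y x) + real CARD('n) / 2 * ln (2 * pi * \<delta>))" for x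
    using \<delta>(1) by (simp add: ln_test_channel)
  have "integrable ?Q (\<lambda>x. (norm (x - y))\<^sup>2)"
    unfolding eq using int by auto
  then have "(\<integral>\<^sup>+ x. ennreal ((norm (x - y))\<^sup>2) \<partial>?Q) = ennreal (\<integral>x. (norm (x - y))\<^sup>2 \<partial>?Q)"
    by (rule nn_integral_eq_integral) simp
  also have "(\<integral>x. (norm (x - y))\<^sup>2 \<partial>?Q) = - 2 * \<delta> * (- (real CARD('n) * ln (2 * pi * exp 1 * \<delta>) / 2) + real CARD('n) / 2 * ln (2 * pi * \<delta>))"
    unfolding eq using int val Q.prob_space by simp
  also have "\<dots> = real CARD('n) * \<delta>"
  proof -
    have *: "ln (2 * pi * exp 1 * \<delta>) = ln (2 * pi * \<delta>) + 1"
      using \<delta>(1) by (simp add: ln_mult)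
    show ?thesis
      unfolding * by (simp add: field_simps)
  qed
  finally show ?thesis
    by (simp add: nn_integral_density)
qed

definition log_ratio :: "(real^'n) \<times> (real^'n) \<Rightarrow> real" where
  "log_ratio z = ln (test_channel (snd z) (fst z)) - ln (gaussian_density m R (fst z))"

lemma exp_log_ratio: "exp (log_ratio z) = test_channel (snd z) (fst z) / gaussian_density m R (fst z)"
  using test_channel_pos source_density_pos by (simp add: log_ratio_def exp_diff)

lemma log_ratio_measurable[measurable]: "log_ratio \<in> borel_measurable (borel \<Otimes>\<^sub>M borel)"
  unfolding log_ratio_def[abs_def] by measurable

text \<open>The log of the channel density is a constant minus a multiple of the squared error, and
  the other term depends on \<open>x\<close> alone. So only the source law and the mean distortion
  enter, and the formula serves the lower bound and the optimal law alike.\<close>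

lemma expectation_log_ratio:
  assumes P: "prob_space P" "sets P = sets (borel \<Otimes>\<^sub>M borel)"
    and X: "distr P borel fst = gaussian_measure m R"
    and int: "integrable P (\<lambda>z. (norm (fst z - snd z))\<^sup>2)"
  shows "integrable P log_ratio"
    "(\<integral>z. log_ratio z \<partial>P) =
      gaussian_rate + (real CARD('n) - (\<integral>z. (norm (fst z - snd z))\<^sup>2 \<partial>P) / \<delta>) / 2"
proof -
  interpret P: prob_space P by (rule P)
  have [measurable]: "fst \<in> borel_measurable P"
    using P(2) measurable_fst[of "borel :: (real^'n) measure" "borel :: (real^'n) measure"]
    by (simp cong: measurable_cong_sets)
  have "distributed P lborel fst (\<lambda>x. ennreal (gaussian_density m R x))"
    using X by (simp add: distributed_def gaussian_measure_def cong: distr_cong)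
  then have D: "distributed P lborel fst (\<lambda>x. ennreal (\<Prod>j\<in>UNIV. normal_density (v j \<bullet> m) (sqrt (l j)) (v j \<bullet> x)))"
    by (simp add: source_density)
  have s: "integrable P (\<lambda>z. ln (gaussian_density m R (fst z)))"
    "(\<integral>z. ln (gaussian_density m R (fst z)) \<partial>P) = - (\<Sum>j\<in>UNIV. ln (2 * pi * exp 1 * l j) / 2)"
    using P.log_density_normal_onb[OF v _ D] l_pos less_imp_le[OF l_pos] by (simp_all add: source_density)
  show "integrable P log_ratio"
    unfolding log_ratio_def[abs_def] ln_test_channel using s(1) int by auto
  have "(\<integral>z. log_ratio z \<partial>P) = - (real CARD('n) / 2 * ln (2 * pi * \<delta>)) - (\<integral>z. (norm (fst z - snd z))\<^sup>2 \<partial>P) / (2 * \<delta>)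
      + (\<Sum>j\<in>UNIV. ln (2 * pi * exp 1 * l j) / 2)"
    unfolding log_ratio_def[abs_def] ln_test_channel using s int by (simp add: P.prob_space)
  also have "(\<Sum>j\<in>UNIV. ln (2 * pi * exp 1 * l j) / 2) = real CARD('n) / 2 * (ln (2 * pi) + 1) + (\<Sum>j\<in>UNIV. ln (l j)) / 2"
    using l_pos by (simp add: ln_mult less_imp_neq[symmetric] sum.distrib add_divide_distrib sum_divide_distrib algebra_simps)
  finally show "(\<integral>z. log_ratio z \<partial>P) =
      gaussian_rate + (real CARD('n) - (\<integral>z. (norm (fst z - snd z))\<^sup>2 \<partial>P) / \<delta>) / 2"
    using \<delta>(1) by (simp add: gaussian_rate_def ln_mult algebra_simps add_divide_distrib diff_divide_distrib)
qed

section \<open>Lower bound for every admissible joint law\<close>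

lemma gaussian_rate_le_mutual_information:
  assumes P: "prob_space P" "sets P = sets (borel \<Otimes>\<^sub>M borel)"
    and X: "distr P borel fst = gaussian_measure m R"
    and ac: "absolutely_continuous (distr P borel fst \<Otimes>\<^sub>M distr P borel snd) P"
    and int: "integrable P (entropy_density (exp 1) (distr P borel fst \<Otimes>\<^sub>M distr P borel snd) P)"
    and dist: "(\<integral>\<^sup>+ z. ennreal ((norm (fst z - snd z))\<^sup>2) \<partial>P) \<le> ennreal (real CARD('n) * \<delta>)"
  shows "gaussian_rate \<le> prob_space.mutual_information P (exp 1) borel borel fst snd"
proof -
  interpret P: prob_space P by (rule P)
  note [measurable_cong] = P(2)
  have [measurable]: "fst \<in> borel_measurable P" "snd \<in> borel_measurable P"
    by measurable
  define Y where "Y = distr P borel snd"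
  have sets_Y[measurable_cong]: "sets Y = sets borel"
    by (simp add: Y_def)
  have sets_X[measurable_cong]: "sets (gaussian_measure m R) = sets borel"
    by (simp add: gaussian_measure_def)
  interpret X: prob_space "gaussian_measure m R"
    by (rule prob_space_source)
  interpret Y: prob_space Y
    unfolding Y_def by (rule P.prob_space_distr) measurable
  interpret XY: pair_prob_space "gaussian_measure m R" Y ..
  have D: "integrable P (\<lambda>z. (norm (fst z - snd z))\<^sup>2)"
    using dist by (intro integrableI_bounded) (auto intro: le_less_trans)
  have "ennreal (\<integral>z. (norm (fst z - snd z))\<^sup>2 \<partial>P) \<le> ennreal (real CARD('n) * \<delta>)"
    using dist by (subst nn_integral_eq_integral[OF D, symmetric]) auto
  then have D_le: "(\<integral>z. (norm (fst z - snd z))\<^sup>2 \<partial>P) \<le> real CARD('n) * \<delta>"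
    using \<delta>(1) by (subst (asm) ennreal_le_iff) auto
  have "(\<integral>\<^sup>+ z. ennreal (exp (log_ratio z)) \<partial>(gaussian_measure m R \<Otimes>\<^sub>M Y)) =
      (\<integral>\<^sup>+ y. \<integral>\<^sup>+ x. ennreal (exp (log_ratio (x, y))) \<partial>gaussian_measure m R \<partial>Y)"
    by (rule XY.nn_integral_snd[symmetric]) measurable
  \<comment> \<open>The source density cancels against the denominator of
    \<open>exp (log_ratio (x, y))\<close>. A probability density in \<open>x\<close> remains for
    each \<open>y\<close>, so the exponential moment is 1 whatever the law of the
    reproduction.\<close>
  also have "\<dots> = (\<integral>\<^sup>+ y. \<integral>\<^sup>+ x. ennreal (test_channel y x) \<partial>lborel \<partial>Y)"
  proof (rule nn_integral_cong)
    fix y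
    have "(\<integral>\<^sup>+ x. ennreal (exp (log_ratio (x, y))) \<partial>gaussian_measure m R) =
        (\<integral>\<^sup>+ x. ennreal (gaussian_density m R x) * ennreal (exp (log_ratio (x, y))) \<partial>lborel)"
      unfolding gaussian_measure_def by (rule nn_integral_density) measurable
    also have "\<dots> = (\<integral>\<^sup>+ x. ennreal (test_channel y x) \<partial>lborel)"
      using source_density_pos
      by (intro nn_integral_cong)
        (simp add: exp_log_ratio less_imp_le less_imp_neq[symmetric] flip: ennreal_mult')
    finally show "(\<integral>\<^sup>+ x. ennreal (exp (log_ratio (x, y))) \<partial>gaussian_measure m R) =
        (\<integral>\<^sup>+ x. ennreal (test_channel y x) \<partial>lborel)" .
  qed
  also have "\<dots> = 1"
    by (simp add: test_channel_integral Y.emeasure_space_1)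
  finally have le: "(\<integral>\<^sup>+ z. ennreal (exp (log_ratio z)) \<partial>(gaussian_measure m R \<Otimes>\<^sub>M Y)) \<le> 1"
    by simp
  have "sets P = sets (gaussian_measure m R \<Otimes>\<^sub>M Y)"
    unfolding P(2) by (rule sets_pair_measure_cong) (simp_all add: sets_X sets_Y)
  then have "(\<integral>z. log_ratio z \<partial>P) \<le> KL_divergence (exp 1) (gaussian_measure m R \<Otimes>\<^sub>M Y) P"
    using ac int expectation_log_ratio(1)[OF P X D] le unfolding X Y_def[symmetric]
    by (intro KL_divergence_ge P XY.prob_space_axioms) auto
  moreover have "gaussian_rate \<le> (\<integral>z. log_ratio z \<partial>P)"
    using D_le \<delta>(1) by (simp add: expectation_log_ratio(2)[OF P X D] field_simps)
  ultimately show ?thesis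
    by (simp add: mutual_information_fst_snd[OF P] X Y_def)
qed

section \<open>Attainment of the lower bound\<close>

lemma ex_gaussian_rate_achieved:
  obtains P where "prob_space P" "sets P = sets (borel \<Otimes>\<^sub>M borel)" "distr P borel fst = gaussian_measure m R"
    "absolutely_continuous (distr P borel fst \<Otimes>\<^sub>M distr P borel snd) P"
    "integrable P (entropy_density (exp 1) (distr P borel fst \<Otimes>\<^sub>M distr P borel snd) P)"
    "(\<integral>\<^sup>+ z. ennreal ((norm (fst z - snd z))\<^sup>2) \<partial>P) \<le> ennreal (real CARD('n) * \<delta>)"
    "prob_space.mutual_information P (exp 1) borel borel fst snd = gaussian_rate"
proof -
  let ?L = "lborel \<Otimes>\<^sub>M lborel :: ((real^'n) \<times> (real^'n)) measure"
  define p where "p z = reproduction_density (snd z) * test_channel (snd z) (fst z)" for z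
  have [measurable]: "p \<in> borel_measurable (borel \<Otimes>\<^sub>M borel)"
    unfolding p_def by measurable
  have p0: "p z \<ge> 0" for z
    using reproduction_density_pos test_channel_pos by (simp add: p_def less_imp_le)
  define P where "P = density ?L p"
  define Y where "Y = density lborel reproduction_density"
  interpret X: prob_space "gaussian_measure m R"
    by (rule prob_space_source)
  interpret Y: prob_space Y
    unfolding Y_def by (rule prob_space_reproduction)
  have sets_Y[measurable_cong]: "sets Y = sets borel"
    by (simp add: Y_def)
  have sets_X[measurable_cong]: "sets (gaussian_measure m R) = sets borel"
    by (simp add: gaussian_measure_def)
  have sets_L: "sets ?L = sets (borel \<Otimes>\<^sub>M borel)"
    by (rule sets_pair_measure_cong) simp_all
  have sets_P: "sets P = sets (borel \<Otimes>\<^sub>M borel)"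
    by (simp add: P_def sets_L)
  note [measurable_cong] = sets_P
  have nn_P: "(\<integral>\<^sup>+ z. h z \<partial>P) = (\<integral>\<^sup>+ y. \<integral>\<^sup>+ x. ennreal (p (x, y)) * h (x, y) \<partial>lborel \<partial>lborel)"
    if [measurable]: "h \<in> borel_measurable (borel \<Otimes>\<^sub>M borel)" for h
  proof -
    have "(\<integral>\<^sup>+ z. h z \<partial>P) = (\<integral>\<^sup>+ z. ennreal (p z) * h z \<partial>?L)"
      unfolding P_def by (rule nn_integral_density) measurable
    also have "\<dots> = (\<integral>\<^sup>+ y. \<integral>\<^sup>+ x. ennreal (p (x, y)) * h (x, y) \<partial>lborel \<partial>lborel)"
      by (rule lborel_pair.nn_integral_snd[symmetric]) measurable
    finally show ?thesis .
  qed
  have Y: "distr P borel snd = Y"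
  proof (rule measure_eqI)
    fix A assume "A \<in> sets (distr P borel snd)"
    then have [measurable]: "A \<in> sets borel"
      by simp
    have "emeasure (distr P borel snd) A = (\<integral>\<^sup>+ z. indicator A (snd z) \<partial>P)"
    proof -
      have "(\<integral>\<^sup>+ z. indicator A (snd z) \<partial>P) = (\<integral>\<^sup>+ y. indicator A y \<partial>distr P borel snd)"
        by (rule nn_integral_distr[symmetric]) measurable
      also have "\<dots> = emeasure (distr P borel snd) A"
        by (rule nn_integral_indicator) simp
      finally show ?thesis
        by (rule sym)
    qed
    also have "\<dots> = (\<integral>\<^sup>+ y. \<integral>\<^sup>+ x. ennreal (p (x, y)) * indicator A y \<partial>lborel \<partial>lborel)"
      by (subst nn_P) auto
    also have "\<dots> = (\<integral>\<^sup>+ y. ennreal (reproduction_density y) * indicator A y \<partial>lborel)"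
    proof (rule nn_integral_cong)
      fix y
      have "(\<integral>\<^sup>+ x. ennreal (p (x, y)) * indicator A y \<partial>lborel) =
          (\<integral>\<^sup>+ x. (ennreal (reproduction_density y) * indicator A y) * ennreal (test_channel y x) \<partial>lborel)"
        by (intro nn_integral_cong)
          (simp add: p_def ennreal_mult less_imp_le[OF reproduction_density_pos] less_imp_le[OF test_channel_pos] mult_ac)
      then show "(\<integral>\<^sup>+ x. ennreal (p (x, y)) * indicator A y \<partial>lborel) = ennreal (reproduction_density y) * indicator A y"
        by (simp add: nn_integral_cmult test_channel_integral)
    qed
    also have "\<dots> = emeasure Y A"
      unfolding Y_def by (rule emeasure_density[symmetric]) auto
    finally show "emeasure (distr P borel snd) A = emeasure Y A" .
  qed (simp add: sets_Y)
  have X: "distr P borel fst = gaussian_measure m R"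
  proof (rule measure_eqI)
    fix A assume "A \<in> sets (distr P borel fst)"
    then have [measurable]: "A \<in> sets borel"
      by simp
    \<comment> \<open>The forward channel from \<open>x\<close> to \<open>y\<close> given by
      \<open>normal_density_split\<close>. The joint density is built from the \<open>y\<close>
      side, and this second factorisation exhibits the source as its first marginal.\<close>
    define w where "w x y = (\<Prod>j\<in>UNIV. normal_density (v j \<bullet> m + (l j - \<delta>) / l j * (v j \<bullet> x - v j \<bullet> m)) (sqrt (\<delta> * (l j - \<delta>) / l j)) (v j \<bullet> y))" for x y
    have p_w: "p (x, y) = gaussian_density m R x * w x y" for x y
      unfolding w_def p_def reproduction_density_def test_channel_def source_density
      by (simp add: normal_density_split[OF \<delta>] flip: prod.distrib)
    have w_nonneg: "w x y \<ge> 0" for x y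
      by (simp add: w_def prod_nonneg)
    have [measurable]: "w x \<in> borel_measurable borel" for x
      unfolding w_def by measurable
    have w_int: "(\<integral>\<^sup>+ y. ennreal (w x y) \<partial>lborel) = 1" for x
    proof -
      interpret W: prob_space "density lborel (\<lambda>y. ennreal (w x y))"
        unfolding w_def using \<delta> l_pos by (intro prob_space_normal_onb[OF v]) auto
      show ?thesis
        using W.emeasure_space_1 by (simp add: emeasure_density)
    qed
    have "emeasure (distr P borel fst) A = (\<integral>\<^sup>+ z. indicator A (fst z) \<partial>P)"
    proof -
      have "(\<integral>\<^sup>+ z. indicator A (fst z) \<partial>P) = (\<integral>\<^sup>+ y. indicator A y \<partial>distr P borel fst)"
        by (rule nn_integral_distr[symmetric]) measurable
      also have "\<dots> = emeasure (distr P borel fst) A"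
        by (rule nn_integral_indicator) simp
      finally show ?thesis
        by (rule sym)
    qed
    also have "\<dots> = (\<integral>\<^sup>+ y. \<integral>\<^sup>+ x. ennreal (p (x, y)) * indicator A x \<partial>lborel \<partial>lborel)"
      by (subst nn_P) auto
    also have "\<dots> = (\<integral>\<^sup>+ x. \<integral>\<^sup>+ y. ennreal (p (x, y)) * indicator A x \<partial>lborel \<partial>lborel)"
      by (rule lborel_pair.Fubini') measurable
    also have "\<dots> = (\<integral>\<^sup>+ x. ennreal (gaussian_density m R x) * indicator A x \<partial>lborel)"
    proof (rule nn_integral_cong)
      fix x
      have "(\<integral>\<^sup>+ y. ennreal (p (x, y)) * indicator A x \<partial>lborel) =
          (\<integral>\<^sup>+ y. (ennreal (gaussian_density m R x) * indicator A x) * ennreal (w x y) \<partial>lborel)"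
        by (intro nn_integral_cong)
          (simp add: p_w ennreal_mult less_imp_le[OF source_density_pos] w_nonneg mult_ac)
      then show "(\<integral>\<^sup>+ y. ennreal (p (x, y)) * indicator A x \<partial>lborel) = ennreal (gaussian_density m R x) * indicator A x"
        by (simp add: nn_integral_cmult w_int)
    qed
    also have "\<dots> = emeasure (gaussian_measure m R) A"
      unfolding gaussian_measure_def by (rule emeasure_density[symmetric]) auto
    finally show "emeasure (distr P borel fst) A = emeasure (gaussian_measure m R) A" .
  qed (simp add: sets_X)
  have prob_P: "prob_space P"
  proof
    have "emeasure P (space P) = emeasure (distr P borel snd) (space Y)"
      by (subst emeasure_distr) (auto simp: Y_def)
    then show "emeasure P (space P) = 1"
      by (simp add: Y Y.emeasure_space_1)
  qed
  interpret P: prob_space P by (rule prob_P)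
  interpret XY: pair_prob_space "gaussian_measure m R" Y ..
  let ?Q = "gaussian_measure m R \<Otimes>\<^sub>M Y"
  have "?Q = density ?L (\<lambda>(x, y). ennreal (gaussian_density m R x) * ennreal (reproduction_density y))"
    unfolding gaussian_measure_def Y_def
    by (intro pair_measure_density) (auto simp: sigma_finite_lborel Y.sigma_finite_measure_axioms simp flip: Y_def)
  moreover have "density (density ?L (\<lambda>(x, y). ennreal (gaussian_density m R x) * ennreal (reproduction_density y)))
      (\<lambda>z. ennreal (exp (log_ratio z))) = P"
  proof -
    have "ennreal (gaussian_density m R x) * ennreal (reproduction_density y) * ennreal (exp (log_ratio (x, y))) = ennreal (p (x, y))" for x y
      using source_density_pos[of x] reproduction_density_pos[of y] test_channel_pos[of y x]
      by (simp add: exp_log_ratio p_def less_imp_le flip: ennreal_mult)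
    then show ?thesis
      unfolding P_def by (subst density_density_eq) (auto simp: split_beta' intro!: arg_cong2[where f = density])
  qed
  ultimately have PQ: "density ?Q (\<lambda>z. ennreal (exp (log_ratio z))) = P"
    by simp
  have [measurable]: "log_ratio \<in> borel_measurable ?Q"
    by measurable
  have ac: "absolutely_continuous ?Q P"
    unfolding PQ[symmetric] by (rule absolutely_continuousI_density) measurable
  \<comment> \<open>Uniqueness of the Radon-Nikodym derivative makes \<open>log_ratio\<close> the
    entropy density of this law, so the test function of the lower bound loses nothing here.\<close>
  have "AE z in ?Q. ennreal (exp (log_ratio z)) = RN_deriv ?Q P z"
    by (rule XY.RN_deriv_unique[OF _ PQ]) measurable
  then have "AE z in ?Q. entropy_density (exp 1) ?Q P z = log_ratio z"
  proof eventually_elim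
    fix z assume "ennreal (exp (log_ratio z)) = RN_deriv ?Q P z"
    then have "enn2real (RN_deriv ?Q P z) = exp (log_ratio z)"
      by (metis enn2real_ennreal exp_ge_zero)
    then show "entropy_density (exp 1) ?Q P z = log_ratio z"
      by (simp add: entropy_density_def log_def)
  qed
  then have AE: "AE z in P. entropy_density (exp 1) ?Q P z = log_ratio z"
    using sets_P by (intro absolutely_continuous_AE[OF _ ac]) (simp_all add: sets_X sets_Y cong: sets_pair_measure_cong)
  have dist: "(\<integral>\<^sup>+ z. ennreal ((norm (fst z - snd z))\<^sup>2) \<partial>P) = ennreal (real CARD('n) * \<delta>)"
  proof -
    have "(\<integral>\<^sup>+ z. ennreal ((norm (fst z - snd z))\<^sup>2) \<partial>P) =
        (\<integral>\<^sup>+ y. \<integral>\<^sup>+ x. ennreal (p (x, y)) * ennreal ((norm (x - y))\<^sup>2) \<partial>lborel \<partial>lborel)"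
      by (subst nn_P) auto
    also have "\<dots> = (\<integral>\<^sup>+ y. ennreal (reproduction_density y) * ennreal (real CARD('n) * \<delta>) \<partial>lborel)"
    proof (rule nn_integral_cong)
      fix y
      have "(\<integral>\<^sup>+ x. ennreal (p (x, y)) * ennreal ((norm (x - y))\<^sup>2) \<partial>lborel) =
          (\<integral>\<^sup>+ x. ennreal (reproduction_density y) * (ennreal (test_channel y x) * ennreal ((norm (x - y))\<^sup>2)) \<partial>lborel)"
        by (intro nn_integral_cong)
          (simp add: p_def ennreal_mult less_imp_le[OF reproduction_density_pos] less_imp_le[OF test_channel_pos] mult_ac)
      then show "(\<integral>\<^sup>+ x. ennreal (p (x, y)) * ennreal ((norm (x - y))\<^sup>2) \<partial>lborel) =
          ennreal (reproduction_density y) * ennreal (real CARD('n) * \<delta>)"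
        by (simp add: nn_integral_cmult test_channel_distortion)
    qed
    also have "\<dots> = emeasure Y (space Y) * ennreal (real CARD('n) * \<delta>)"
      unfolding Y_def by (simp add: nn_integral_multc emeasure_density)
    finally show ?thesis
      by (simp add: Y.emeasure_space_1)
  qed
  have D: "has_bochner_integral P (\<lambda>z. (norm (fst z - snd z))\<^sup>2) (real CARD('n) * \<delta>)"
    using dist \<delta>(1) by (intro has_bochner_integral_nn_integral) auto
  note E = expectation_log_ratio[OF prob_P sets_P X integrable.intros[OF D]]
  show thesis
  proof (rule that[OF prob_P sets_P X])
    show "absolutely_continuous (distr P borel fst \<Otimes>\<^sub>M distr P borel snd) P"
      using ac by (simp add: X Y)
    have "entropy_density (exp 1) ?Q P \<in> borel_measurable P" "log_ratio \<in> borel_measurable P"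
      using measurable_entropy_density[of "exp 1" ?Q P] by (simp_all cong: measurable_cong_sets)
    then show "integrable P (entropy_density (exp 1) (distr P borel fst \<Otimes>\<^sub>M distr P borel snd) P)"
      unfolding X Y using E(1) AE by (subst integrable_cong_AE) auto
    have "KL_divergence (exp 1) ?Q P = (\<integral>z. log_ratio z \<partial>P)"
      unfolding KL_divergence_def using AE
      by (intro integral_cong_AE) (simp_all cong: measurable_cong_sets)
    then show "prob_space.mutual_information P (exp 1) borel borel fst snd = gaussian_rate"
      using E(2) has_bochner_integral_integral_eq[OF D] \<delta>(1)
      by (simp add: mutual_information_fst_snd[OF prob_P sets_P] X Y)
  qed (simp add: dist)
qed

lemma rate_distortion_gaussian:
  "rate_distortion (gaussian_measure m R) (real CARD('n) * \<delta>) = gaussian_rate"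
proof -
  obtain P where "prob_space P" "sets P = sets (borel \<Otimes>\<^sub>M borel)" "distr P borel fst = gaussian_measure m R"
    "absolutely_continuous (distr P borel fst \<Otimes>\<^sub>M distr P borel snd) P"
    "integrable P (entropy_density (exp 1) (distr P borel fst \<Otimes>\<^sub>M distr P borel snd) P)"
    "(\<integral>\<^sup>+ z. ennreal ((norm (fst z - snd z))\<^sup>2) \<partial>P) \<le> ennreal (real CARD('n) * \<delta>)"
    "prob_space.mutual_information P (exp 1) borel borel fst snd = gaussian_rate"
    by (rule ex_gaussian_rate_achieved)
  then show ?thesis
    unfolding rate_distortion_def
    by (intro cInf_eq_minimum) (force, auto intro: gaussian_rate_le_mutual_information)
qed

end

section \<open>The group transform and the Karhunen--Loeve transform\<close>

lemma sum_matrix_vector_mult: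
  fixes A :: "'i \<Rightarrow> real^'n^'m"
  shows "(\<Sum>i\<in>I. A i) *v x = (\<Sum>i\<in>I. A i *v x)"
  by (induction I rule: infinite_finite_induct) (simp_all add: matrix_vector_mult_add_rdistrib)

lemma mat_vector_mult: "mat a *v x = a *\<^sub>R (x :: real^'n)"
  by (simp add: vec_eq_iff matrix_vector_mult_def mat_def if_distrib if_distribR cong: if_cong)

lemma KLT_eigenvalues:
  assumes "pos_def R" "is_KLT R V"
  obtains l where "\<And>i. R *v row i V = l i *\<^sub>R row i V" "\<And>i. l i > 0"
proof -
  obtain l where l: "R *v row i V = l i *\<^sub>R row i V" for i
    using assms(2) unfolding is_KLT_def by metis
  have on: "row i V \<bullet> row i V = 1" for i
    using onb_inner[OF onb_rows, of V i i] assms(2) by (simp add: is_KLT_def)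
  then have "row i V \<noteq> 0" for i
    by (metis inner_zero_left zero_neq_one)
  then have "row i V \<bullet> (R *v row i V) > 0" for i
    using assms(1) by (simp add: pos_def_def)
  then have "l i > 0" for i
    by (simp only: l inner_scaleR_right on mult_1_right)
  then show thesis
    using l that by blast
qed

lemma sum_over_sectors:
  fixes f :: "'n::finite \<Rightarrow> real"
  assumes "sectors G \<pi> = range s"
  shows "(\<Sum>S\<in>sectors G \<pi>. \<Sum>i\<in>{i. s i = S}. f i) = (\<Sum>i\<in>UNIV. f i)"
  using sum.group[of UNIV "range s" s f] assms by simp

context
  fixes G :: "('g, 'm) monoid_scheme" and \<pi> :: "'g \<Rightarrow> real^'n^'n" and R U :: "real^'n^'n"
  assumes G: "Group.group G" and rep: "unitary_rep G \<pi>" and U: "is_group_transform G \<pi> R U"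
begin

text \<open>Distinct sectors are orthogonal, so the rows lying in a sector span it, and a nonzero
  sector contains a row: the sectors are the finitely many values of \<open>s\<close>. Inside a
  sector the rows diagonalise the compression, hence they are orthogonal for the form of
  \<open>R\<close> and the eigenvalues are its diagonal entries.\<close>

lemma group_transform_sectors:
  obtains s where "\<And>i. s i \<in> sectors G \<pi>" "sectors G \<pi> = range s"
    "\<And>S. S \<in> sectors G \<pi> \<Longrightarrow> onb (\<lambda>i. row i U) {i. s i = S} S"
    "\<And>S i. S \<in> sectors G \<pi> \<Longrightarrow> compression R S *v row i U =
      (if s i = S then (row i U \<bullet> (R *v row i U)) *\<^sub>R row i U else 0)"
    "\<And>i k. s i = s k \<Longrightarrow> i \<noteq> k \<Longrightarrow> row i U \<bullet> (R *v row k U) = 0"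
proof -
  let ?u = "\<lambda>i. row i U"
  have u: "onb ?u UNIV UNIV"
    using U by (intro onb_rows) (simp add: is_group_transform_def)
  obtain s l where s: "\<And>i. s i \<in> sectors G \<pi>" "\<And>i. ?u i \<in> s i"
    and l: "\<And>i. compression R (s i) *v ?u i = l i *\<^sub>R ?u i"
    using U unfolding is_group_transform_def by metis
  have onb: "onb ?u {i. s i = S} S" if S: "S \<in> sectors G \<pi>" for S
  proof (rule onb_subset[OF u])
    show "\<forall>x\<in>S. ?u i \<bullet> x = 0" if "i \<in> UNIV - {i. s i = S}" for i
      using that sectors_orthogonal[OF G rep s(1) S _ s(2)] by auto
  qed (use s sector_subspace[OF S] in auto)
  have range: "sectors G \<pi> = range s"
  proof (intro equalityI subsetI)
    fix S assume S: "S \<in> sectors G \<pi>"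
    have "{i. s i = S} \<noteq> {}"
      using onb[OF S] sector_nonzero[OF S] by (auto simp: onb_def)
    then show "S \<in> range s"
      by auto
  qed (use s in auto)
  have P: "orth_proj (s i) *v ?u i = ?u i" for i
    unfolding orth_proj_onb[OF onb[OF s(1)]] using onb_proj_unique[OF onb[OF s(1)] s(2)] by simp
  have P0: "orth_proj S *v ?u i = 0" if "S \<in> sectors G \<pi>" "s i \<noteq> S" for S i
    unfolding orth_proj_onb[OF onb[OF that(1)]]
    using sectors_orthogonal[OF G rep that(1) s(1) _ _ s(2), of i] that(2)
    by (intro onb_proj_unique[OF onb[OF that(1)]])
      (auto simp: subspace_0[OF sector_subspace[OF that(1)]])
  have Pi: "?u i \<bullet> (orth_proj (s i) *v y) = ?u i \<bullet> y" for i y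
    unfolding orth_proj_onb[OF onb[OF s(1)]] by (rule onb_proj_inner[OF onb[OF s(1)] s(2)])
  have comp: "compression R S *v x = orth_proj S *v (R *v (orth_proj S *v x))" for S x
    by (simp add: compression_def flip: matrix_vector_mul_assoc)
  \<comment> \<open>The projection onto the common sector is self-adjoint and fixes both rows, so it
    can be inserted on both sides of \<open>R\<close>.\<close>
  have ul: "?u i \<bullet> (R *v ?u k) = l k * (?u i \<bullet> ?u k)" if "s i = s k" for i k
  proof -
    have "?u i \<bullet> (R *v ?u k) = ?u i \<bullet> (compression R (s k) *v ?u k)"
      unfolding comp P using Pi[of i] that by simp
    then show ?thesis
      by (simp add: l)
  qed
  then have "l i = ?u i \<bullet> (R *v ?u i)" for i
    by (simp add: onb_inner[OF u])
  then have "compression R S *v ?u i = (if s i = S then (?u i \<bullet> (R *v ?u i)) *\<^sub>R ?u i else 0)"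
    if "S \<in> sectors G \<pi>" for S i
    using l[of i] P0[OF that, of i] by (auto simp: comp)
  moreover have "?u i \<bullet> (R *v ?u k) = 0" if "s i = s k" "i \<noteq> k" for i k
    using ul[OF that(1)] that(2) by (simp add: onb_inner[OF u])
  ultimately show thesis
    using that[OF s(1) range onb] by blast
qed

lemma block_diag_part_group_transform:
  "block_diag_part G \<pi> R *v row i U = (row i U \<bullet> (R *v row i U)) *\<^sub>R row i U"
proof -
  obtain s where s: "\<And>i. s i \<in> sectors G \<pi>" "sectors G \<pi> = range s"
    "\<And>S i. S \<in> sectors G \<pi> \<Longrightarrow> compression R S *v row i U =
      (if s i = S then (row i U \<bullet> (R *v row i U)) *\<^sub>R row i U else 0)"
    by (rule group_transform_sectors) blast
  \<comment> \<open>The sum defining \<open>block_diag_part\<close> would default to 0 over an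
    infinite set.\<close>
  have "finite (sectors G \<pi>)"
    by (simp add: s(2))
  moreover have "block_diag_part G \<pi> R *v row i U =
      (\<Sum>S\<in>sectors G \<pi>. if s i = S then (row i U \<bullet> (R *v row i U)) *\<^sub>R row i U else 0)"
    unfolding block_diag_part_def sum_matrix_vector_mult by (intro sum.cong refl s(3))
  ultimately show ?thesis
    using s(1) by simp
qed

lemma sum_ln_det_on_sectors:
  assumes "\<And>i. row i U \<bullet> (R *v row i U) > 0"
  shows "(\<Sum>S\<in>sectors G \<pi>. ln (det_on S (compression R S))) = (\<Sum>i\<in>UNIV. ln (row i U \<bullet> (R *v row i U)))"
proof -
  let ?d = "\<lambda>i. row i U \<bullet> (R *v row i U)"
  obtain s where s: "sectors G \<pi> = range s"
    "\<And>S. S \<in> sectors G \<pi> \<Longrightarrow> onb (\<lambda>i. row i U) {i. s i = S} S"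
    "\<And>S i. S \<in> sectors G \<pi> \<Longrightarrow> compression R S *v row i U = (if s i = S then ?d i *\<^sub>R row i U else 0)"
    by (rule group_transform_sectors) blast
  have u: "onb (\<lambda>i. row i U) UNIV UNIV"
    using U by (intro onb_rows) (simp add: is_group_transform_def)
  have "ln (det_on S (compression R S)) = (\<Sum>i\<in>{i. s i = S}. ln (?d i))" if S: "S \<in> sectors G \<pi>" for S
  proof -
    have "det_on S (compression R S) = (\<Prod>i\<in>{i. s i = S}. ?d i)"
      using s(3)[OF S] by (intro det_on_eigenbasis[OF u s(2)[OF S]]) auto
    then show ?thesis
      using assms by (simp add: ln_prod less_imp_neq[symmetric])
  qed
  then show ?thesis
    using sum_over_sectors[OF s(1)] by simp
qed

lemma multi_information_sectors:
  fixes v :: "'n \<Rightarrow> real^'n"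
  assumes V: "onb v UNIV UNIV" "\<And>j. R *v v j = l j *\<^sub>R v j" "\<And>j. l j > 0"
    and X: "gaussian_vector \<Omega> X m R"
  shows "multi_information \<Omega> X (sectors G \<pi>) =
    ((\<Sum>i\<in>UNIV. ln (row i U \<bullet> (R *v row i U))) - (\<Sum>j\<in>UNIV. ln (l j))) / 2"
proof -
  let ?d = "\<lambda>i. row i U \<bullet> (R *v row i U)"
  interpret prob_space \<Omega>
    using X by (simp add: gaussian_vector_def)
  have D: "distributed \<Omega> lborel X (\<lambda>x. ennreal (gaussian_density m R x))"
    using X by (simp add: gaussian_vector_def)
  have u: "onb (\<lambda>i. row i U) UNIV UNIV"
    using U by (intro onb_rows) (simp add: is_group_transform_def)
  have d: "?d i > 0" for i
    by (rule hadamard(1)[OF u V])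
  obtain s where s: "sectors G \<pi> = range s"
    "\<And>S. S \<in> sectors G \<pi> \<Longrightarrow> onb (\<lambda>i. row i U) {i. s i = S} S"
    "\<And>i k. s i = s k \<Longrightarrow> i \<noteq> k \<Longrightarrow> row i U \<bullet> (R *v row k U) = 0"
    by (rule group_transform_sectors) blast
  have sector: "entropy (exp 1) (lborel_on S) (\<lambda>\<omega>. orth_proj S *v X \<omega>) =
      (\<Sum>i\<in>{i. s i = S}. ln (2 * pi * exp 1 * ?d i) / 2)" if S: "S \<in> sectors G \<pi>" for S
    using S s d by (intro entropy_gaussian_projection[OF D V s(2)[OF S]]) auto
  have "orth_proj UNIV *v x = x" for x :: "real^'n"
    by (simp add: orth_proj_onb[OF V(1)] onb_proj_def onb_expand_UNIV[OF V(1)])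
  then have whole: "entropy (exp 1) lborel X = (\<Sum>j\<in>UNIV. ln (2 * pi * exp 1 * l j) / 2)"
    using entropy_gaussian_projection[OF D V V(1), of l] V onb_inner[OF V(1)]
    by (simp add: lborel_on_UNIV)
  \<comment> \<open>The constants \<open>2 * pi * exp 1\<close> occur once per coordinate in both
    sums and cancel in the difference.\<close>
  have split: "(\<Sum>i\<in>UNIV. ln (2 * pi * exp 1 * a i) / 2) =
      real CARD('n) * (ln (2 * pi * exp 1) / 2) + (\<Sum>i\<in>UNIV. ln (a i)) / 2"
    if "\<And>i. a i > 0" for a :: "'n \<Rightarrow> real"
  proof -
    have "ln (2 * pi * exp 1 * a i) / 2 = ln (2 * pi * exp 1) / 2 + ln (a i) / 2" for i
      using that[of i] by (subst ln_mult) (auto simp: add_divide_distrib)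
    then show ?thesis
      by (simp add: sum.distrib sum_divide_distrib add_divide_distrib)
  qed
  have "multi_information \<Omega> X (sectors G \<pi>) =
      (\<Sum>i\<in>UNIV. ln (2 * pi * exp 1 * ?d i) / 2) - (\<Sum>j\<in>UNIV. ln (2 * pi * exp 1 * l j) / 2)"
    unfolding multi_information_def whole
    using sector sum_over_sectors[OF s(1), of "\<lambda>i. ln (2 * pi * exp 1 * ?d i) / 2"] by simp
  then show ?thesis
    unfolding split[of ?d, OF d] split[of l, OF V(3)] by (simp add: diff_divide_distrib)
qed

end

section \<open>Distortion penalty, equality case and excess rates\<close>

theorem theorem4p9:
  fixes G :: "('g, 'm) monoid_scheme"
    and \<pi> :: "'g \<Rightarrow> real^'n^'n"
    and R U\<^sub>G V R\<^sub>0 :: "real^'n^'n"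
    and c M C :: real
  assumes "Group.group G"
    and "unitary_rep G \<pi>"
    and "pos_def R"
    and "is_group_transform G \<pi> R U\<^sub>G"
    and "is_KLT R V"
    and "c > 0"
    and "M = real CARD('n)"
    and "R\<^sub>0 = block_diag_part G \<pi> R"
    and "C = sector_information G \<pi> R"
  shows
    (* distortion at fixed rate B, and optimality of the KLT *)
    "(\<forall>U B. orthogonal_matrix U \<longrightarrow>
        coding_distortion c R U B = (c * M * exp (- 2 * B / M)) * geo_mean_var R U) \<and>
     (\<forall>U. orthogonal_matrix U \<longrightarrow> geo_mean_var R V \<le> geo_mean_var R U) \<and>
     (\<comment> \<open>the distortion penalty of the group transform relative to the KLT\<close>
      \<forall>B. coding_distortion c R U\<^sub>G B / coding_distortion c R V B
            = (det R\<^sub>0 / det R) powr (1 / M)) \<and>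
     (det R\<^sub>0 / det R) powr (1 / M) = exp (2 * C / M) \<and>
     exp (2 * C / M) \<ge> 1 \<and>
     (exp (2 * C / M) = 1 \<longleftrightarrow> weakly_symmetric G \<pi> R) \<and>
     (\<comment> \<open>the Gaussian multi-information among the sectors\<close>
      \<forall>(\<Omega> :: 'w measure) X m. gaussian_vector \<Omega> X m R \<longrightarrow>
        multi_information \<Omega> X (sectors G \<pi>) = C) \<and>
     (\<comment> \<open>excess rate at fixed distortion over the least rate of any transform\<close>
      \<forall>D>0. (\<forall>U. orthogonal_matrix U \<longrightarrow> coding_rate c R V D \<le> coding_rate c R U D) \<and>
        coding_rate c R U\<^sub>G D - coding_rate c R V D = C) \<and>
     (\<comment> \<open>excess rate over Shannon's rate-distortion function when \<open>D / M\<close> is below the least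
         eigenvalue of \<open>R\<close>; \<open>M / 2 * ln c\<close> is the loss of the quantizers, zero for ideal ones\<close>
      \<forall>m D. D > 0 \<longrightarrow> pos_def (R - mat (D / M)) \<longrightarrow>
        coding_rate c R U\<^sub>G D
          - (rate_distortion (gaussian_measure m R) D + M / 2 * ln c) = C)"
proof -
  note transform = assms(1,2,4)
  let ?v = "\<lambda>i. row i V" and ?u = "\<lambda>i. row i U\<^sub>G"
  let ?d = "\<lambda>U i. row i U \<bullet> (R *v row i U)"
  obtain l where eig: "\<And>i. R *v ?v i = l i *\<^sub>R ?v i" and l: "\<And>i. l i > 0"
    using KLT_eigenvalues[OF assms(3,5)] by metis
  have orth: "orthogonal_matrix V" "orthogonal_matrix U\<^sub>G"
    using assms(4,5) by (auto simp: is_KLT_def is_group_transform_def)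
  have v: "onb ?v UNIV UNIV" and u: "onb ?u UNIV UNIV"
    by (rule onb_rows[OF orth(1)], rule onb_rows[OF orth(2)])
  have M: "M > 0"
    using assms(7) by simp
  \<comment> \<open>All claims reduce to \<open>L\<close>, which is \<open>ln (det R)\<close> and
    the value of \<open>K\<close> at the KLT, and to \<open>K U\<close>, the logarithm of the
    product of the variances; Hadamard's inequality is \<open>L \<le> K U\<close>.\<close>
  define L where "L = (\<Sum>j\<in>UNIV. ln (l j))"
  define K where "K U = (\<Sum>i\<in>UNIV. ln (coeff_var R U i))" for U :: "real^'n^'n"
  have pos: "coeff_var R U i > 0" and L_le: "L \<le> K U" if "orthogonal_matrix U" for U i
    using hadamard(1,2)[OF onb_rows[OF that] v eig l] by (simp_all add: coeff_var_row L_def K_def)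
  have "coeff_var R V i = l i" for i
    by (simp add: coeff_var_row eig onb_inner[OF v])
  then have KV: "K V = L"
    by (simp add: K_def L_def)
  have detR: "det R = exp L"
    using l by (simp add: det_eigenbasis[OF v eig] L_def exp_sum)
  have eig0: "R\<^sub>0 *v ?u i = ?d U\<^sub>G i *\<^sub>R ?u i" for i
    unfolding assms(8) by (rule block_diag_part_group_transform[OF transform])
  have d: "?d U\<^sub>G i > 0" for i
    by (rule hadamard(1)[OF u v eig l])
  have detR0: "det R\<^sub>0 = exp (K U\<^sub>G)"
    using d by (simp add: det_eigenbasis[OF u eig0] K_def coeff_var_row exp_sum)
  have C: "C = (K U\<^sub>G - L) / 2"
    using sum_ln_det_on_sectors[OF transform d]
    by (simp add: assms(9) sector_information_def K_def coeff_var_row detR)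
  have geo: "geo_mean_var R U = exp (K U / M)" if "orthogonal_matrix U" for U
    using geo_mean_var_exp[OF pos[OF that]] by (simp add: K_def assms(7))
  have dist: "coding_distortion c R U B = (c * M * exp (- 2 * B / M)) * geo_mean_var R U"
    if "orthogonal_matrix U" for U B
    using coding_distortion_eq[OF assms(6) pos[OF that]] by (simp add: assms(7))
  have rate: "coding_rate c R U D = M / 2 * ln (c * M / D) + K U / 2" if "orthogonal_matrix U" "D > 0" for U D
    using coding_rate_eq[OF assms(6) pos[OF that(1)] that(2)] by (simp add: K_def assms(7))
  have ratio: "(det R\<^sub>0 / det R) powr (1 / M) = exp (2 * C / M)"
  proof -
    have *: "2 * C = K U\<^sub>G - L"
      by (simp add: C)
    show ?thesis
      unfolding * by (simp add: detR detR0 powr_def flip: exp_diff)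
  qed
  have "geo_mean_var R V \<le> geo_mean_var R U" if "orthogonal_matrix U" for U
    using L_le[OF that] M by (simp add: geo[OF that] geo[OF orth(1)] KV divide_right_mono)
  moreover have "coding_distortion c R U\<^sub>G B / coding_distortion c R V B = (det R\<^sub>0 / det R) powr (1 / M)" for B
    using assms(6) M unfolding ratio
    by (simp add: dist[OF orth(1)] dist[OF orth(2)] geo[OF orth(1)] geo[OF orth(2)] KV C diff_divide_distrib exp_diff)
  moreover have "exp (2 * C / M) \<ge> 1"
    using L_le[OF orth(2)] M by (simp add: C)
  moreover have "exp (2 * C / M) = 1 \<longleftrightarrow> weakly_symmetric G \<pi> R"
  proof
    assume "exp (2 * C / M) = 1"
    then have eq: "L = K U\<^sub>G"
      using M by (simp add: C)
    \<comment> \<open>Equality in Hadamard's inequality makes each row an eigenvector of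
      \<open>R\<close> with its variance as eigenvalue, as it always is for the block-diagonal part;
      the two matrices agree on a basis.\<close>
    have "R *v ?u i = R\<^sub>0 *v ?u i" for i
      using hadamard(3)[OF u v eig l] eq by (simp add: eig0 L_def K_def coeff_var_row)
    then have "R *v x = R\<^sub>0 *v x" for x
    proof -
      have lin: "A *v x = (\<Sum>i\<in>UNIV. (?u i \<bullet> x) *\<^sub>R (A *v ?u i))" for A :: "real^'n^'n"
        using linear_sum[OF matrix_vector_mul_linear[of A], of "\<lambda>i. (?u i \<bullet> x) *\<^sub>R ?u i" UNIV]
        by (simp add: onb_expand_UNIV[OF u] matrix_vector_mult_scaleR)
      show ?thesis
        unfolding lin[of R] lin[of "R\<^sub>0"] using \<open>\<And>i. R *v ?u i = R\<^sub>0 *v ?u i\<close> by simp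
    qed
    then have "R = R\<^sub>0"
      by (simp add: matrix_eq)
    then show "weakly_symmetric G \<pi> R"
      unfolding weakly_symmetric_def off_sector_part_def assms(8)[symmetric] by simp
  next
    assume "weakly_symmetric G \<pi> R"
    then have "R = R\<^sub>0"
      by (simp add: weakly_symmetric_def off_sector_part_def assms(8))
    then have "L = K U\<^sub>G"
      using detR detR0 by simp
    then show "exp (2 * C / M) = 1"
      by (simp add: C)
  qed
  moreover have "multi_information \<Omega> X (sectors G \<pi>) = C" if "gaussian_vector \<Omega> X m R" for \<Omega> :: "'w measure" and X m
    using multi_information_sectors[OF transform v eig l that]
    by (simp add: C K_def L_def coeff_var_row)
  moreover have "coding_rate c R V D \<le> coding_rate c R U D" if "orthogonal_matrix U" "D > 0" for U D
    using L_le[OF that(1)] by (simp add: rate[OF that] rate[OF orth(1) that(2)] KV)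
  moreover have "coding_rate c R U\<^sub>G D - coding_rate c R V D = C" if "D > 0" for D
    by (simp add: rate[OF orth(1) that] rate[OF orth(2) that] KV C diff_divide_distrib)
  moreover have "coding_rate c R U\<^sub>G D - (rate_distortion (gaussian_measure m R) D + M / 2 * ln c) = C"
    if D: "D > 0" and pd: "pos_def (R - mat (D / M))" for m D
  proof -
    \<comment> \<open>The distortion per coordinate. Testing positive definiteness of
      \<open>R - mat \<delta>\<close> on the eigenvectors gives \<open>\<delta> < l j\<close>, the
      condition under which the rate-distortion function was computed.\<close>
    define \<delta> where "\<delta> = D / M"
    have \<delta>: "\<delta> > 0" "D = real CARD('n) * \<delta>"
      using D M by (auto simp: \<delta>_def assms(7))
    have "\<delta> < l j" for j
    proof -
      have n: "?v j \<bullet> ?v j = 1"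
        by (simp add: onb_inner[OF v])
      then have "?v j \<noteq> 0"
        by (metis inner_zero_left zero_neq_one)
      then have "0 < ?v j \<bullet> ((R - mat \<delta>) *v ?v j)"
        using pd unfolding pos_def_def \<delta>_def by blast
      also have "\<dots> = l j - \<delta>"
        by (simp add: matrix_vector_mult_diff_rdistrib mat_vector_mult eig inner_diff_right n del: dot_square_norm)
      finally show ?thesis
        by simp
    qed
    then have rd: "rate_distortion (gaussian_measure m R) D = L / 2 - M / 2 * ln \<delta>"
      using rate_distortion_gaussian[OF v eig \<delta>(1), of m] gaussian_rate_def[OF v eig \<delta>(1)]
      by (simp add: \<delta>(2) L_def assms(7))
    \<comment> \<open>Splits the quantizer loss off the rate; after \<open>M / 2 * ln c\<close> is
      subtracted, the terms in \<open>ln \<delta>\<close> cancel and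
      \<open>(K U\<^sub>G - L) / 2\<close> is left at every \<open>D\<close>.\<close>
    have ln: "ln (c * M / D) = ln c - ln \<delta>"
      using assms(6) M D \<delta>(1) by (simp add: \<delta>_def ln_mult ln_div)
    show ?thesis
      unfolding rate[OF orth(2) D] rd ln C by (simp add: algebra_simps diff_divide_distrib)
  qed
  ultimately show ?thesis
    using dist ratio by blast
qed

end
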